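(* Let $(U(t,s))_{t\ge s}$ be an evolution family on a real separable Hilbert space $\mathbb{H}$, and let $(\mu_{t,s})_{t\ge s}$ be infinitely divisible probability measures on $\mathbb{H}$, $\mu_{t,s}=[a_{t,s},R_{t,s},m_{t,s}]$, with $\mu_{t,s}=\mu_{t,r}*(\mu_{r,s}\circ U(t,r)^{-1})$ for all $t\ge r\ge s$. Let $p_{s,t}f(x)=\int_{\mathbb{H}}f(U(t,s)x+y)\,\mu_{t,s}(dy)$ and $\Gamma_{t,s}=R_{t,s}^{-1/2}U(t,s)$. Let $B_b^+(\mathbb{H})$ be the set of bounded non-negative Borel functions on $\mathbb{H}$. Fix $t\ge s$ and consider the statements: (1) $U(t,s)(\mathbb{H})\subset R_{t,s}^{1/2}(\mathbb{H})$. (2) $\|\Gamma_{t,s}\|<\infty$ and for every $\alpha>1$ and $f\in B_b^+(\mathbb{H})$, $$(p_{s,t}f(x))^\alpha\le\exp\Bigl(\frac{\alpha(\|\Gamma_{t,s}\|\cdot|x-y|)^2}{2(\alpha-1)}\Bigr)p_{s,t}f^\alpha(y),\qquad x,y\in\mathbb{H}.\qquad(\ast)$$ (3) $\|\Gamma_{t,s}\|<\infty$ and there exists $\alpha>1$ such that $(\ast)$ holds for all $f\in B_b^+(\mathbb{H})$. (4) $\|\Gamma_{t,s}\|<\infty$ and for every $f\in B_b^+(\mathbb{H})$ with $f>1$, $$p_{s,t}\log f(x)\le\log p_{s,t}f(y)+\frac{\|\Gamma_{t,s}\|^2}{2}|x-y|^2,\qquad x,y\in\mathbb{H}.$$ (5)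 $p_{s,t}$ is strong Feller. Then $(1)\Rightarrow(2)\Rightarrow(3)\Rightarrow(4)\Rightarrow(5)$. In particular, if $m_{t,s}\equiv0$, these statements are equivalent to each other.
   Context: Evolution family: bounded linear operators $U(t,s)$, $t\ge s$, on $\mathbb{H}$ with $U(s,s)=I$, $U(t,r)U(r,s)=U(t,s)$ for $t\ge r\ge s$, and $(t,s)\mapsto U(t,s)x$ continuous for each $x$. $\mu=[a,R,m]$ means that $\mu$ is infinitely divisible with $\int e^{i\langle x,\xi\rangle}\mu(dx)=e^{-\psi(\xi)}$, $\psi(\xi)=-i\langle a,\xi\rangle+\frac12\langle R\xi,\xi\rangle-\int_{\mathbb{H}}\bigl(e^{i\langle\xi,x\rangle}-1-\frac{i\langle\xi,x\rangle}{1+|x|^2}\bigr)m(dx)$, where $a\in\mathbb{H}$, $R$ is a non-negative symmetric trace class operator and $m$ is a Lévy measure. $R_{t,s}^{-1/2}$ is the pseudo-inverse of $R_{t,s}^{1/2}$, and $|\Gamma_{t,s}x|:=\infty$ if $U(t,s)x\notin R_{t,s}^{1/2}(\mathbb{H})$; thus $\|\Gamma_{t,s}\|=\sup_{|x|\le1}|\Gamma_{t,s}x|<\infty$ means that $\Gamma_{t,s}$ is an everywhere defined bounded operator. $p_{s,t}$ is strong Feller if $p_{s,t}f$ is continuous for every bounded Borel $f$. *)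

theory Defs
  imports "HOL-Probability.Probability"
begin

text \<open>
  A real separable Hilbert space is a type of sort \<open>{real_inner, banach, polish_space}\<close>.
  Here \<open>polish_space\<close> is \<open>complete_space + second_countable_topology\<close>; \<open>banach\<close> is
  semantically redundant, but is not derived from the other two classes by the type system.
\<close>

section \<open>Evolution families\<close>

definition evolution_family :: "(real \<Rightarrow> real \<Rightarrow> 'a::real_normed_vector \<Rightarrow>\<^sub>L 'a) \<Rightarrow> bool" where
  "evolution_family U \<longleftrightarrow>
     (\<forall>s. U s s = id_blinfun) \<and>
     (\<forall>s r t. s \<le> r \<and> r \<le> t \<longrightarrow> U t r o\<^sub>L U r s = U t s) \<and>
     (\<forall>x. continuous_on {(t, s). s \<le> t} (\<lambda>(t, s). blinfun_apply (U t s) x))"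

section \<open>Operators on a Hilbert space\<close>

definition nonneg_symmetric :: "('a::real_inner \<Rightarrow>\<^sub>L 'a) \<Rightarrow> bool" where
  "nonneg_symmetric T \<longleftrightarrow>
     (\<forall>x y. inner (T x) y = inner x (T y)) \<and> (\<forall>x. 0 \<le> inner (T x) x)"

text \<open>Trace class (nuclear) operators: \<open>T = (\<Sum>n. \<langle>a n, \<cdot>\<rangle> b n)\<close> with
  \<open>(\<Sum>n. |a n| |b n|) < \<infinity>\<close>.\<close>

definition trace_class :: "('a::real_inner \<Rightarrow>\<^sub>L 'a) \<Rightarrow> bool" where
  "trace_class T \<longleftrightarrow>
     (\<exists>a b :: nat \<Rightarrow> 'a. summable (\<lambda>n. norm (a n) * norm (b n)) \<and>
        (\<forall>x. (\<lambda>n. inner (a n) x *\<^sub>R b n) sums T x))"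

text \<open>The square root is meaningful for non-negative symmetric operators on a Hilbert space,
  where it exists and is unique.\<close>

definition op_sqrt :: "('a::real_inner \<Rightarrow>\<^sub>L 'a) \<Rightarrow> 'a \<Rightarrow>\<^sub>L 'a" where
  "op_sqrt R = (THE S. nonneg_symmetric S \<and> S o\<^sub>L S = R)"

text \<open>The pseudo-inverse maps \<open>y\<close> in the range of \<open>S\<close> to its unique preimage in the orthogonal
  complement of the kernel of \<open>S\<close>; it is only used on the range of \<open>S\<close>.\<close>

definition pseudo_inv :: "('a::real_inner \<Rightarrow>\<^sub>L 'a) \<Rightarrow> 'a \<Rightarrow> 'a" where
  "pseudo_inv S y = (THE x. S x = y \<and> (\<forall>z. S z = 0 \<longrightarrow> inner x z = 0))"

text \<open>For \<open>\<Gamma> = R\<^sup>-\<^sup>1\<^sup>/\<^sup>2 V\<close>, \<open>Gamma_abs V R x\<close> is \<open>|\<Gamma> x|\<close> and \<open>Gamma_norm V R\<close> is \<open>\<parallel>\<Gamma>\<parallel>\<close>,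
  both with values in \<open>[0, \<infinity>]\<close>.\<close>

definition Gamma_abs :: "('a::real_inner \<Rightarrow>\<^sub>L 'a) \<Rightarrow> ('a \<Rightarrow>\<^sub>L 'a) \<Rightarrow> 'a \<Rightarrow> ennreal" where
  "Gamma_abs V R x =
     (if V x \<in> range (op_sqrt R)
      then ennreal (norm (pseudo_inv (op_sqrt R) (V x))) else \<infinity>)"

definition Gamma_norm :: "('a::real_inner \<Rightarrow>\<^sub>L 'a) \<Rightarrow> ('a \<Rightarrow>\<^sub>L 'a) \<Rightarrow> ennreal" where
  "Gamma_norm V R = (SUP x\<in>{x. norm x \<le> 1}. Gamma_abs V R x)"

section \<open>Infinitely divisible measures\<close>

text \<open>The library's \<open>convolution\<close> is restricted to ordered Euclidean spaces.\<close>

definition conv :: "'a::{second_countable_topology, real_normed_vector} measure \<Rightarrow> 'a measure \<Rightarrow> 'a measure"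
  where "conv M N = distr (M \<Otimes>\<^sub>M N) borel (\<lambda>(x, y). x + y)"

primrec conv_power :: "'a::{second_countable_topology, real_normed_vector} measure \<Rightarrow> nat \<Rightarrow> 'a measure"
  where
    "conv_power M 0 = return borel 0"
  | "conv_power M (Suc n) = conv M (conv_power M n)"

definition infinitely_divisible ::
    "'a::{second_countable_topology, real_normed_vector} measure \<Rightarrow> bool" where
  "infinitely_divisible M \<longleftrightarrow>
     prob_space M \<and> sets M = sets borel \<and>
     (\<forall>n\<ge>1. \<exists>N. prob_space N \<and> sets N = sets borel \<and> conv_power N n = M)"

definition levy_measure :: "'a::real_inner measure \<Rightarrow> bool" where
  "levy_measure m \<longleftrightarrow>
     sets m = sets borel \<and> emeasure m {0} = 0 \<and>
     (\<integral>\<^sup>+x. ennreal (min 1 ((norm x)\<^sup>2)) \<partial>m) < \<infinity>"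

definition levy_exponent ::
    "'a::real_inner \<Rightarrow> ('a \<Rightarrow>\<^sub>L 'a) \<Rightarrow> 'a measure \<Rightarrow> 'a \<Rightarrow> complex" where
  "levy_exponent a R m \<xi> =
     - \<i> * of_real (inner a \<xi>) + of_real (inner (R \<xi>) \<xi>) / 2
     - (\<integral>x. exp (\<i> * of_real (inner \<xi> x)) - 1
             - \<i> * of_real (inner \<xi> x) / of_real (1 + (norm x)\<^sup>2) \<partial>m)"

text \<open>\<open>levy_triplet \<mu> a R m\<close> states \<open>\<mu> = [a, R, m]\<close>.\<close>

definition levy_triplet ::
    "'a::{second_countable_topology, real_inner} measure \<Rightarrow> 'a \<Rightarrow> ('a \<Rightarrow>\<^sub>L 'a) \<Rightarrow> 'a measure \<Rightarrow> bool"
  where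
  "levy_triplet \<mu> a R m \<longleftrightarrow>
     infinitely_divisible \<mu> \<and> nonneg_symmetric R \<and> trace_class R \<and> levy_measure m \<and>
     (\<forall>\<xi>. (\<integral>x. exp (\<i> * of_real (inner x \<xi>)) \<partial>\<mu>) = exp (- levy_exponent a R m \<xi>))"

section \<open>The transition operators and their properties\<close>

definition transition_op ::
    "(real \<Rightarrow> real \<Rightarrow> 'a::real_normed_vector \<Rightarrow>\<^sub>L 'a) \<Rightarrow> (real \<Rightarrow> real \<Rightarrow> 'a measure) \<Rightarrow>
     real \<Rightarrow> real \<Rightarrow> ('a \<Rightarrow> real) \<Rightarrow> 'a \<Rightarrow> real" where
  "transition_op U \<mu> s t f x = (\<integral>y. f (U t s x + y) \<partial>\<mu> t s)"

definition bounded_borel :: "('a::topological_space \<Rightarrow> real) set" where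
  "bounded_borel = {f \<in> borel_measurable borel. bounded (range f)}"

definition bounded_borel_nonneg :: "('a::topological_space \<Rightarrow> real) set" where
  "bounded_borel_nonneg = {f \<in> bounded_borel. \<forall>x. 0 \<le> f x}"

definition power_harnack ::
    "(('a::real_normed_vector \<Rightarrow> real) \<Rightarrow> 'a \<Rightarrow> real) \<Rightarrow> real \<Rightarrow> real \<Rightarrow> bool" where
  "power_harnack P C \<alpha> \<longleftrightarrow>
     (\<forall>f\<in>bounded_borel_nonneg. \<forall>x y.
        P f x powr \<alpha> \<le>
          exp (\<alpha> * (C * norm (x - y))\<^sup>2 / (2 * (\<alpha> - 1))) * P (\<lambda>z. f z powr \<alpha>) y)"

definition log_harnack ::
    "(('a::real_normed_vector \<Rightarrow> real) \<Rightarrow> 'a \<Rightarrow> real) \<Rightarrow> real \<Rightarrow> bool" where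
  "log_harnack P C \<longleftrightarrow>
     (\<forall>f\<in>bounded_borel_nonneg. (\<forall>z. f z > 1) \<longrightarrow>
        (\<forall>x y. P (\<lambda>z. ln (f z)) x \<le> ln (P f y) + C\<^sup>2 / 2 * (norm (x - y))\<^sup>2))"

definition strong_feller ::
    "(('a::topological_space \<Rightarrow> real) \<Rightarrow> 'a \<Rightarrow> real) \<Rightarrow> bool" where
  "strong_feller P \<longleftrightarrow> (\<forall>f\<in>bounded_borel. continuous_on UNIV (P f))"

end

theory Submission
  imports Defs
begin

text \<open>
  Only \<open>S1 \<Longrightarrow> S2\<close> and, for \<open>m = 0\<close>, \<open>S5 \<Longrightarrow> S1\<close> use the structure of \<open>\<mu>\<close>. Write
  \<open>S = R\<^sup>1\<^sup>/\<^sup>2\<close> and \<open>V = U(t,s)\<close>.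

  \<open>S1 \<Longrightarrow> S2\<close>. A vector \<open>y\<close> is of the form \<open>S g\<close> with \<open>|g| \<le> n\<close> exactly when
  \<open>|\<langle>y,z\<rangle>| \<le> n |S z|\<close> for all \<open>z\<close> (\<open>range_criterion\<close>); these conditions on \<open>V x\<close> define
  closed sets of \<open>x\<close>, and the Baire category theorem makes \<open>\<Gamma>\<close> bounded
  (\<open>Gamma_norm_finite\<close>). The Harnack inequality then reduces to comparing \<open>\<mu>\<close> with its
  translate by \<open>S g\<close>, where \<open>|g| \<le> \<parallel>\<Gamma>\<parallel> |x - y|\<close>. Let \<open>u = g/|g|\<close> and \<open>v = S u\<close>. As
  \<open>\<langle>v,\<xi>\<rangle>\<^sup>2 \<le> \<langle>R \<xi>,\<xi>\<rangle>\<close>, the characteristic function of \<open>\<mu>\<close> is that of the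
  one-dimensional Gaussian law of \<open>N v\<close>, with \<open>N\<close> standard normal, times the function \<open>\<rho>\<close> with
  triplet \<open>[a, R - v \<otimes> v, m]\<close>. If \<open>\<rho>\<close> belonged to a probability
  measure \<open>\<nu>\<close>, then integrating over \<open>\<nu>\<close> the one-dimensional inequality, which is the
  Cameron-Martin formula followed by Young's inequality (\<open>std_normal_translation_le\<close>), and
  optimising the parameter of Young's inequality would finish the proof.

  The measure \<open>\<nu>\<close> is replaced by a positive operator on trigonometric polynomials
  \<open>\<Sum> c\<^sub>j exp(i\<langle>\<xi>\<^sub>j,x\<rangle>)\<close>: the one that multiplies \<open>c\<^sub>j\<close> by \<open>\<rho>(\<xi>\<^sub>j)\<close>. It maps non-negative
  functions to non-negative functions (\<open>positive_multiplier_levy\<close>). Indeed the multipliers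
  with this property contain the Fourier transforms of finite measures and are closed under
  sums, products and pointwise limits, hence under \<open>exp\<close>; and \<open>\<rho>\<close> is a limit of compound
  Poisson exponentials times a Gaussian factor, which on finitely many frequencies is a product
  of one-dimensional Gaussian transforms. This gives the inequality for trigonometric
  polynomials (\<open>gaussian_factor_translation_le\<close>). It is stable under bounded pointwise limits,
  and such limits of trigonometric polynomials exhaust the bounded Borel functions
  (\<open>bounded_borel_in_bounded_closure_real_trig\<close>).

  \<open>S3 \<Longrightarrow> S4\<close>. Inserting the right point of the segment from \<open>x\<close> to \<open>y\<close> gives the inequality
  for \<open>\<alpha>\<beta>\<close> from those for \<open>\<alpha>\<close> and \<open>\<beta>\<close>, with the exact constant (\<open>power_harnack_mult\<close>).
  So it holds for all powers \<open>\<alpha>\<^sup>n\<close>; apply it to \<open>f\<close> to the power \<open>\<alpha>\<^sup>-\<^sup>n\<close> and let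
  \<open>n \<rightarrow> \<infinity>\<close>.

  \<open>S4 \<Longrightarrow> S5\<close>. For \<open>f \<ge> 1\<close>, apply the log-Harnack inequality to \<open>1 + \<epsilon> f\<close> with \<open>\<epsilon> = |x - y|\<close>.
  Expanding the logarithm shows that \<open>p f\<close> is Lipschitz continuous.

  \<open>S5 \<Longrightarrow> S1\<close> for \<open>m = 0\<close>. If \<open>V x\<close> is not in the range of \<open>S\<close>, the range criterion gives
  \<open>z\<^sub>n\<close> with \<open>\<langle>V x,z\<^sub>n\<rangle> = 1\<close> and \<open>|S z\<^sub>n| < 2\<^sup>-\<^sup>n\<close>. Then \<open>cos \<langle>y - a,z\<^sub>n\<rangle> \<rightarrow> 1\<close> for \<open>\<mu>\<close>-almost
  every \<open>y\<close>, but for no translate of such a \<open>y\<close> by \<open>\<epsilon> V x\<close> with \<open>0 < \<epsilon> \<le> 1\<close>. So \<open>p\<close> maps the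
  indicator of a convergence set to a function that is \<open>1\<close> at \<open>0\<close> and \<open>0\<close> at every
  \<open>\<epsilon> x\<close> (\<open>gaussian_strong_feller_imp_range\<close>).
\<close>

section \<open>Square roots of non-negative symmetric operators\<close>

text \<open>Expand \<open>0 \<le> \<langle>T w, w\<rangle>\<close> for \<open>w = x - T x / \<parallel>T\<parallel>\<close>. The estimate stands in for the spectral
  theorem: it shows \<open>\<parallel>I - T / \<parallel>T\<parallel>\<parallel> \<le> 1\<close>, and that \<open>\<langle>T x, x\<rangle> = 0\<close> forces \<open>T x = 0\<close>.\<close>

lemma nonneg_symmetric_norm_sq_le:
  fixes T :: "'a::real_inner \<Rightarrow>\<^sub>L 'a"
  assumes "nonneg_symmetric T"
  shows "(norm (T x))\<^sup>2 \<le> norm T * inner (T x) x"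
proof (cases "norm T = 0")
  case False
  then have c: "norm T > 0" by simp
  let ?s = "1 / norm T"
  have sym: "\<And>x y. inner (T x) y = inner x (T y)" and nn: "\<And>x. 0 \<le> inner (T x) x"
    using assms by (auto simp: nonneg_symmetric_def)
  have "0 \<le> inner (T (x - ?s *\<^sub>R T x)) (x - ?s *\<^sub>R T x)"
    by (rule nn)
  also have "\<dots> = inner (T x) x - 2 * ?s * (norm (T x))\<^sup>2 + ?s\<^sup>2 * inner (T (T x)) (T x)"
    by (simp add: blinfun.diff_right blinfun.scaleR_right inner_diff_left inner_diff_right
        sym[of "T x" x] dot_square_norm power2_eq_square algebra_simps)
  also have "?s\<^sup>2 * inner (T (T x)) (T x) \<le> ?s\<^sup>2 * (norm T * (norm (T x))\<^sup>2)"
  proof (rule mult_left_mono)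
    have "inner (T (T x)) (T x) \<le> norm (T (T x)) * norm (T x)"
      by (rule norm_cauchy_schwarz)
    also have "\<dots> \<le> (norm T * norm (T x)) * norm (T x)"
      by (intro mult_right_mono norm_blinfun) auto
    finally show "inner (T (T x)) (T x) \<le> norm T * (norm (T x))\<^sup>2"
      by (simp add: power2_eq_square mult.assoc)
  qed simp
  also have "\<dots> = ?s * (norm (T x))\<^sup>2"
    using c by (simp add: power2_eq_square)
  finally have "?s * (norm (T x))\<^sup>2 \<le> inner (T x) x"
    by simp
  then show ?thesis
    using c by (simp add: field_simps)
qed (simp add: zero_blinfun.rep_eq)

lemma blinfun_compose_distribs:
  "(a + b) o\<^sub>L c = (a o\<^sub>L c) + (b o\<^sub>L c)"
  "c o\<^sub>L (a + b) = (c o\<^sub>L a) + (c o\<^sub>L b)"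
  "(a - b) o\<^sub>L c = (a o\<^sub>L c) - (b o\<^sub>L c)"
  "c o\<^sub>L (a - b) = (c o\<^sub>L a) - (c o\<^sub>L b)"
  "(r *\<^sub>R a) o\<^sub>L c = r *\<^sub>R (a o\<^sub>L c)"
  "c o\<^sub>L (r *\<^sub>R a) = r *\<^sub>R (c o\<^sub>L a)"
  by (simp_all add: bounded_bilinear.add_left[OF bounded_bilinear_blinfun_compose]
     bounded_bilinear.add_right[OF bounded_bilinear_blinfun_compose]
     bounded_bilinear.diff_left[OF bounded_bilinear_blinfun_compose]
     bounded_bilinear.diff_right[OF bounded_bilinear_blinfun_compose]
     bounded_bilinear.scaleR_left[OF bounded_bilinear_blinfun_compose]
     bounded_bilinear.scaleR_right[OF bounded_bilinear_blinfun_compose])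

lemma blinfun_compose_id: "id_blinfun o\<^sub>L a = a" "a o\<^sub>L id_blinfun = a"
  by (rule blinfun_eqI; simp)+

lemma blinfun_compose_assoc: "(a o\<^sub>L b) o\<^sub>L c = a o\<^sub>L (b o\<^sub>L c)"
  by (rule blinfun_eqI) simp

text \<open>The fixed points of \<open>Y \<mapsto> (B + Y\<^sup>2) / 2\<close> are the \<open>Y\<close> with \<open>(I - Y)\<^sup>2 = I - B\<close>. The iterates are
  polynomials in \<open>B\<close> with non-negative coefficients, so their norms and increments are dominated
  by the scalar iteration at \<open>B = 1\<close>.\<close>

primrec sqrt_iter :: "('a::real_normed_vector \<Rightarrow>\<^sub>L 'a) \<Rightarrow> nat \<Rightarrow> 'a \<Rightarrow>\<^sub>L 'a" where
  "sqrt_iter B 0 = 0"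
| "sqrt_iter B (Suc n) = (1/2) *\<^sub>R (B + (sqrt_iter B n o\<^sub>L sqrt_iter B n))"

primrec sqrt_iter_majorant :: "nat \<Rightarrow> real" where
  "sqrt_iter_majorant 0 = 0"
| "sqrt_iter_majorant (Suc n) = (1 + (sqrt_iter_majorant n)\<^sup>2) / 2"

lemma sqrt_iter_majorant_bounds: "0 \<le> sqrt_iter_majorant n \<and> sqrt_iter_majorant n \<le> 1"
proof (induction n)
  case (Suc n)
  then have "(sqrt_iter_majorant n)\<^sup>2 \<le> 1"
    by (simp add: power_le_one)
  then show ?case by simp
qed simp

lemma incseq_sqrt_iter_majorant: "incseq sqrt_iter_majorant"
proof (rule incseq_SucI)
  fix n
  have "0 \<le> (1 - sqrt_iter_majorant n)\<^sup>2" by simp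
  then show "sqrt_iter_majorant n \<le> sqrt_iter_majorant (Suc n)"
    by (simp add: power2_eq_square algebra_simps)
qed

lemma norm_sqrt_iter_le:
  assumes "norm B \<le> 1"
  shows "norm (sqrt_iter B n) \<le> sqrt_iter_majorant n"
proof (induction n)
  case (Suc n)
  have "norm (sqrt_iter B (Suc n)) \<le> (norm B + norm (sqrt_iter B n o\<^sub>L sqrt_iter B n)) / 2"
    using norm_triangle_ineq by simp
  also have "norm (sqrt_iter B n o\<^sub>L sqrt_iter B n) \<le> sqrt_iter_majorant n * sqrt_iter_majorant n"
    by (rule order_trans[OF norm_blinfun_compose mult_mono])
      (use Suc sqrt_iter_majorant_bounds[of n] in auto)
  finally show ?case
    using assms by (simp add: power2_eq_square)
qed simp

lemma sqrt_iter_commute: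
  assumes "B o\<^sub>L C = C o\<^sub>L B"
  shows "sqrt_iter B n o\<^sub>L C = C o\<^sub>L sqrt_iter B n"
proof (induction n)
  case (Suc n)
  let ?Y = "sqrt_iter B n"
  have "(?Y o\<^sub>L ?Y) o\<^sub>L C = C o\<^sub>L (?Y o\<^sub>L ?Y)"
    by (metis Suc blinfun_compose_assoc)
  then show ?case
    using assms by (simp add: blinfun_compose_distribs)
qed (simp add: blinfun_eqI)

lemma sqrt_iter_commute_sqrt_iter:
  "sqrt_iter B m o\<^sub>L sqrt_iter B n = sqrt_iter B n o\<^sub>L sqrt_iter B m"
  by (rule sqrt_iter_commute, rule sqrt_iter_commute[symmetric], rule refl)

text \<open>Since the iterates commute, \<open>Y\<^sub>n\<^sub>+\<^sub>1\<^sup>2 - Y\<^sub>n\<^sup>2\<close> factors, in the same way for operators and for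
  the scalar majorant. Convergence in norm follows because the increments of the majorant sum to
  at most \<open>1\<close>.\<close>

lemma norm_sqrt_iter_step_le:
  assumes "norm B \<le> 1"
  shows "norm (sqrt_iter B (Suc n) - sqrt_iter B n) \<le> sqrt_iter_majorant (Suc n) - sqrt_iter_majorant n"
proof (induction n)
  case 0
  then show ?case using assms by simp
next
  case (Suc n)
  let ?Y = "sqrt_iter B" and ?y = sqrt_iter_majorant
  have "?Y (Suc (Suc n)) - ?Y (Suc n)
      = (1/2) *\<^sub>R ((?Y (Suc n) o\<^sub>L ?Y (Suc n)) - (?Y n o\<^sub>L ?Y n))"
    unfolding sqrt_iter.simps(2)[of B "Suc n"]
    by (subst (2) sqrt_iter.simps(2)) (simp only: scaleR_diff_right[symmetric] add_diff_cancel_left)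
  also have "(?Y (Suc n) o\<^sub>L ?Y (Suc n)) - (?Y n o\<^sub>L ?Y n)
      = (?Y (Suc n) - ?Y n) o\<^sub>L (?Y (Suc n) + ?Y n)"
    unfolding blinfun_compose_distribs sqrt_iter_commute_sqrt_iter[of B "Suc n" n]
    by (simp del: sqrt_iter.simps)
  finally have "norm (?Y (Suc (Suc n)) - ?Y (Suc n))
      = norm ((?Y (Suc n) - ?Y n) o\<^sub>L (?Y (Suc n) + ?Y n)) / 2"
    by (simp del: sqrt_iter.simps)
  also have "\<dots> \<le> (norm (?Y (Suc n) - ?Y n) * norm (?Y (Suc n) + ?Y n)) / 2"
    by (intro divide_right_mono norm_blinfun_compose) simp
  also have "\<dots> \<le> ((?y (Suc n) - ?y n) * (?y (Suc n) + ?y n)) / 2"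
  proof (intro divide_right_mono mult_mono Suc)
    show "norm (?Y (Suc n) + ?Y n) \<le> ?y (Suc n) + ?y n"
      by (rule order_trans[OF norm_triangle_ineq add_mono]) (intro norm_sqrt_iter_le assms)+
    show "0 \<le> ?y (Suc n) - ?y n"
      using incseq_SucD[OF incseq_sqrt_iter_majorant, of n] by (simp del: sqrt_iter_majorant.simps)
  qed auto
  also have "\<dots> = ?y (Suc (Suc n)) - ?y (Suc n)"
  proof -
    have "(a - b) * (a + b) / 2 = (1 + a\<^sup>2) / 2 - (1 + b\<^sup>2) / 2" for a b :: real
      by (simp add: power2_eq_square field_simps)
    then show ?thesis
      by (metis sqrt_iter_majorant.simps(2))
  qed
  finally show ?case .
qed

lemma convergent_sqrt_iter:
  fixes B :: "'a::banach \<Rightarrow>\<^sub>L 'a"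
  assumes "norm B \<le> 1"
  shows "convergent (sqrt_iter B)"
proof -
  let ?D = "\<lambda>n. sqrt_iter B (Suc n) - sqrt_iter B n"
  have "convergent sqrt_iter_majorant"
    by (rule Bseq_monoseq_convergent[OF BseqI'[of _ 1]])
      (use sqrt_iter_majorant_bounds incseq_sqrt_iter_majorant in \<open>auto simp: monoseq_iff\<close>)
  then obtain l where "sqrt_iter_majorant \<longlonglongrightarrow> l"
    by (auto simp: convergent_def)
  then have "summable (\<lambda>n. sqrt_iter_majorant (Suc n) - sqrt_iter_majorant n)"
    by (rule telescope_summable)
  then have "summable ?D"
    by (rule summable_comparison_test') (rule norm_sqrt_iter_step_le[OF assms])
  then have "convergent (\<lambda>n. \<Sum>k<n. ?D k)"
    by (simp add: summable_iff_convergent del: sqrt_iter.simps)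
  moreover have "(\<Sum>k<n. ?D k) = sqrt_iter B n" for n
    by (subst sum_lessThan_telescope) simp
  ultimately show ?thesis by simp
qed

text \<open>The square root of \<open>T\<close> is \<open>\<surd>c (I - Y)\<close> with \<open>c = \<parallel>T\<parallel>\<close> and \<open>Y\<close> the limit of the iteration for
  \<open>B = I - T / c\<close>. It commutes with everything that commutes with \<open>T\<close>, as the iterates do; this
  is what makes the root unique.\<close>

lemma nonneg_symmetric_sqrt_exists:
  fixes T :: "'a::{real_inner, banach} \<Rightarrow>\<^sub>L 'a"
  assumes "nonneg_symmetric T"
  obtains S where "nonneg_symmetric S" "S o\<^sub>L S = T"
    "\<And>C. T o\<^sub>L C = C o\<^sub>L T \<Longrightarrow> S o\<^sub>L C = C o\<^sub>L S"
proof (cases "T = 0")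
  case True
  then show ?thesis
    by (intro that[of 0]) (auto simp: nonneg_symmetric_def)
next
  case False
  define c where "c = norm T"
  have c: "c > 0" using False by (simp add: c_def)
  have sym: "\<And>x y. inner (T x) y = inner x (T y)" and nn: "\<And>x. 0 \<le> inner (T x) x"
    using assms by (auto simp: nonneg_symmetric_def)
  define B where "B = id_blinfun - (1/c) *\<^sub>R T"
  have Bsym: "inner (B x) y = inner x (B y)" for x y
    by (simp add: B_def blinfun.diff_left blinfun.scaleR_left inner_diff_left inner_diff_right sym)
  have "norm B \<le> 1"
  proof (rule norm_blinfun_bound)
    fix x
    have "(norm (B x))\<^sup>2 = (norm x)\<^sup>2 - 2 * (1/c) * inner (T x) x + (1/c)\<^sup>2 * (norm (T x))\<^sup>2"
      unfolding power2_norm_eq_inner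
      by (simp add: B_def blinfun.diff_left blinfun.scaleR_left inner_diff_left inner_diff_right
          sym power2_eq_square algebra_simps)
    also have "(1/c)\<^sup>2 * (norm (T x))\<^sup>2 \<le> (1/c)\<^sup>2 * (c * inner (T x) x)"
      unfolding c_def by (intro mult_left_mono nonneg_symmetric_norm_sq_le assms) simp
    also have "\<dots> = (1/c) * inner (T x) x"
      using c by (simp add: power2_eq_square)
    finally have "(norm (B x))\<^sup>2 \<le> (norm x)\<^sup>2 - (1/c) * inner (T x) x"
      by simp
    also have "\<dots> \<le> (norm x)\<^sup>2"
      using c nn[of x] by simp
    finally show "norm (B x) \<le> 1 * norm x"
      by (simp add: power2_le_iff_abs_le)
  qed simp
  from convergent_sqrt_iter[OF this] obtain Y where Y: "sqrt_iter B \<longlonglongrightarrow> Y"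
    by (auto simp: convergent_def)
  have "norm Y \<le> 1"
  proof (rule LIMSEQ_le_const2[OF tendsto_norm[OF Y]], intro exI allI impI)
    fix n show "norm (sqrt_iter B n) \<le> 1"
      using norm_sqrt_iter_le[OF \<open>norm B \<le> 1\<close>] sqrt_iter_majorant_bounds order_trans by blast
  qed
  have fixpoint: "Y = (1/2) *\<^sub>R (B + (Y o\<^sub>L Y))"
  proof (rule LIMSEQ_unique[OF LIMSEQ_Suc[OF Y]])
    show "(\<lambda>n. sqrt_iter B (Suc n)) \<longlonglongrightarrow> (1/2) *\<^sub>R (B + (Y o\<^sub>L Y))"
      unfolding sqrt_iter.simps
      by (intro tendsto_intros bounded_bilinear.tendsto[OF bounded_bilinear_blinfun_compose] Y)
  qed
  have Yapp: "(\<lambda>n. sqrt_iter B n x) \<longlonglongrightarrow> Y x" for x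
    by (intro blinfun.tendsto Y tendsto_const)
  have iter_sym: "inner (sqrt_iter B n x) y = inner x (sqrt_iter B n y)" for n x y
  proof (induction n arbitrary: x y)
    case (Suc n)
    then show ?case
      by (simp add: blinfun.add_left blinfun.scaleR_left inner_add_left inner_add_right Bsym)
  qed simp
  have Ysym: "inner (Y x) y = inner x (Y y)" for x y
    by (rule LIMSEQ_unique[of "\<lambda>n. inner (sqrt_iter B n x) y"])
      (intro tendsto_intros Yapp, simp only: iter_sym, intro tendsto_intros Yapp)
  have Ycomm: "Y o\<^sub>L C = C o\<^sub>L Y" if "T o\<^sub>L C = C o\<^sub>L T" for C
  proof (rule LIMSEQ_unique)
    have "B o\<^sub>L C = C o\<^sub>L B"
      using that by (simp add: B_def blinfun_compose_distribs blinfun_compose_id)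
    then have "sqrt_iter B n o\<^sub>L C = C o\<^sub>L sqrt_iter B n" for n
      by (rule sqrt_iter_commute)
    then show "(\<lambda>n. sqrt_iter B n o\<^sub>L C) \<longlonglongrightarrow> (C o\<^sub>L Y)"
      by (simp only:) (intro bounded_bilinear.tendsto[OF bounded_bilinear_blinfun_compose] tendsto_const Y)
    show "(\<lambda>n. sqrt_iter B n o\<^sub>L C) \<longlonglongrightarrow> (Y o\<^sub>L C)"
      by (intro bounded_bilinear.tendsto[OF bounded_bilinear_blinfun_compose] tendsto_const Y)
  qed
  define Z where "Z = id_blinfun - Y"
  have "Y + Y = B + (Y o\<^sub>L Y)"
    by (subst (1 2) fixpoint) (simp add: scaleR_2[symmetric] del: scaleR_2)
  then have ZZ: "Z o\<^sub>L Z = (1/c) *\<^sub>R T"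
    by (simp add: Z_def B_def blinfun_compose_distribs blinfun_compose_id algebra_simps)
  have Znn: "0 \<le> inner (Z x) x" for x
  proof -
    have "inner (Y x) x \<le> norm (Y x) * norm x"
      by (rule norm_cauchy_schwarz)
    also have "\<dots> \<le> (1 * norm x) * norm x"
      by (intro mult_right_mono order_trans[OF norm_blinfun]) (use \<open>norm Y \<le> 1\<close> in auto)
    finally show ?thesis
      by (simp add: Z_def blinfun.diff_left inner_diff_left power2_norm_eq_inner[symmetric] power2_eq_square)
  qed
  show ?thesis
  proof (rule that)
    show "nonneg_symmetric (sqrt c *\<^sub>R Z)"
      using c Znn by (simp add: nonneg_symmetric_def blinfun.scaleR_left Z_def blinfun.diff_left
          inner_diff_left inner_diff_right Ysym)
    show "(sqrt c *\<^sub>R Z) o\<^sub>L (sqrt c *\<^sub>R Z) = T"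
      using c by (simp add: blinfun_compose_distribs ZZ)
    show "(sqrt c *\<^sub>R Z) o\<^sub>L C = C o\<^sub>L (sqrt c *\<^sub>R Z)" if "T o\<^sub>L C = C o\<^sub>L T" for C
      using Ycomm[OF that] by (simp add: Z_def blinfun_compose_distribs blinfun_compose_id)
  qed
qed

lemma nonneg_symmetric_inner_0_iff:
  fixes T :: "'a::real_inner \<Rightarrow>\<^sub>L 'a"
  assumes "nonneg_symmetric T"
  shows "inner (T x) x = 0 \<longleftrightarrow> T x = 0"
  using nonneg_symmetric_norm_sq_le[OF assms, of x] by auto

text \<open>For \<open>w = S x - T x\<close>, commutation gives \<open>S w + T w = (S\<^sup>2 - T\<^sup>2) x = 0\<close>, so both non-negative
  forms \<open>\<langle>S w, w\<rangle>\<close> and \<open>\<langle>T w, w\<rangle>\<close> vanish. Then \<open>S w = T w = 0\<close>, and symmetry yields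
  \<open>|w|\<^sup>2 = \<langle>x, S w - T w\<rangle> = 0\<close>.\<close>

lemma nonneg_symmetric_sqrt_unique:
  fixes S T :: "'a::real_inner \<Rightarrow>\<^sub>L 'a"
  assumes S: "nonneg_symmetric S" and T: "nonneg_symmetric T"
    and sq: "S o\<^sub>L S = T o\<^sub>L T" and comm: "S o\<^sub>L T = T o\<^sub>L S"
  shows "S = T"
proof (rule blinfun_eqI)
  fix x
  define w where "w = S x - T x"
  have sqx: "S (S u) = T (T u)" and commx: "S (T u) = T (S u)" for u
    using arg_cong[OF sq, of "\<lambda>A. A u"] arg_cong[OF comm, of "\<lambda>A. A u"] by auto
  have zero: "S w + T w = 0"
    by (simp add: w_def blinfun.diff_right sqx commx)
  then have "inner (S w) w + inner (T w) w = 0"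
    by (simp add: inner_add_left[symmetric])
  then have "inner (S w) w = 0" "inner (T w) w = 0"
    using S T by (smt (verit) nonneg_symmetric_def)+
  then have "S w = 0" "T w = 0"
    using nonneg_symmetric_inner_0_iff S T by blast+
  then have "inner w w = 0"
    using S T unfolding nonneg_symmetric_def
    by (metis diff_self inner_diff_left inner_zero_right w_def)
  then show "S x = T x"
    by (simp add: w_def)
qed

lemma op_sqrt_properties:
  fixes R :: "'a::{real_inner, banach} \<Rightarrow>\<^sub>L 'a"
  assumes "nonneg_symmetric R"
  shows "nonneg_symmetric (op_sqrt R)" "op_sqrt R o\<^sub>L op_sqrt R = R"
proof -
  obtain S where S: "nonneg_symmetric S" "S o\<^sub>L S = R"
    and comm: "\<And>C. R o\<^sub>L C = C o\<^sub>L R \<Longrightarrow> S o\<^sub>L C = C o\<^sub>L S"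
    using nonneg_symmetric_sqrt_exists[OF assms] by blast
  have "nonneg_symmetric (op_sqrt R) \<and> op_sqrt R o\<^sub>L op_sqrt R = R"
    unfolding op_sqrt_def
  proof (rule theI2[where a = S])
    fix T assume T: "nonneg_symmetric T \<and> T o\<^sub>L T = R"
    then have "R o\<^sub>L T = T o\<^sub>L R"
      by (metis blinfun_compose_assoc)
    from comm[OF this] show "T = S"
      using nonneg_symmetric_sqrt_unique[OF S(1), of T] S T by simp
  qed (use S in auto)
  then show "nonneg_symmetric (op_sqrt R)" "op_sqrt R o\<^sub>L op_sqrt R = R"
    by auto
qed

lemma norm_op_sqrt_sq:
  fixes R :: "'a::{real_inner, banach} \<Rightarrow>\<^sub>L 'a"
  assumes "nonneg_symmetric R"
  shows "(norm (op_sqrt R z))\<^sup>2 = inner (R z) z"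
proof -
  have "inner (op_sqrt R z) (op_sqrt R z) = inner (op_sqrt R (op_sqrt R z)) z"
    using op_sqrt_properties(1)[OF assms] by (simp add: nonneg_symmetric_def)
  then show ?thesis
    using arg_cong[OF op_sqrt_properties(2)[OF assms], of "\<lambda>A. A z"]
    by (simp add: power2_norm_eq_inner)
qed

section \<open>Operator ranges and the norm of \<open>\<Gamma>\<close>\<close>

text \<open>A minimising sequence \<open>z\<^sub>k\<close> of \<open>J z = |S z|\<^sup>2 / 2 - \<langle>y, z\<rangle>\<close>, which the hypothesis bounds from
  below, need not converge, but by the parallelogram law \<open>S z\<^sub>k\<close> does. Its limit \<open>g\<close> satisfies the
  Euler equation \<open>\<langle>g, S w\<rangle> = \<langle>y, w\<rangle>\<close>, that is \<open>S g = y\<close>. Being a limit of elements of the range of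
  \<open>S\<close>, it is orthogonal to the kernel and inherits the norm bound. So one argument
  provides the pseudo-inverse and its norm, in place of the projection theorem, Riesz
  representation and weak compactness.\<close>

lemma range_criterion:
  fixes S :: "'a::{real_inner, banach} \<Rightarrow>\<^sub>L 'a"
  assumes sym: "\<And>x y. inner (S x) y = inner x (S y)"
    and n: "0 \<le> n" and bd: "\<And>z. \<bar>inner y z\<bar> \<le> n * norm (S z)"
  obtains g where "S g = y" "norm g \<le> n" "\<And>z. S z = 0 \<Longrightarrow> inner g z = 0"
proof -
  define J where "J z = (norm (S z))\<^sup>2 / 2 - inner y z" for z
  have J_ge: "- n\<^sup>2 / 2 \<le> J z" for z
  proof -
    have "0 \<le> (norm (S z) - n)\<^sup>2 / 2" by simp
    also have "\<dots> = (norm (S z))\<^sup>2 / 2 - n * norm (S z) + n\<^sup>2 / 2"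
      by (simp add: power2_eq_square field_simps)
    also have "\<dots> \<le> J z + n\<^sup>2 / 2"
      using bd[of z] by (simp add: J_def)
    finally show ?thesis by simp
  qed
  define i where "i = (INF z. J z)"
  have bdd: "bdd_below (range J)"
    using J_ge by (auto intro!: bdd_belowI)
  have i_le: "i \<le> J z" for z
    unfolding i_def by (intro cINF_lower bdd) simp
  have "\<exists>z. J z < i + inverse (real (Suc k))" for k
    using cInf_lessD[of "range J" "i + inverse (real (Suc k))"] by (auto simp: i_def)
  then obtain z where z: "\<And>k. J (z k) < i + inverse (real (Suc k))"
    by metis
  have J_lim: "(\<lambda>k. J (z k)) \<longlonglongrightarrow> i"
  proof (rule tendsto_sandwich[of "\<lambda>_. i" _ _ "\<lambda>k. i + inverse (real (Suc k))"])
    show "(\<lambda>k. i + inverse (real (Suc k))) \<longlonglongrightarrow> i"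
      using LIMSEQ_inverse_real_of_nat_add[of i] by simp
  qed (use i_le z in \<open>auto intro!: always_eventually less_imp_le\<close>)
  have step: "(norm (S x - S w))\<^sup>2 \<le> 4 * (J x - i) + 4 * (J w - i)" for x w
  proof -
    have "i \<le> J ((1/2) *\<^sub>R (x + w))" by (rule i_le)
    also have "\<dots> = (norm (S x + S w))\<^sup>2 / 8 - inner y x / 2 - inner y w / 2"
    proof -
      have "norm (S ((1/2) *\<^sub>R (x + w))) = norm (S x + S w) / 2"
        by (simp add: blinfun.scaleR_right blinfun.add_right del: scaleR_add_right)
      then show ?thesis
        unfolding J_def by (simp only: power_divide) (simp add: inner_add_right field_simps)
    qed
    finally show ?thesis
      by (simp add: J_def power2_norm_eq_inner inner_diff_left inner_diff_right inner_add_left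
          inner_add_right inner_commute field_simps)
  qed
  have "Cauchy (\<lambda>k. S (z k))"
  proof (rule metric_CauchyI)
    fix e :: real assume e: "0 < e"
    then have "eventually (\<lambda>k. J (z k) < i + e\<^sup>2 / 8) sequentially"
      by (intro order_tendstoD(2)[OF J_lim]) simp
    then obtain M where M: "\<And>k. k \<ge> M \<Longrightarrow> J (z k) < i + e\<^sup>2 / 8"
      by (auto simp: eventually_sequentially)
    show "\<exists>M. \<forall>m\<ge>M. \<forall>k\<ge>M. dist (S (z m)) (S (z k)) < e"
    proof (intro exI allI impI)
      fix m k assume "m \<ge> M" "k \<ge> M"
      have "(norm (S (z m) - S (z k)))\<^sup>2 < e\<^sup>2"
      proof -
        have "4 * (J (z m) - i) + 4 * (J (z k) - i) < 4 * (e\<^sup>2 / 8) + 4 * (e\<^sup>2 / 8)"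
          using M[OF \<open>m \<ge> M\<close>] M[OF \<open>k \<ge> M\<close>] by (intro add_strict_mono mult_strict_left_mono) auto
        then show ?thesis
          using step[of "z m" "z k"] by simp
      qed
      then show "dist (S (z m)) (S (z k)) < e"
        using e by (auto simp: dist_norm intro: power_less_imp_less_base)
    qed
  qed
  then obtain g where g: "(\<lambda>k. S (z k)) \<longlonglongrightarrow> g"
    by (meson Cauchy_convergent_iff convergent_def)
  have Euler: "inner g (S w) = inner y w" for w
  proof -
    define d where "d = inner g (S w) - inner y w"
    have "0 \<le> t * d + t\<^sup>2 * (norm (S w))\<^sup>2 / 2" for t
    proof (rule LIMSEQ_le_const)
      have "J (z k + t *\<^sub>R w) = J (z k) + t * (inner (S (z k)) (S w) - inner y w) + t\<^sup>2 * (norm (S w))\<^sup>2 / 2" for k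
        unfolding J_def power2_norm_eq_inner
        by (simp add: blinfun.scaleR_right blinfun.add_right inner_add_left
            inner_add_right inner_commute power2_eq_square add_divide_distrib algebra_simps)
      then have eq: "J (z k + t *\<^sub>R w) - i = (J (z k) - i) + t * (inner (S (z k)) (S w) - inner y w) + t\<^sup>2 * (norm (S w))\<^sup>2 / 2" for k
        by simp
      show "(\<lambda>k. J (z k + t *\<^sub>R w) - i) \<longlonglongrightarrow> t * d + t\<^sup>2 * (norm (S w))\<^sup>2 / 2"
        unfolding eq d_def
        by (rule tendsto_eq_intros J_lim g refl | simp)+
    qed (use i_le in auto)
    note quad = this
    have "d = 0"
    proof (cases "S w = 0")
      case True
      then show ?thesis using quad[of 1] quad[of "-1"] by simp
    next
      case False
      \<comment> \<open>The minimum of the quadratic in \<open>t\<close> is negative unless \<open>d = 0\<close>.\<close>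
      have "0 \<le> - (d / (norm (S w))\<^sup>2) * d + (- (d / (norm (S w))\<^sup>2))\<^sup>2 * (norm (S w))\<^sup>2 / 2"
        by (rule quad)
      also have "\<dots> = - (d\<^sup>2 / (2 * (norm (S w))\<^sup>2))"
        using False by (simp add: power2_eq_square field_simps)
      finally show ?thesis
        using False by (simp add: divide_le_0_iff)
    qed
    then show ?thesis by (simp add: d_def)
  qed
  show ?thesis
  proof (rule that)
    show "S g = y"
      by (rule vector_eq_rdot[THEN iffD1]) (simp add: sym Euler)
    have "(norm g)\<^sup>2 \<le> n * norm g"
    proof (rule LIMSEQ_le)
      show "(\<lambda>k. inner g (S (z k))) \<longlonglongrightarrow> (norm g)\<^sup>2"
        unfolding power2_norm_eq_inner by (intro tendsto_intros g)
      show "(\<lambda>k. n * norm (S (z k))) \<longlonglongrightarrow> n * norm g"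
        by (intro tendsto_intros g)
      show "\<exists>N. \<forall>k\<ge>N. inner g (S (z k)) \<le> n * norm (S (z k))"
        using bd Euler by (auto intro: order_trans[OF abs_ge_self])
    qed
    then show "norm g \<le> n"
      using n by (cases "norm g = 0") (auto simp: power2_eq_square)
    fix w assume w: "S w = 0"
    have "(\<lambda>k. inner (S (z k)) w) \<longlonglongrightarrow> inner g w"
      by (intro tendsto_intros g)
    moreover have "inner (S (z k)) w = 0" for k
      by (simp add: sym w)
    ultimately show "inner g w = 0"
      by (simp add: LIMSEQ_const_iff)
  qed
qed

text \<open>The criterion also shows that the unique preimage orthogonal to the kernel exists: apply it
  with \<open>n\<close> the norm of any preimage.\<close>

lemma pseudo_inv_properties:
  fixes S :: "'a::{real_inner, banach} \<Rightarrow>\<^sub>L 'a"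
  assumes sym: "\<And>x y. inner (S x) y = inner x (S y)" and y: "y \<in> range S"
  shows "S (pseudo_inv S y) = y"
    and "0 \<le> n \<Longrightarrow> (\<And>z. \<bar>inner y z\<bar> \<le> n * norm (S z)) \<Longrightarrow> norm (pseudo_inv S y) \<le> n"
proof -
  have unique: "pseudo_inv S y = g" if "S g = y" "\<And>z. S z = 0 \<Longrightarrow> inner g z = 0" for g
    unfolding pseudo_inv_def
  proof (rule the_equality)
    fix x assume x: "S x = y \<and> (\<forall>z. S z = 0 \<longrightarrow> inner x z = 0)"
    then have "S (x - g) = 0" using that by (simp add: blinfun.diff_right)
    then have "inner x (x - g) = 0" "inner g (x - g) = 0" using x that by auto
    then have "inner (x - g) (x - g) = 0" by (simp add: inner_diff_left)
    then show "x = g" by simp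
  qed (use that in auto)
  obtain g0 where g0: "y = S g0" using y by auto
  have "\<bar>inner y z\<bar> \<le> norm g0 * norm (S z)" for z
    by (simp add: g0 sym Cauchy_Schwarz_ineq2)
  then obtain g where "S g = y" "\<And>z. S z = 0 \<Longrightarrow> inner g z = 0"
    using range_criterion[OF sym, of "norm g0" y] by (metis norm_ge_zero)
  with unique[of g] show "S (pseudo_inv S y) = y" by simp
  assume "0 \<le> n" "\<And>z. \<bar>inner y z\<bar> \<le> n * norm (S z)"
  then obtain g where "S g = y" "norm g \<le> n" "\<And>z. S z = 0 \<Longrightarrow> inner g z = 0"
    using range_criterion[OF sym] by blast
  with unique[of g] show "norm (pseudo_inv S y) \<le> n" by simp
qed

text \<open>By the range criterion, \<open>V x\<close> satisfies \<open>|\<langle>V x, z\<rangle>| \<le> n |S z|\<close> for all \<open>z\<close>, for some \<open>n\<close>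
  depending on \<open>x\<close>. For fixed \<open>n\<close> this is a closed condition on \<open>x\<close>, so by Baire some \<open>n\<close> serves a
  whole ball, and linearity carries the bound from the ball to all of the space.\<close>

lemma uniform_range_bound:
  fixes S V :: "'a::{real_inner, banach} \<Rightarrow>\<^sub>L 'a"
  assumes sym: "\<And>x y. inner (S x) y = inner x (S y)" and sub: "range V \<subseteq> range S"
  obtains c where "0 \<le> c" "\<And>x z. \<bar>inner (V x) z\<bar> \<le> c * norm x * norm (S z)"
proof -
  define F where "F n = (\<Inter>z. {x. \<bar>inner (V x) z\<bar> \<le> real n * norm (S z)})" for n
  have closed: "closed (F n)" for n
    unfolding F_def
    by (intro closed_INT ballI closed_Collect_le) (intro continuous_intros)+
  have cover: "(\<Union>n. F n) = UNIV"
  proof (rule equalityI[OF subset_UNIV], rule subsetI)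
    fix x
    obtain g where g: "V x = S g" using sub by blast
    obtain n where n: "norm g \<le> real n" using real_arch_simple by blast
    have "\<bar>inner (V x) z\<bar> \<le> real n * norm (S z)" for z
    proof -
      have "\<bar>inner (V x) z\<bar> \<le> norm g * norm (S z)"
        by (simp add: g sym Cauchy_Schwarz_ineq2)
      also have "\<dots> \<le> real n * norm (S z)" by (intro mult_right_mono n) simp
      finally show ?thesis .
    qed
    then show "x \<in> (\<Union>n. F n)" by (auto simp: F_def)
  qed
  have "\<exists>n. interior (F n) \<noteq> {}"
  proof (rule ccontr)
    assume "\<not> ?thesis"
    then have "euclidean interior_of (\<Union>(range F)) = {}"
      using closed by (intro Baire_category_alt completely_metrizable_space_euclidean disjI1) auto
    then show False by (simp add: cover)
  qed
  then obtain n x0 e where e: "e > 0" "ball x0 e \<subseteq> F n"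
    by (metis all_not_in_conv mem_interior)
  have mem: "\<bar>inner (V x) z\<bar> \<le> real n * norm (S z)" if "x \<in> ball x0 e" for x z
    using that e by (auto simp: F_def)
  define c where "c = 4 * real n / e"
  show ?thesis
  proof (rule that)
    show "0 \<le> c" using e by (simp add: c_def)
    fix x z
    show "\<bar>inner (V x) z\<bar> \<le> c * norm x * norm (S z)"
    proof (cases "x = 0")
      case False
      \<comment> \<open>Both \<open>x0\<close> and \<open>x0 + r x\<close> lie in the ball; subtract the two bounds.\<close>
      define r where "r = e / (2 * norm x)"
      have r: "r > 0" using e False by (simp add: r_def)
      have "x0 + r *\<^sub>R x \<in> ball x0 e"
        using e False by (simp add: dist_norm r_def)
      then have "\<bar>inner (V (x0 + r *\<^sub>R x)) z\<bar> \<le> real n * norm (S z)" by (rule mem)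
      moreover have "\<bar>inner (V x0) z\<bar> \<le> real n * norm (S z)"
        using e by (intro mem) simp
      ultimately have "\<bar>r * inner (V x) z\<bar> \<le> 2 * (real n * norm (S z))"
        by (simp add: blinfun.add_right blinfun.scaleR_right inner_add_left)
      then have "r * \<bar>inner (V x) z\<bar> \<le> 2 * (real n * norm (S z))"
        using r by (simp add: abs_mult)
      then show ?thesis
        using r e False by (simp add: r_def c_def field_simps)
    qed simp
  qed
qed

lemma Gamma_norm_finite:
  fixes R V :: "'a::{real_inner, banach} \<Rightarrow>\<^sub>L 'a"
  assumes R: "nonneg_symmetric R" and sub: "range V \<subseteq> range (op_sqrt R)"
  shows "Gamma_norm V R < \<infinity>"
proof -
  define S where "S = op_sqrt R"
  have sym: "\<And>x y. inner (S x) y = inner x (S y)"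
    using op_sqrt_properties(1)[OF R] by (simp add: S_def nonneg_symmetric_def)
  obtain c where c: "0 \<le> c" "\<And>x z. \<bar>inner (V x) z\<bar> \<le> c * norm x * norm (S z)"
    using uniform_range_bound[OF sym] sub unfolding S_def by blast
  have "Gamma_abs V R x \<le> ennreal c" if "norm x \<le> 1" for x
  proof -
    have "norm (pseudo_inv S (V x)) \<le> c * norm x"
      using sub c by (intro pseudo_inv_properties(2)[OF sym]) (auto simp: S_def)
    also have "\<dots> \<le> c" using that c by (simp add: mult_left_le)
    finally show ?thesis using sub by (auto simp: Gamma_abs_def S_def ennreal_leI)
  qed
  then have "Gamma_norm V R \<le> ennreal c"
    unfolding Gamma_norm_def by (intro SUP_least) auto
  then show ?thesis by (simp add: order_le_less_trans)
qed

text \<open>Only \<open>|x| \<le> 1\<close> enters the definition of the norm; homogeneity gives the bound for all \<open>x\<close>.\<close>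

lemma Gamma_norm_preimage:
  fixes R V :: "'a::{real_inner, banach} \<Rightarrow>\<^sub>L 'a"
  assumes R: "nonneg_symmetric R" and fin: "Gamma_norm V R < \<infinity>"
  obtains g where "op_sqrt R g = V x" "norm g \<le> enn2real (Gamma_norm V R) * norm x"
proof -
  define C where "C = enn2real (Gamma_norm V R)"
  have C: "Gamma_norm V R = ennreal C" "0 \<le> C"
    using fin by (auto simp: C_def less_top)
  define S where "S = op_sqrt R"
  have sym: "\<And>x y. inner (S x) y = inner x (S y)"
    using op_sqrt_properties(1)[OF R] by (simp add: S_def nonneg_symmetric_def)
  define w where "w = x /\<^sub>R norm x"
  have "norm w \<le> 1" by (cases "x = 0") (simp_all add: w_def)
  then have "Gamma_abs V R w \<le> ennreal C"
    unfolding C(1)[symmetric] Gamma_norm_def by (intro SUP_upper) simp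
  then have "V w \<in> range S" and nw: "norm (pseudo_inv S (V w)) \<le> C"
    using C by (auto simp: Gamma_abs_def S_def top_unique split: if_splits)
  from pseudo_inv_properties(1)[OF sym this(1)]
  have "S (norm x *\<^sub>R pseudo_inv S (V w)) = V x"
    by (cases "x = 0") (simp_all add: blinfun.scaleR_right w_def)
  moreover have "norm (norm x *\<^sub>R pseudo_inv S (V w)) \<le> C * norm x"
    using mult_left_mono[OF nw, of "norm x"] by (simp add: mult.commute)
  ultimately show ?thesis using that unfolding S_def C_def by blast
qed

section \<open>From the power Harnack inequality to the strong Feller property\<close>

lemma bounded_borel_iff:
  "f \<in> bounded_borel \<longleftrightarrow> f \<in> borel_measurable borel \<and> (\<exists>K. \<forall>x. \<bar>f x\<bar> \<le> K)"
  by (auto simp: bounded_borel_def bounded_iff)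

lemma bounded_borel_nonneg_powr:
  assumes "f \<in> bounded_borel_nonneg" "0 \<le> \<alpha>"
  shows "(\<lambda>z. f z powr \<alpha>) \<in> bounded_borel_nonneg"
proof -
  obtain K where K: "\<And>x. \<bar>f x\<bar> \<le> K" and f: "f \<in> borel_measurable borel" "\<And>x. 0 \<le> f x"
    using assms(1) unfolding bounded_borel_nonneg_def bounded_borel_iff by blast
  have "\<bar>f x powr \<alpha>\<bar> \<le> K powr \<alpha>" for x
    using K[of x] f(2)[of x] assms(2) by (simp add: powr_mono2)
  then show ?thesis
    using f by (auto simp: bounded_borel_nonneg_def bounded_borel_iff)
qed

text \<open>Apply the inequality with exponent \<open>\<alpha>\<close> from \<open>x\<close> to a point \<open>z\<close> of the segment, then the one
  with \<open>\<beta>\<close> from \<open>z\<close> to \<open>y\<close>. If \<open>z\<close> divides the segment in the ratio \<open>\<theta> : 1 - \<theta>\<close>, the exponents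
  add up to a multiple of \<open>A \<theta>\<^sup>2 + B (1 - \<theta>)\<^sup>2\<close> with \<open>A = \<alpha>\<beta> / (\<alpha> - 1)\<close> and
  \<open>B = \<beta> / (\<beta> - 1)\<close>. The minimum over \<open>\<theta>\<close> is \<open>AB / (A + B) = \<alpha>\<beta> / (\<alpha>\<beta> - 1)\<close>, exactly the
  constant for \<open>\<alpha>\<beta>\<close>.\<close>

lemma power_harnack_mult:
  fixes P :: "('a::real_normed_vector \<Rightarrow> real) \<Rightarrow> 'a \<Rightarrow> real"
  assumes pos: "\<And>f x. f \<in> bounded_borel_nonneg \<Longrightarrow> 0 \<le> P f x"
    and a: "1 < \<alpha>" "power_harnack P C \<alpha>" and b: "1 < \<beta>" "power_harnack P C \<beta>"
  shows "power_harnack P C (\<alpha> * \<beta>)"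
  unfolding power_harnack_def
proof (intro ballI allI)
  fix f :: "'a \<Rightarrow> real" and x y :: 'a
  assume f: "f \<in> bounded_borel_nonneg"
  have gt: "1 < \<alpha> * \<beta>" using a b by (simp add: less_1_mult)
  define \<theta> where "\<theta> = (\<alpha> - 1) / (\<alpha> * \<beta> - 1)"
  define z where "z = x + \<theta> *\<^sub>R (y - x)"
  have \<theta>: "0 \<le> \<theta>" "1 - \<theta> = \<alpha> * (\<beta> - 1) / (\<alpha> * \<beta> - 1)"
    using a gt by (auto simp: \<theta>_def field_simps)
  have "0 \<le> 1 - \<theta>" using \<theta> a b gt by simp
  have xz: "norm (x - z) = \<theta> * norm (x - y)"
    using \<theta>(1) by (simp add: z_def norm_minus_commute)
  have "z - y = (1 - \<theta>) *\<^sub>R (x - y)"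
    by (simp add: z_def algebra_simps)
  then have zy: "norm (z - y) = (1 - \<theta>) * norm (x - y)"
    using \<open>0 \<le> 1 - \<theta>\<close> by simp
  have fa: "(\<lambda>u. f u powr \<alpha>) \<in> bounded_borel_nonneg"
    using a by (intro bounded_borel_nonneg_powr f) simp
  define D where "D = (C * norm (x - y))\<^sup>2 / 2"
  define p where "p = \<alpha> * \<theta>\<^sup>2 / (\<alpha> - 1) * D"
  define q where "q = \<beta> * (1 - \<theta>)\<^sup>2 / (\<beta> - 1) * D"
  have 1: "P f x powr \<alpha> \<le> exp p * P (\<lambda>u. f u powr \<alpha>) z"
    using a(2)[unfolded power_harnack_def, rule_format, OF f, of x z]
    unfolding xz p_def D_def by (simp add: power_mult_distrib mult_ac)
  have 2: "P (\<lambda>u. f u powr \<alpha>) z powr \<beta> \<le> exp q * P (\<lambda>u. (f u powr \<alpha>) powr \<beta>) y"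
    using b(2)[unfolded power_harnack_def, rule_format, OF fa, of z y]
    unfolding zy q_def D_def by (simp add: power_mult_distrib mult_ac)
  have "P f x powr (\<alpha> * \<beta>) = (P f x powr \<alpha>) powr \<beta>"
    by (simp add: powr_powr)
  also have "\<dots> \<le> (exp p * P (\<lambda>u. f u powr \<alpha>) z) powr \<beta>"
    using b by (intro powr_mono2 1) auto
  also have "\<dots> = exp (p * \<beta>) * P (\<lambda>u. f u powr \<alpha>) z powr \<beta>"
    using pos[OF fa] by (simp add: powr_mult exp_powr_real)
  also have "\<dots> \<le> exp (p * \<beta>) * (exp q * P (\<lambda>u. (f u powr \<alpha>) powr \<beta>) y)"
    by (intro mult_left_mono 2) simp
  also have "\<dots> = exp (p * \<beta> + q) * P (\<lambda>u. f u powr (\<alpha> * \<beta>)) y"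
    by (simp add: exp_add powr_powr)
  also have "p * \<beta> + q = \<alpha> * \<beta> * (C * norm (x - y))\<^sup>2 / (2 * (\<alpha> * \<beta> - 1))"
  proof -
    have nz: "\<alpha> - 1 \<noteq> 0" "\<beta> - 1 \<noteq> 0" "\<alpha> * \<beta> - 1 \<noteq> 0" using a b gt by auto
    have "\<alpha> * \<theta>\<^sup>2 / (\<alpha> - 1) * \<beta> + \<beta> * (1 - \<theta>)\<^sup>2 / (\<beta> - 1)
        = \<alpha> * \<beta> * ((\<alpha> - 1) + \<alpha> * (\<beta> - 1)) / (\<alpha> * \<beta> - 1)\<^sup>2"
    proof -
      have "\<alpha> * (A / N)\<^sup>2 / A * \<beta> + \<beta> * (\<alpha> * B / N)\<^sup>2 / B = \<alpha> * \<beta> * (A + \<alpha> * B) / N\<^sup>2"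
        if "A \<noteq> 0" "B \<noteq> 0" "N \<noteq> 0" for A B N
        using that by (simp add: power2_eq_square field_simps)
      from this[OF nz] show ?thesis unfolding \<theta>(2) unfolding \<theta>_def .
    qed
    also have "(\<alpha> - 1) + \<alpha> * (\<beta> - 1) = \<alpha> * \<beta> - 1" by (simp add: algebra_simps)
    also have "\<alpha> * \<beta> * (\<alpha> * \<beta> - 1) / (\<alpha> * \<beta> - 1)\<^sup>2 = \<alpha> * \<beta> / (\<alpha> * \<beta> - 1)"
      using nz by (simp add: power2_eq_square)
    finally have "(\<alpha> * \<theta>\<^sup>2 / (\<alpha> - 1) * \<beta> + \<beta> * (1 - \<theta>)\<^sup>2 / (\<beta> - 1)) * D = \<alpha> * \<beta> / (\<alpha> * \<beta> - 1) * D"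
      by simp
    then show ?thesis by (simp add: p_def q_def D_def algebra_simps)
  qed
  finally show "P f x powr (\<alpha> * \<beta>) \<le>
    exp (\<alpha> * \<beta> * (C * norm (x - y))\<^sup>2 / (2 * (\<alpha> * \<beta> - 1))) * P (\<lambda>z. f z powr (\<alpha> * \<beta>)) y" .
qed

lemma power_harnack_power:
  fixes P :: "('a::real_normed_vector \<Rightarrow> real) \<Rightarrow> 'a \<Rightarrow> real"
  assumes pos: "\<And>f x. f \<in> bounded_borel_nonneg \<Longrightarrow> 0 \<le> P f x"
    and a: "1 < \<alpha>" "power_harnack P C \<alpha>"
  shows "power_harnack P C (\<alpha> ^ Suc n)"
proof (induction n)
  case (Suc n)
  then show ?case
    using power_harnack_mult[OF pos a, of "\<alpha> ^ Suc n"] a(1) one_less_power[OF a(1), of "Suc n"] by simp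
qed (use a in simp)

text \<open>The transition operator for one fixed pair of times: \<open>V = U(t,s)\<close> and \<open>M = \<mu>\<^sub>t\<^sub>,\<^sub>s\<close>.\<close>

definition shift_expectation :: "'a::real_normed_vector measure \<Rightarrow> ('a \<Rightarrow>\<^sub>L 'a) \<Rightarrow> ('a \<Rightarrow> real) \<Rightarrow> 'a \<Rightarrow> real" where
  "shift_expectation M V f x = (\<integral>y. f (V x + y) \<partial>M)"

lemma shift_expectation_integrable:
  fixes M :: "'a::real_normed_vector measure"
  assumes "prob_space M" "sets M = sets borel" "f \<in> bounded_borel"
  shows "integrable M (\<lambda>y. f (v + y))"
proof -
  interpret prob_space M by fact
  obtain K where K: "\<And>x. \<bar>f x\<bar> \<le> K" and f: "f \<in> borel_measurable borel"
    using assms by (auto simp: bounded_borel_iff)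
  have "(\<lambda>y. f (v + y)) \<in> borel_measurable borel"
    by (intro measurable_compose[OF _ f] borel_measurable_continuous_onI continuous_intros)
  then have "(\<lambda>y. f (v + y)) \<in> borel_measurable M"
    using assms(2) by (simp cong: measurable_cong_sets)
  then show ?thesis
    using K by (intro integrable_const_bound[of _ K]) auto
qed

lemma ln_one_plus_ge:
  fixes t :: real
  assumes t: "0 \<le> t"
  shows "t - t\<^sup>2 \<le> ln (1 + t)"
proof (cases "t \<le> 1")
  case True
  then show ?thesis using t by (intro ln_one_plus_pos_lower_bound)
next
  case False
  then have "t \<le> t\<^sup>2" by (simp add: power2_eq_square)
  moreover have "0 \<le> ln (1 + t)" using t by simp
  ultimately show ?thesis by linarith
qed

text \<open>Let \<open>b = \<alpha>\<^sup>n\<^sup>+\<^sup>1\<close> and \<open>l = P (ln f) x\<close>. As \<open>f\<^sup>1\<^sup>/\<^sup>b \<ge> 1 + (ln f) / b\<close>, the power inequality for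
  \<open>f\<^sup>1\<^sup>/\<^sup>b\<close> yields \<open>b ln (1 + l / b) \<le> ln (P f y) + b / (b - 1) E\<close>, where \<open>E\<close> is the quadratic
  term. As \<open>b\<close> tends to infinity, the left side tends to \<open>l\<close> and the last coefficient to \<open>1\<close>.\<close>

lemma power_harnack_imp_log_harnack:
  fixes M :: "'a::real_normed_vector measure"
  assumes M: "prob_space M" "sets M = sets borel"
    and a: "1 < \<alpha>" "power_harnack (shift_expectation M V) C \<alpha>"
  shows "log_harnack (shift_expectation M V) C"
  unfolding log_harnack_def
proof (intro ballI impI allI)
  interpret prob_space M by fact
  let ?P = "shift_expectation M V"
  note int = shift_expectation_integrable[OF M]
  have pos: "0 \<le> ?P f x" if "f \<in> bounded_borel_nonneg" for f :: "'a \<Rightarrow> real" and x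
    unfolding shift_expectation_def using that
    by (intro integral_nonneg_AE) (auto simp: bounded_borel_nonneg_def)
  fix f :: "'a \<Rightarrow> real" and x y :: 'a
  assume f: "f \<in> bounded_borel_nonneg" and gt: "\<forall>z. f z > 1"
  obtain K where K: "\<And>x. f x \<le> K" and fm: "f \<in> borel_measurable borel"
    using f by (auto simp: bounded_borel_nonneg_def bounded_borel_iff intro: order_trans[OF abs_ge_self])
  have lnf: "(\<lambda>z. ln (f z)) \<in> bounded_borel"
  proof -
    have "\<bar>ln (f z)\<bar> \<le> ln K" for z
      using gt[rule_format, of z] K[of z] by simp
    then show ?thesis using fm by (auto simp: bounded_borel_iff)
  qed
  have fbb: "f \<in> bounded_borel" using f by (simp add: bounded_borel_nonneg_def)
  define l where "l = ?P (\<lambda>z. ln (f z)) x"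
  have "0 \<le> l"
    unfolding l_def shift_expectation_def using gt
    by (intro Bochner_Integration.integral_nonneg) (simp add: less_imp_le)
  have "1 \<le> ?P f y"
  proof -
    have "(\<integral>u. 1 \<partial>M) \<le> ?P f y"
      unfolding shift_expectation_def
      by (intro integral_mono int[OF fbb]) (use gt in \<open>auto intro: less_imp_le\<close>)
    then show ?thesis by (simp add: prob_space)
  qed
  define E where "E = (C * norm (x - y))\<^sup>2 / 2"
  define b where "b n = \<alpha> ^ Suc n" for n
  have b1: "b n > 1" for n unfolding b_def by (rule one_less_power[OF a(1)]) simp
  have ineq: "b n * ln (1 + l / b n) \<le> ln (?P f y) + b n / (b n - 1) * E" for n
  proof -
    define h where "h = (\<lambda>z. f z powr (1 / b n))"
    have h: "h \<in> bounded_borel_nonneg"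
      unfolding h_def using b1[of n] by (intro bounded_borel_nonneg_powr f) simp
    have "1 + l / b n = (\<integral>u. 1 + ln (f (V x + u)) / b n \<partial>M)"
      using int[OF lnf, of "V x"] by (simp add: l_def shift_expectation_def prob_space)
    also have "\<dots> \<le> ?P h x"
      unfolding shift_expectation_def
    proof (intro integral_mono)
      show "integrable M (\<lambda>u. h (V x + u))"
        using h by (intro int) (simp add: bounded_borel_nonneg_def)
      fix u
      show "1 + ln (f (V x + u)) / b n \<le> h (V x + u)"
        using exp_ge_add_one_self[of "ln (f (V x + u)) / b n"] gt[rule_format, of "V x + u"]
        by (simp add: h_def powr_def)
    qed (use int[OF lnf, of "V x"] in auto)
    finally have le: "1 + l / b n \<le> ?P h x" .
    have p0: "0 < 1 + l / b n" using \<open>0 \<le> l\<close> b1[of n] by (simp add: add_pos_nonneg)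
    have "(1 + l / b n) powr b n \<le> ?P h x powr b n"
      using p0 le b1[of n] by (intro powr_mono2) auto
    also have "\<dots> \<le> exp (b n * (C * norm (x - y))\<^sup>2 / (2 * (b n - 1))) * ?P (\<lambda>z. h z powr b n) y"
      using power_harnack_power[OF pos a, of n] h unfolding b_def power_harnack_def by blast
    also have "(\<lambda>z. h z powr b n) = f"
    proof
      fix u show "h u powr b n = f u"
        using b1[of n] gt[rule_format, of u] by (simp add: h_def powr_powr)
    qed
    finally have "(1 + l / b n) powr b n \<le> exp (b n / (b n - 1) * E) * ?P f y"
      by (simp only: E_def times_divide_times_eq mult.commute[of "b n - 1" 2])
    then have "ln ((1 + l / b n) powr b n) \<le> ln (exp (b n / (b n - 1) * E) * ?P f y)"
      using p0 by (subst ln_le_cancel_iff) (use \<open>1 \<le> ?P f y\<close> in \<open>auto intro: mult_pos_pos\<close>)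
    then show ?thesis
      using p0 \<open>1 \<le> ?P f y\<close> by (simp add: ln_powr ln_mult)
  qed
  have ibn: "(\<lambda>n. inverse (b n)) \<longlonglongrightarrow> 0"
    unfolding b_def power_inverse[symmetric]
    by (intro LIMSEQ_Suc LIMSEQ_realpow_zero) (use a(1) in \<open>auto simp: inverse_le_1_iff inverse_less_1_iff\<close>)
  have "l - l\<^sup>2 * 0 \<le> ln (?P f y) + 1 / (1 - 0) * E"
  proof (rule LIMSEQ_le)
    show "(\<lambda>n. l - l\<^sup>2 * inverse (b n)) \<longlonglongrightarrow> l - l\<^sup>2 * 0"
      by (intro tendsto_intros ibn)
    show "(\<lambda>n. ln (?P f y) + 1 / (1 - inverse (b n)) * E) \<longlonglongrightarrow> ln (?P f y) + 1 / (1 - 0) * E"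
      by (intro tendsto_intros ibn) simp
    show "\<exists>N. \<forall>n\<ge>N. l - l\<^sup>2 * inverse (b n) \<le> ln (?P f y) + 1 / (1 - inverse (b n)) * E"
    proof (intro exI allI impI)
      fix n
      have b0: "b n > 0" "b n - 1 > 0" using b1[of n] by auto
      have "l - l\<^sup>2 * inverse (b n) = b n * (l / b n - (l / b n)\<^sup>2)"
        using b0 by (simp add: power2_eq_square field_simps)
      also have "\<dots> \<le> b n * ln (1 + l / b n)"
        using b0 \<open>0 \<le> l\<close> by (intro mult_left_mono ln_one_plus_ge) auto
      also note ineq[of n]
      also have "b n / (b n - 1) = 1 / (1 - inverse (b n))"
        using b0 by (simp add: field_simps)
      finally show "l - l\<^sup>2 * inverse (b n) \<le> ln (?P f y) + 1 / (1 - inverse (b n)) * E" .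
    qed
  qed
  then show "?P (\<lambda>z. ln (f z)) x \<le> ln (?P f y) + C\<^sup>2 / 2 * (norm (x - y))\<^sup>2"
    by (simp add: l_def E_def power_mult_distrib)
qed

text \<open>For \<open>1 \<le> g \<le> K\<close> and \<open>\<epsilon> > 0\<close>, the bounds \<open>t - t\<^sup>2 \<le> ln (1 + t) \<le> t\<close> turn the log-Harnack
  inequality for \<open>1 + \<epsilon> g\<close> into \<open>P g x \<le> P g y + \<epsilon> K\<^sup>2 + C\<^sup>2 |x - y|\<^sup>2 / (2\<epsilon>)\<close>. The choice
  \<open>\<epsilon> = |x - y|\<close> gives a Lipschitz estimate.\<close>

lemma log_harnack_imp_strong_feller:
  fixes M :: "'a::real_normed_vector measure"
  assumes M: "prob_space M" "sets M = sets borel"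
    and log: "log_harnack (shift_expectation M V) C"
  shows "strong_feller (shift_expectation M V)"
  unfolding strong_feller_def
proof
  interpret prob_space M by fact
  let ?P = "shift_expectation M V"
  note int = shift_expectation_integrable[OF M]
  fix f :: "'a \<Rightarrow> real" assume f: "f \<in> bounded_borel"
  obtain K where K: "\<And>x. \<bar>f x\<bar> \<le> K" and fm: "f \<in> borel_measurable borel"
    using f by (auto simp: bounded_borel_iff)
  define g where "g z = f z + K + 1" for z
  have g: "1 \<le> g z" "g z \<le> 2 * K + 1" for z
    using K[of z] by (auto simp: g_def abs_le_iff)
  have gb: "g \<in> bounded_borel"
  proof -
    have "\<bar>g z\<bar> \<le> 2 * K + 1" for z
      using g[of z] by simp
    moreover have "g \<in> borel_measurable borel"
      using fm by (simp add: g_def[abs_def])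
    ultimately show ?thesis
      by (auto simp: bounded_borel_iff)
  qed
  have Pg: "?P g x = ?P f x + K + 1" for x
    using int[OF f, of "V x"] by (simp add: shift_expectation_def g_def prob_space)
  have Pg1: "1 \<le> ?P g x" for x
  proof -
    have "(\<integral>u. 1 \<partial>M) \<le> ?P g x"
      unfolding shift_expectation_def by (intro integral_mono int[OF gb]) (use g in auto)
    then show ?thesis by (simp add: prob_space)
  qed
  define L where "L = (2 * K + 1)\<^sup>2 + C\<^sup>2 / 2"
  have step: "?P g x \<le> ?P g y + L * norm (x - y)" for x y
  proof (cases "x = y")
    case False
    define e where "e = norm (x - y)"
    have e: "e > 0" using False by (simp add: e_def)
    define h where "h z = 1 + e * g z" for z
    have h1: "h z > 1" for z using e g(1)[of z] by (simp add: h_def)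
    have h2: "h z \<le> 1 + e * (2 * K + 1)" for z using e g(2)[of z] by (simp add: h_def)
    have hb: "h \<in> bounded_borel_nonneg"
    proof -
      have "\<bar>h z\<bar> \<le> 1 + e * (2 * K + 1)" for z using h1[of z] h2[of z] by simp
      moreover have "h \<in> borel_measurable borel"
        using fm by (simp add: h_def[abs_def] g_def)
      ultimately show ?thesis
        using h1 by (auto simp: bounded_borel_nonneg_def bounded_borel_iff intro: less_imp_le order_less_trans[OF zero_less_one])
    qed
    have lnb: "(\<lambda>z. ln (h z)) \<in> bounded_borel"
    proof -
      have "\<bar>ln (h z)\<bar> \<le> ln (1 + e * (2 * K + 1))" for z
        using h1[of z] h2[of z] by simp
      then show ?thesis using hb by (auto simp: bounded_borel_nonneg_def bounded_borel_iff)
    qed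
    have "e * ?P g x - e\<^sup>2 * (2 * K + 1)\<^sup>2 = (\<integral>u. e * g (V x + u) - e\<^sup>2 * (2 * K + 1)\<^sup>2 \<partial>M)"
      using int[OF gb, of "V x"] by (simp add: shift_expectation_def prob_space)
    also have "\<dots> \<le> ?P (\<lambda>z. ln (h z)) x"
      unfolding shift_expectation_def
    proof (intro integral_mono int[OF lnb])
      fix u
      define t where "t = e * g (V x + u)"
      have t: "0 \<le> t" using e g(1)[of "V x + u"] by (simp add: t_def)
      have "t\<^sup>2 \<le> (e * (2 * K + 1))\<^sup>2"
        using t e g(2)[of "V x + u"] by (intro power_mono) (auto simp: t_def)
      moreover have "t - t\<^sup>2 \<le> ln (1 + t)"
        using t by (rule ln_one_plus_ge)
      ultimately show "e * g (V x + u) - e\<^sup>2 * (2 * K + 1)\<^sup>2 \<le> ln (h (V x + u))"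
        by (simp add: h_def t_def power_mult_distrib)
    qed (use int[OF gb, of "V x"] in auto)
    also have "\<dots> \<le> ln (?P h y) + C\<^sup>2 / 2 * (norm (x - y))\<^sup>2"
      using log hb h1 unfolding log_harnack_def by blast
    also have "?P h y = 1 + e * ?P g y"
      using int[OF gb, of "V y"] by (simp add: shift_expectation_def h_def prob_space)
    also have "ln (1 + e * ?P g y) \<le> e * ?P g y"
      using e Pg1[of y] by (intro ln_add_one_self_le_self) simp
    finally have "e * ?P g x \<le> e * (?P g y + L * e)"
      by (simp add: L_def e_def[symmetric] power2_eq_square algebra_simps)
    then show ?thesis using e by (simp add: e_def)
  qed simp
  have "L-lipschitz_on UNIV (?P f)"
  proof (rule lipschitz_onI)
    fix x y
    show "dist (?P f x) (?P f y) \<le> L * dist x y"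
      using step[of x y] step[of y x] by (simp add: Pg dist_norm norm_minus_commute abs_le_iff)
  qed (simp add: L_def)
  then show "continuous_on UNIV (?P f)"
    by (rule lipschitz_on_continuous_on)
qed

section \<open>Positivity-preserving Fourier multipliers\<close>

text \<open>A trigonometric polynomial is given by a list of coefficients and frequencies. The list is not
  determined by the function, so a Fourier multiplier acts on lists; this avoids proving that
  distinct characters are linearly independent.\<close>

definition trig_eval :: "(complex \<times> 'a::real_inner) list \<Rightarrow> 'a \<Rightarrow> complex" where
  "trig_eval l x = (\<Sum>(c, \<xi>)\<leftarrow>l. c * iexp (inner \<xi> x))"

definition trig_mult :: "('a \<Rightarrow> complex) \<Rightarrow> (complex \<times> 'a) list \<Rightarrow> (complex \<times> 'a) list" where
  "trig_mult \<phi> l = map (\<lambda>(c, \<xi>). (\<phi> \<xi> * c, \<xi>)) l"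

text \<open>A substitute for the statement that \<open>\<phi>\<close> is the Fourier transform of a positive measure: the
  operator of convolution with that measure, seen on trigonometric polynomials, preserves
  non-negativity. Unlike the existence of the measure, this property passes to pointwise limits
  without any continuity or tightness.\<close>

definition positive_multiplier :: "('a::real_inner \<Rightarrow> complex) \<Rightarrow> bool" where
  "positive_multiplier \<phi> \<longleftrightarrow>
     (\<forall>l. (\<forall>x. trig_eval l x \<in> \<real>\<^sub>\<ge>\<^sub>0) \<longrightarrow> (\<forall>x. trig_eval (trig_mult \<phi> l) x \<in> \<real>\<^sub>\<ge>\<^sub>0))"

lemma trig_eval_simps [simp]:
  "trig_eval [] x = 0"
  "trig_eval ((c, \<xi>) # l) x = c * iexp (inner \<xi> x) + trig_eval l x"
  "trig_eval (l @ l') x = trig_eval l x + trig_eval l' x"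
  by (simp_all add: trig_eval_def)

lemma trig_mult_simps [simp]:
  "trig_mult \<phi> [] = []"
  "trig_mult \<phi> ((c, \<xi>) # l) = (\<phi> \<xi> * c, \<xi>) # trig_mult \<phi> l"
  "trig_mult \<phi> (l @ l') = trig_mult \<phi> l @ trig_mult \<phi> l'"
  by (simp_all add: trig_mult_def)

lemma trig_mult_trig_mult: "trig_mult \<phi> (trig_mult \<psi> l) = trig_mult (\<lambda>\<xi>. \<phi> \<xi> * \<psi> \<xi>) l"
  by (induction l) (auto simp: mult.assoc)

lemma snd_set_trig_mult: "snd ` set (trig_mult \<phi> l) = snd ` set l"
  by (force simp: trig_mult_def image_image)

lemma trig_mult_cong:
  "(\<And>\<xi>. \<xi> \<in> snd ` set l \<Longrightarrow> \<phi> \<xi> = \<psi> \<xi>) \<Longrightarrow> trig_mult \<phi> l = trig_mult \<psi> l"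
  by (force simp: trig_mult_def)

lemma trig_mult_1: "trig_mult (\<lambda>_. 1) l = l"
  by (induction l) auto

lemma trig_eval_trig_mult_add:
  "trig_eval (trig_mult (\<lambda>\<xi>. \<phi> \<xi> + \<psi> \<xi>) l) x = trig_eval (trig_mult \<phi> l) x + trig_eval (trig_mult \<psi> l) x"
  by (induction l) (auto simp: algebra_simps)

lemma trig_eval_trig_mult_const: "trig_eval (trig_mult (\<lambda>_. c) l) x = c * trig_eval l x"
  by (induction l) (auto simp: algebra_simps)

lemma tendsto_trig_eval_trig_mult:
  assumes "\<And>\<xi>. ((\<lambda>n. \<phi> n \<xi>) \<longlongrightarrow> \<psi> \<xi>) F"
  shows "((\<lambda>n. trig_eval (trig_mult (\<phi> n) l) x) \<longlongrightarrow> trig_eval (trig_mult \<psi> l) x) F"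
  by (induction l) (auto intro!: tendsto_intros assms)

lemma positive_multiplierD:
  "positive_multiplier \<phi> \<Longrightarrow> (\<And>x. trig_eval l x \<in> \<real>\<^sub>\<ge>\<^sub>0) \<Longrightarrow> trig_eval (trig_mult \<phi> l) x \<in> \<real>\<^sub>\<ge>\<^sub>0"
  by (simp add: positive_multiplier_def)

lemma positive_multiplier_mult:
  "positive_multiplier \<phi> \<Longrightarrow> positive_multiplier \<psi> \<Longrightarrow> positive_multiplier (\<lambda>\<xi>. \<phi> \<xi> * \<psi> \<xi>)"
  by (simp add: positive_multiplier_def trig_mult_trig_mult[symmetric])

lemma positive_multiplier_add:
  "positive_multiplier \<phi> \<Longrightarrow> positive_multiplier \<psi> \<Longrightarrow> positive_multiplier (\<lambda>\<xi>. \<phi> \<xi> + \<psi> \<xi>)"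
  by (simp add: positive_multiplier_def trig_eval_trig_mult_add nonneg_Reals_add_I)

lemma positive_multiplier_const: "c \<in> \<real>\<^sub>\<ge>\<^sub>0 \<Longrightarrow> positive_multiplier (\<lambda>_. c)"
  by (simp add: positive_multiplier_def trig_eval_trig_mult_const nonneg_Reals_mult_I)

lemma positive_multiplier_tendsto:
  fixes \<psi> :: "'a::real_inner \<Rightarrow> complex"
  assumes "\<And>\<xi>. (\<lambda>n. \<phi> n \<xi>) \<longlonglongrightarrow> \<psi> \<xi>" and "\<And>n. positive_multiplier (\<phi> n)"
  shows "positive_multiplier \<psi>"
  unfolding positive_multiplier_def
proof (intro allI impI)
  fix l :: "(complex \<times> 'a) list" and x
  assume l: "\<forall>x. trig_eval l x \<in> \<real>\<^sub>\<ge>\<^sub>0"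
  show "trig_eval (trig_mult \<psi> l) x \<in> \<real>\<^sub>\<ge>\<^sub>0"
  proof (rule closed_sequentially[OF closed_nonneg_Reals_complex])
    show "(\<lambda>n. trig_eval (trig_mult (\<phi> n) l) x) \<longlonglongrightarrow> trig_eval (trig_mult \<psi> l) x"
      by (rule tendsto_trig_eval_trig_mult) (rule assms)
  qed (use assms(2) l in \<open>auto simp: positive_multiplier_def\<close>)
qed

text \<open>The partial sums of the exponential series are sums of products of \<open>\<phi>\<close> and non-negative
  constants.\<close>

lemma positive_multiplier_exp:
  assumes "positive_multiplier \<phi>"
  shows "positive_multiplier (\<lambda>\<xi>. exp (\<phi> \<xi>))"
proof (rule positive_multiplier_tendsto)
  show "(\<lambda>n. \<Sum>k<n. of_real (1 / fact k) * \<phi> \<xi> ^ k) \<longlonglongrightarrow> exp (\<phi> \<xi>)" for \<xi>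
    using exp_converges[of "\<phi> \<xi>"] by (simp add: sums_def scaleR_conv_of_real divide_inverse)
  have pow: "positive_multiplier (\<lambda>\<xi>. \<phi> \<xi> ^ k)" for k
  proof (induction k)
    case (Suc k)
    from positive_multiplier_mult[OF assms this] show ?case by simp
  qed (simp add: positive_multiplier_const)
  show "positive_multiplier (\<lambda>\<xi>. \<Sum>k<n. of_real (1 / fact k) * \<phi> \<xi> ^ k)" for n
  proof (induction n)
    case (Suc n)
    have "positive_multiplier (\<lambda>\<xi>. of_real (1 / fact n) * \<phi> \<xi> ^ n)"
      by (intro positive_multiplier_mult pow positive_multiplier_const) (simp add: nonneg_Reals_of_real_iff del: of_real_divide)
    from positive_multiplier_add[OF Suc this] show ?case by simp
  qed (simp add: positive_multiplier_const)
qed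

text \<open>Convolution with a finite measure acts on trigonometric polynomials as the multiplier given by its
  Fourier transform.\<close>

lemma trig_eval_integral:
  fixes M :: "'a::real_inner measure"
  assumes M: "finite_measure M" "sets M = sets borel"
  shows "integrable M (\<lambda>y. trig_eval l (x + y))"
    and "(\<integral>y. trig_eval l (x + y) \<partial>M) = trig_eval (trig_mult (\<lambda>\<xi>. \<integral>y. iexp (inner \<xi> y) \<partial>M) l) x"
proof -
  interpret finite_measure M by fact
  have int: "integrable M (\<lambda>y. iexp (inner \<xi> y))" for \<xi>
    by (rule integrable_const_bound[of _ 1])
      (auto simp: measurable_cong_sets[OF M(2) refl] intro!: borel_measurable_continuous_onI continuous_intros)
  have shift: "iexp (inner \<xi> (x + y)) = iexp (inner \<xi> x) * iexp (inner \<xi> y)" for \<xi> y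
    by (simp add: inner_add_right distrib_left exp_add)
  have "integrable M (\<lambda>y. trig_eval l (x + y)) \<and>
    (\<integral>y. trig_eval l (x + y) \<partial>M) = trig_eval (trig_mult (\<lambda>\<xi>. \<integral>y. iexp (inner \<xi> y) \<partial>M) l) x"
  proof (induction l)
    case (Cons p l)
    obtain c \<xi> where p: "p = (c, \<xi>)" by force
    have i: "integrable M (\<lambda>y. c * iexp (inner \<xi> (x + y)))"
      unfolding shift by (intro integrable_mult_right int)
    have "(\<integral>y. c * iexp (inner \<xi> (x + y)) \<partial>M) = c * (iexp (inner \<xi> x) * (\<integral>y. iexp (inner \<xi> y) \<partial>M))"
      unfolding shift by (simp only: integral_mult_right_zero)
    then show ?case
      using Cons i by (simp add: p mult_ac)
  qed simp
  then show "integrable M (\<lambda>y. trig_eval l (x + y))"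
    and "(\<integral>y. trig_eval l (x + y) \<partial>M) = trig_eval (trig_mult (\<lambda>\<xi>. \<integral>y. iexp (inner \<xi> y) \<partial>M) l) x"
    by auto
qed

lemma integral_nonneg_Reals:
  assumes "\<And>y. f y \<in> \<real>\<^sub>\<ge>\<^sub>0"
  shows "(\<integral>y. f y \<partial>M) \<in> (\<real>\<^sub>\<ge>\<^sub>0 :: complex set)"
proof -
  have "f = (\<lambda>y. of_real (Re (f y)))"
    using assms by (simp add: complex_nonneg_Reals_iff complex_eq_iff fun_eq_iff)
  then have "(\<integral>y. f y \<partial>M) = of_real (\<integral>y. Re (f y) \<partial>M)"
    by (metis integral_complex_of_real)
  moreover have "0 \<le> (\<integral>y. Re (f y) \<partial>M)"
    using assms by (intro Bochner_Integration.integral_nonneg) (auto simp: complex_nonneg_Reals_iff)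
  ultimately show ?thesis by simp
qed

lemma positive_multiplier_fourier:
  fixes M :: "'a::real_inner measure"
  assumes "finite_measure M" "sets M = sets borel"
  shows "positive_multiplier (\<lambda>\<xi>. \<integral>y. iexp (inner \<xi> y) \<partial>M)"
  unfolding positive_multiplier_def trig_eval_integral(2)[OF assms, symmetric]
  by (auto intro: integral_nonneg_Reals)

lemma positive_multiplier_iexp:
  fixes b :: "'a::real_inner"
  shows "positive_multiplier (\<lambda>\<xi>. iexp (inner \<xi> b))"
  unfolding positive_multiplier_def
proof (intro allI impI)
  fix l :: "(complex \<times> 'a) list" and x
  assume l: "\<forall>x. trig_eval l x \<in> \<real>\<^sub>\<ge>\<^sub>0"
  have "trig_eval (trig_mult (\<lambda>\<xi>. iexp (inner \<xi> b)) l) x = trig_eval l (x + b)"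
    by (induction l) (auto simp: inner_add_right distrib_left exp_add mult_ac)
  then show "trig_eval (trig_mult (\<lambda>\<xi>. iexp (inner \<xi> b)) l) x \<in> \<real>\<^sub>\<ge>\<^sub>0"
    using l by simp
qed

text \<open>The law of \<open>N v\<close> for a standard normal variable \<open>N\<close>.\<close>

definition gauss_ray :: "'a::real_normed_vector \<Rightarrow> 'a measure" where
  "gauss_ray v = distr std_normal_distribution borel (\<lambda>r. r *\<^sub>R v)"

lemma prob_space_gauss_ray: "prob_space (gauss_ray v)"
  and sets_gauss_ray [simp]: "sets (gauss_ray v) = sets borel"
proof -
  interpret real_distribution std_normal_distribution by (rule real_dist_normal_dist)
  show "prob_space (gauss_ray v)"
    unfolding gauss_ray_def by (rule prob_space_distr) (auto intro!: borel_measurable_continuous_onI continuous_intros)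
qed (simp add: gauss_ray_def)

lemma gauss_ray_fourier:
  "(\<integral>y. iexp (inner \<xi> y) \<partial>gauss_ray v) = of_real (exp (- (inner \<xi> v)\<^sup>2 / 2))"
proof -
  have "(\<integral>y. iexp (inner \<xi> y) \<partial>gauss_ray v) = (\<integral>r. iexp (inner \<xi> (r *\<^sub>R v)) \<partial>std_normal_distribution)"
    unfolding gauss_ray_def
    by (rule integral_distr) (auto intro!: borel_measurable_continuous_onI continuous_intros)
  also have "\<dots> = char std_normal_distribution (inner \<xi> v)"
    by (simp add: char_def mult.commute)
  finally show ?thesis
    by (simp add: char_std_normal_distribution)
qed

lemma positive_multiplier_gauss_ray:
  "positive_multiplier (\<lambda>\<xi>. of_real (exp (- (inner \<xi> v)\<^sup>2 / 2)))"
  using positive_multiplier_fourier[OF _ sets_gauss_ray, of v]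
    prob_space.axioms(1)[OF prob_space_gauss_ray, of v]
  by (simp add: gauss_ray_fourier)

definition rank_one :: "'a::real_inner \<Rightarrow> 'a \<Rightarrow>\<^sub>L 'a" where
  "rank_one v = blinfun_scaleR_left v o\<^sub>L blinfun_inner_right v"

lemma rank_one_apply [simp]: "rank_one v x = inner v x *\<^sub>R v"
  by (simp add: rank_one_def)

lemma nonneg_symmetric_diff_rank_one:
  assumes T: "nonneg_symmetric T" and le: "\<And>x. (inner v x)\<^sup>2 \<le> inner (T x) x"
  shows "nonneg_symmetric (T - rank_one v)"
  using assms
  by (auto simp: nonneg_symmetric_def blinfun.diff_left inner_diff_left inner_diff_right
      power2_eq_square inner_commute)

text \<open>The discriminant of the non-negative quadratic polynomial \<open>s \<mapsto> \<langle>T (y + s x), y + s x\<rangle>\<close>.\<close>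

lemma nonneg_symmetric_Cauchy_Schwarz:
  fixes T :: "'a::real_inner \<Rightarrow>\<^sub>L 'a"
  assumes T: "nonneg_symmetric T"
  shows "(inner (T x) y)\<^sup>2 \<le> inner (T x) x * inner (T y) y"
proof -
  have sym: "\<And>x y. inner (T x) y = inner x (T y)" and nn: "\<And>x. 0 \<le> inner (T x) x"
    using T by (auto simp: nonneg_symmetric_def)
  have quad: "0 \<le> inner (T y) y + 2 * s * inner (T x) y + s\<^sup>2 * inner (T x) x" for s
    using nn[of "y + s *\<^sub>R x"]
    by (simp add: blinfun.add_right blinfun.scaleR_right inner_add_left inner_add_right
        sym[of y x] inner_commute[of y "T x"] power2_eq_square algebra_simps)
  show ?thesis
  proof (cases "inner (T x) x = 0")
    case True
    have "inner (T x) y = 0"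
    proof (rule ccontr)
      assume "inner (T x) y \<noteq> 0"
      then show False
        using quad[of "- (inner (T y) y + 1) / (2 * inner (T x) y)"] True by (simp add: field_simps)
    qed
    then show ?thesis using True by simp
  next
    case False
    then show ?thesis
      using quad[of "- inner (T x) y / inner (T x) x"] nn[of x]
      by (simp add: power2_eq_square field_simps)
  qed
qed

text \<open>On finitely many frequencies the Gaussian factor is a finite product of one-dimensional ones, by
  a Cholesky decomposition of \<open>T\<close>: if \<open>T \<eta> \<noteq> 0\<close>, split off the rank-one operator of
  \<open>v = T \<eta> / \<langle>T \<eta>, \<eta>\<rangle>\<^sup>1\<^sup>/\<^sup>2\<close>. The remainder \<open>T - v \<otimes> v\<close> is non-negative by the
  Cauchy-Schwarz inequality, it kills \<open>\<eta>\<close>, and it still kills all that \<open>T\<close> kills. The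
  induction is on the number of frequencies that are not yet killed.\<close>

lemma positive_multiplier_quadratic:
  fixes T :: "'a::real_inner \<Rightarrow>\<^sub>L 'a"
  assumes "nonneg_symmetric T"
  shows "positive_multiplier (\<lambda>\<xi>. of_real (exp (- inner (T \<xi>) \<xi> / 2)))"
  unfolding positive_multiplier_def
proof (intro allI impI)
  fix l :: "(complex \<times> 'a) list" and x assume "\<forall>x. trig_eval l x \<in> \<real>\<^sub>\<ge>\<^sub>0"
  then show "trig_eval (trig_mult (\<lambda>\<xi>. of_real (exp (- inner (T \<xi>) \<xi> / 2))) l) x \<in> \<real>\<^sub>\<ge>\<^sub>0"
    using assms
  proof (induction "card {\<xi> \<in> snd ` set l. T \<xi> \<noteq> 0}" arbitrary: l T rule: less_induct)
    case less
    have sym: "\<And>x y. inner (T x) y = inner x (T y)" and nn: "\<And>x. 0 \<le> inner (T x) x"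
      using less.prems by (auto simp: nonneg_symmetric_def)
    show ?case
    proof (cases "\<exists>\<eta> \<in> snd ` set l. T \<eta> \<noteq> 0")
      case False
      then have "trig_mult (\<lambda>\<xi>. of_real (exp (- inner (T \<xi>) \<xi> / 2))) l = trig_mult (\<lambda>_. 1) l"
        by (intro trig_mult_cong) auto
      then show ?thesis using less.prems by (simp add: trig_mult_1)
    next
      case True
      then obtain \<eta> where \<eta>: "\<eta> \<in> snd ` set l" "T \<eta> \<noteq> 0" by blast
      define q where "q = inner (T \<eta>) \<eta>"
      have "q \<noteq> 0"
        using \<eta>(2) nonneg_symmetric_inner_0_iff[OF less.prems(2)] by (simp add: q_def)
      then have q: "q > 0" using nn[of \<eta>] by (simp add: q_def)
      define v where "v = (1 / sqrt q) *\<^sub>R T \<eta>"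
      define T' where "T' = T - rank_one v"
      have T'x: "T' \<xi> = T \<xi> - (inner (T \<eta>) \<xi> / q) *\<^sub>R T \<eta>" for \<xi>
        using q by (simp add: T'_def v_def blinfun.diff_left)
      have vsq: "(inner v \<xi>)\<^sup>2 = (inner (T \<eta>) \<xi>)\<^sup>2 / q" for \<xi>
        using q by (simp add: v_def power_divide)
      have "(inner v \<xi>)\<^sup>2 \<le> inner (T \<xi>) \<xi>" for \<xi>
        using nonneg_symmetric_Cauchy_Schwarz[OF less.prems(2), of \<eta> \<xi>] q
        by (simp add: vsq q_def divide_le_eq mult.commute)
      then have T': "nonneg_symmetric T'"
        unfolding T'_def by (intro nonneg_symmetric_diff_rank_one less.prems)
      define l' where "l' = trig_mult (\<lambda>\<xi>. of_real (exp (- (inner \<xi> v)\<^sup>2 / 2))) l"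
      have set_l': "snd ` set l' = snd ` set l"
        by (simp add: l'_def snd_set_trig_mult)
      have "\<forall>x. trig_eval l' x \<in> \<real>\<^sub>\<ge>\<^sub>0"
        unfolding l'_def using positive_multiplierD[OF positive_multiplier_gauss_ray] less.prems by blast
      moreover have "card {\<xi> \<in> snd ` set l'. T' \<xi> \<noteq> 0} < card {\<xi> \<in> snd ` set l. T \<xi> \<noteq> 0}"
      proof (rule psubset_card_mono)
        have "T' \<xi> = 0" if "T \<xi> = 0" for \<xi>
          using that by (simp add: T'x sym)
        moreover have "T' \<eta> = 0" using q by (simp add: T'x q_def)
        ultimately show "{\<xi> \<in> snd ` set l'. T' \<xi> \<noteq> 0} \<subset> {\<xi> \<in> snd ` set l. T \<xi> \<noteq> 0}"
          unfolding set_l' using \<eta> by blast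
      qed simp
      ultimately have "trig_eval (trig_mult (\<lambda>\<xi>. of_real (exp (- inner (T' \<xi>) \<xi> / 2))) l') x \<in> \<real>\<^sub>\<ge>\<^sub>0"
        using less.hyps T' by blast
      also have "trig_mult (\<lambda>\<xi>. of_real (exp (- inner (T' \<xi>) \<xi> / 2))) l'
          = trig_mult (\<lambda>\<xi>. of_real (exp (- inner (T \<xi>) \<xi> / 2))) l"
        unfolding l'_def trig_mult_trig_mult
      proof (rule trig_mult_cong)
        fix \<xi>
        have "- inner (T' \<xi>) \<xi> / 2 + - (inner \<xi> v)\<^sup>2 / 2 = - inner (T \<xi>) \<xi> / 2"
          unfolding T'_def blinfun.diff_left rank_one_apply inner_diff_left
          by (simp add: power2_eq_square inner_commute diff_divide_distrib)
        then show "complex_of_real (exp (- inner (T' \<xi>) \<xi> / 2)) * of_real (exp (- (inner \<xi> v)\<^sup>2 / 2))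
            = of_real (exp (- inner (T \<xi>) \<xi> / 2))"
          by (simp add: of_real_mult[symmetric] exp_add[symmetric] del: of_real_mult)
      qed
      finally show ?thesis .
    qed
  qed
qed

definition levy_jump :: "'a::real_inner \<Rightarrow> 'a \<Rightarrow> complex" where
  "levy_jump \<xi> x = exp (\<i> * of_real (inner \<xi> x)) - 1
             - \<i> * of_real (inner \<xi> x) / of_real (1 + (norm x)\<^sup>2)"

lemma borel_measurable_levy_jump [measurable]: "levy_jump \<xi> \<in> borel_measurable borel"
proof -
  have "complex_of_real (1 + (norm x)\<^sup>2) \<noteq> 0" for x :: 'a
    by (metis of_real_eq_0_iff add_pos_nonneg less_irrefl zero_le_power2 zero_less_one)
  then show ?thesis
    unfolding levy_jump_def[abs_def]
    by (intro borel_measurable_continuous_onI continuous_intros) simp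
qed

text \<open>For \<open>|x| \<le> 1\<close> compare with the second-order Taylor remainder of the exponential, the
  compensator differing from \<open>i\<langle>\<xi>,x\<rangle>\<close> by a term of order \<open>|x|\<^sup>3\<close>; for \<open>|x| > 1\<close> every
  term is bounded.\<close>

lemma norm_levy_jump_le:
  "cmod (levy_jump \<xi> x) \<le> (2 + norm \<xi> + (norm \<xi>)\<^sup>2) * min 1 ((norm x)\<^sup>2)"
proof -
  define u where "u = inner \<xi> x"
  define n where "n = norm x"
  have n: "0 \<le> n" by (simp add: n_def)
  have pos: "0 < 1 + n\<^sup>2" by (simp add: add_pos_nonneg)
  have u: "\<bar>u\<bar> \<le> norm \<xi> * n" unfolding u_def n_def by (rule Cauchy_Schwarz_ineq2)
  show ?thesis
  proof (cases "n \<le> 1")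
    case True
    have "levy_jump \<xi> x = (iexp u - 1 - \<i> * u) + \<i> * of_real (u * n\<^sup>2 / (1 + n\<^sup>2))"
    proof -
      have "u - u / (1 + n\<^sup>2) = u * n\<^sup>2 / (1 + n\<^sup>2)" using pos by (simp add: field_simps)
      then have "complex_of_real u - of_real u / of_real (1 + n\<^sup>2) = of_real (u * n\<^sup>2 / (1 + n\<^sup>2))"
        by (metis of_real_diff of_real_divide)
      then show ?thesis
        unfolding levy_jump_def u_def[symmetric] n_def[symmetric]
        by (simp only: of_real_power[symmetric] right_diff_distrib times_divide_eq_right
            diff_eq_eq[symmetric] flip: \<open>_ = complex_of_real (u * n\<^sup>2 / (1 + n\<^sup>2))\<close>) simp
    qed
    then have "cmod (levy_jump \<xi> x) \<le> cmod (iexp u - 1 - \<i> * u) + \<bar>u * n\<^sup>2 / (1 + n\<^sup>2)\<bar>"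
      by (metis norm_triangle_ineq norm_mult norm_ii mult_1 norm_of_real)
    also have "cmod (iexp u - 1 - \<i> * u) \<le> u\<^sup>2 / 2"
      using iexp_approx1[of u 1] by (simp add: diff_diff_eq power2_eq_square)
    also have "\<bar>u * n\<^sup>2 / (1 + n\<^sup>2)\<bar> \<le> \<bar>u\<bar> * n\<^sup>2"
    proof -
      have "\<bar>u\<bar> * n\<^sup>2 * 1 \<le> \<bar>u\<bar> * n\<^sup>2 * (1 + n\<^sup>2)"
        by (intro mult_left_mono) auto
      then show ?thesis using pos by (simp add: abs_mult divide_le_eq)
    qed
    also have "u\<^sup>2 / 2 \<le> (norm \<xi>)\<^sup>2 * n\<^sup>2"
    proof -
      have "u\<^sup>2 \<le> (norm \<xi> * n)\<^sup>2" using u by (metis abs_ge_zero power2_abs power_mono)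
      moreover have "u\<^sup>2 / 2 \<le> u\<^sup>2" by simp
      ultimately show ?thesis by (simp only: power_mult_distrib)
    qed
    also have "\<bar>u\<bar> * n\<^sup>2 \<le> norm \<xi> * n\<^sup>2"
    proof (rule mult_right_mono)
      show "\<bar>u\<bar> \<le> norm \<xi>" using u True n by (smt (verit) mult_left_le norm_ge_zero)
    qed simp
    also have "(norm \<xi>)\<^sup>2 * n\<^sup>2 + norm \<xi> * n\<^sup>2 \<le> (2 + norm \<xi> + (norm \<xi>)\<^sup>2) * n\<^sup>2"
      by (simp add: algebra_simps)
    also have "n\<^sup>2 = min 1 (n\<^sup>2)" using True n by (simp add: power_le_one)
    finally show ?thesis unfolding n_def by simp
  next
    case False
    have "cmod (levy_jump \<xi> x) \<le> cmod (iexp u) + 1 + cmod (\<i> * of_real u / of_real (1 + n\<^sup>2))"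
      unfolding levy_jump_def u_def[symmetric] n_def[symmetric]
      by (rule order_trans[OF norm_triangle_ineq4]) (use norm_triangle_ineq4[of "iexp u" 1] in simp)
    also have "cmod (\<i> * of_real u / of_real (1 + n\<^sup>2)) = \<bar>u\<bar> / (1 + n\<^sup>2)"
      using pos by (simp only: norm_divide norm_mult norm_ii norm_of_real abs_of_pos mult_1)
    also have "\<dots> \<le> norm \<xi>"
    proof -
      have "\<bar>u\<bar> \<le> norm \<xi> * (1 + n\<^sup>2)"
      proof (rule order_trans[OF u mult_left_mono])
        show "n \<le> 1 + n\<^sup>2" using False by (simp add: power2_eq_square add_increasing)
      qed simp
      then show ?thesis using pos by (simp add: divide_le_eq)
    qed
    finally have "cmod (levy_jump \<xi> x) \<le> 2 + norm \<xi>" by simp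
    then have "cmod (levy_jump \<xi> x) \<le> 2 + norm \<xi> + (norm \<xi>)\<^sup>2"
      by (rule add_increasing2[rotated]) simp
    moreover have "min 1 (n\<^sup>2) = 1" using False by (simp add: one_le_power)
    ultimately show ?thesis unfolding n_def by simp
  qed
qed

text \<open>For a finite measure the jump integral splits into the Fourier transform of \<open>M\<close>, minus the total
  mass of \<open>M\<close>, minus \<open>i\<langle>\<xi>,b\<rangle>\<close> with \<open>b = \<integral> x / (1 + |x|\<^sup>2) dM\<close>. So its exponential is the
  exponential of a Fourier transform, times a positive constant, times a translation.\<close>

lemma positive_multiplier_compound_poisson:
  fixes M :: "'a::{real_inner, banach, second_countable_topology} measure"
  assumes M: "finite_measure M" "sets M = sets borel"
  shows "positive_multiplier (\<lambda>\<xi>. exp (\<integral>x. levy_jump \<xi> x \<partial>M))"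
proof -
  interpret finite_measure M by fact
  define d where "d x = (1 / (1 + (norm x)\<^sup>2)) *\<^sub>R x" for x :: 'a
  have dm: "d \<in> borel_measurable M"
  proof -
    have "1 + (norm x)\<^sup>2 \<noteq> 0" for x :: 'a
      by (metis add_pos_nonneg less_irrefl zero_le_power2 zero_less_one)
    then show ?thesis
      unfolding measurable_cong_sets[OF M(2) refl] d_def[abs_def]
      by (intro borel_measurable_continuous_onI continuous_intros) simp
  qed
  have "norm (d x) \<le> 1" for x
  proof -
    have "norm x \<le> 1 + (norm x)\<^sup>2"
      using zero_le_power2[of "norm x - 1"] by (simp add: power2_eq_square algebra_simps) (smt (verit) mult_nonneg_nonneg norm_ge_zero)
    then show ?thesis by (simp add: d_def divide_le_eq add_pos_nonneg)
  qed
  then have dint: "integrable M d"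
    using dm by (intro integrable_const_bound[of _ 1]) auto
  define b where "b = (\<integral>x. d x \<partial>M)"
  have eint: "integrable M (\<lambda>y. iexp (inner \<xi> y))" for \<xi>
    by (rule integrable_const_bound[of _ 1])
      (auto simp: measurable_cong_sets[OF M(2) refl] intro!: borel_measurable_continuous_onI continuous_intros)
  have id: "integrable M (\<lambda>x. inner \<xi> (d x))" for \<xi>
    by (intro integrable_inner_right dint)
  have "(\<integral>x. levy_jump \<xi> x \<partial>M) = (\<integral>x. iexp (inner \<xi> x) \<partial>M) + of_real (- measure M (space M)) + \<i> * of_real (inner \<xi> (- b))" for \<xi>
  proof -
    have "levy_jump \<xi> x = iexp (inner \<xi> x) - 1 - \<i> * of_real (inner \<xi> (d x))" for x
      by (simp add: levy_jump_def d_def)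
    then have "(\<integral>x. levy_jump \<xi> x \<partial>M) = (\<integral>x. iexp (inner \<xi> x) \<partial>M) - (\<integral>x. 1 \<partial>M) - \<i> * (\<integral>x. of_real (inner \<xi> (d x)) \<partial>M)"
      using eint[of \<xi>] id[of \<xi>] by simp
    also have "(\<integral>x. of_real (inner \<xi> (d x)) \<partial>M) = complex_of_real (inner \<xi> b)"
      using id[of \<xi>] dint by (simp add: b_def)
    finally show ?thesis by (simp add: scaleR_conv_of_real)
  qed
  then have "(\<lambda>\<xi>. exp (\<integral>x. levy_jump \<xi> x \<partial>M))
    = (\<lambda>\<xi>. exp (\<integral>x. iexp (inner \<xi> x) \<partial>M) * of_real (exp (- measure M (space M))) * iexp (inner \<xi> (- b)))"
    by (simp only: exp_add exp_of_real)
  then show ?thesis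
    by (simp only:) (intro positive_multiplier_mult positive_multiplier_exp
        positive_multiplier_fourier M positive_multiplier_const positive_multiplier_iexp, simp)
qed

text \<open>Remove the jumps of size at most \<open>1/(n+1)\<close>: the rest of the Levy measure is finite, and the jump
  integrals converge by domination, because the integrand vanishes at \<open>x = 0\<close>.\<close>

lemma positive_multiplier_levy_jump:
  fixes m :: "'a::{real_inner, banach, second_countable_topology} measure"
  assumes m: "levy_measure m"
  shows "positive_multiplier (\<lambda>\<xi>. exp (\<integral>x. levy_jump \<xi> x \<partial>m))"
proof (rule positive_multiplier_tendsto)
  have sets: "sets m = sets borel" and fin: "(\<integral>\<^sup>+x. ennreal (min 1 ((norm x)\<^sup>2)) \<partial>m) < \<infinity>"
    using m by (auto simp: levy_measure_def)
  define e where "e n = inverse (real (Suc n))" for n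
  define B where "B n = {x::'a. e n < norm x}" for n
  have B: "B n \<in> sets m" for n
    unfolding sets B_def by measurable
  define M where "M n = density m (indicator (B n))" for n
  have "finite_measure (M n)" for n
  proof (rule finite_measureI)
    have e: "0 < e n" "e n \<le> 1" by (auto simp: e_def field_simps)
    have "ennreal ((e n)\<^sup>2) * emeasure m (B n) = (\<integral>\<^sup>+x. ennreal ((e n)\<^sup>2) * indicator (B n) x \<partial>m)"
      by (rule nn_integral_cmult_indicator[OF B, symmetric])
    also have "\<dots> \<le> (\<integral>\<^sup>+x. ennreal (min 1 ((norm x)\<^sup>2)) \<partial>m)"
    proof (rule nn_integral_mono)
      fix x
      have "(e n)\<^sup>2 \<le> min 1 ((norm x)\<^sup>2)" if "x \<in> B n"
        using that e by (auto simp: B_def power_le_one intro: power_mono)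
      then show "ennreal ((e n)\<^sup>2) * indicator (B n) x \<le> ennreal (min 1 ((norm x)\<^sup>2))"
        by (auto simp: indicator_def intro: ennreal_leI)
    qed
    finally have "ennreal ((e n)\<^sup>2) * emeasure m (B n) < \<infinity>"
      using fin by (rule le_less_trans)
    then have "emeasure m (B n) < \<infinity>"
      using e by (auto simp: ennreal_mult_less_top)
    then show "emeasure (M n) (space (M n)) \<noteq> \<infinity>"
      using B by (simp add: M_def emeasure_density nn_integral_indicator emeasure_restricted less_top)
  qed
  moreover have "sets (M n) = sets borel" for n by (simp add: M_def sets)
  ultimately show "positive_multiplier (\<lambda>\<xi>. exp (\<integral>x. levy_jump \<xi> x \<partial>M n))" for n
    by (rule positive_multiplier_compound_poisson)
  fix \<xi> :: 'a
  have meas: "levy_jump \<xi> \<in> borel_measurable m"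
    unfolding measurable_cong_sets[OF sets refl] by measurable
  have eq: "(\<integral>x. levy_jump \<xi> x \<partial>M n) = (\<integral>x. indicator (B n) x *\<^sub>R levy_jump \<xi> x \<partial>m)" for n
    unfolding M_def using B[of n] meas
    using integral_density[of "levy_jump \<xi>" m "indicator (B n)"] by (simp add: ennreal_indicator)
  show "(\<lambda>n. exp (\<integral>x. levy_jump \<xi> x \<partial>M n)) \<longlonglongrightarrow> exp (\<integral>x. levy_jump \<xi> x \<partial>m)"
    unfolding eq
  proof (intro tendsto_exp integral_dominated_convergence[where w = "\<lambda>x. (2 + norm \<xi> + (norm \<xi>)\<^sup>2) * min 1 ((norm x)\<^sup>2)"])
    show "integrable m (\<lambda>x. (2 + norm \<xi> + (norm \<xi>)\<^sup>2) * min 1 ((norm x)\<^sup>2))"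
      by (intro integrable_mult_right integrableI_nonneg) (use fin in \<open>auto simp: measurable_cong_sets[OF sets refl]\<close>)
    show "AE x in m. (\<lambda>n. indicator (B n) x *\<^sub>R levy_jump \<xi> x) \<longlonglongrightarrow> levy_jump \<xi> x"
    proof (rule AE_I2)
      fix x
      show "(\<lambda>n. indicator (B n) x *\<^sub>R levy_jump \<xi> x) \<longlonglongrightarrow> levy_jump \<xi> x"
      proof (cases "x = 0")
        case False
        have "eventually (\<lambda>n. e n < norm x) sequentially"
          unfolding e_def using False by (intro order_tendstoD(2)[OF LIMSEQ_inverse_real_of_nat]) simp
        then show ?thesis
          by (intro tendsto_eventually) (auto simp: B_def elim: eventually_mono)
      qed (simp add: levy_jump_def)
    qed
    show "AE x in m. norm (indicator (B n) x *\<^sub>R levy_jump \<xi> x) \<le> (2 + norm \<xi> + (norm \<xi>)\<^sup>2) * min 1 ((norm x)\<^sup>2)" for n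
    proof (rule AE_I2)
      fix x
      have "norm (indicator (B n) x *\<^sub>R levy_jump \<xi> x) \<le> norm (levy_jump \<xi> x)"
        by (simp add: indicator_def)
      then show "norm (indicator (B n) x *\<^sub>R levy_jump \<xi> x) \<le> (2 + norm \<xi> + (norm \<xi>)\<^sup>2) * min 1 ((norm x)\<^sup>2)"
        using norm_levy_jump_le order_trans by blast
    qed
  qed (use B meas in auto)
qed

lemma positive_multiplier_levy:
  fixes m :: "'a::{real_inner, banach, second_countable_topology} measure"
  assumes "nonneg_symmetric R" "levy_measure m"
  shows "positive_multiplier (\<lambda>\<xi>. exp (- levy_exponent a R m \<xi>))"
proof -
  have "(\<lambda>\<xi>. exp (- levy_exponent a R m \<xi>)) = (\<lambda>\<xi>. iexp (inner \<xi> a) *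
     of_real (exp (- inner (R \<xi>) \<xi> / 2)) * exp (\<integral>x. levy_jump \<xi> x \<partial>m))"
  proof
    fix \<xi>
    have "- levy_exponent a R m \<xi> = \<i> * of_real (inner \<xi> a) + of_real (- inner (R \<xi>) \<xi> / 2) + (\<integral>x. levy_jump \<xi> x \<partial>m)"
      by (simp add: levy_exponent_def levy_jump_def[abs_def] inner_commute)
    then show "exp (- levy_exponent a R m \<xi>) = iexp (inner \<xi> a) *
     of_real (exp (- inner (R \<xi>) \<xi> / 2)) * exp (\<integral>x. levy_jump \<xi> x \<partial>m)"
      by (simp only: exp_add exp_of_real)
  qed
  then show ?thesis
    by (simp only:) (intro positive_multiplier_mult positive_multiplier_iexp
        positive_multiplier_quadratic positive_multiplier_levy_jump assms)
qed

section \<open>Bounded pointwise limits of trigonometric polynomials\<close>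

text \<open>The least class of functions that contains \<open>S\<close> and all pointwise limits of its uniformly bounded
  sequences. An inequality between integrals that is stable under dominated convergence extends
  from \<open>S\<close> to this class by rule induction.\<close>

inductive_set bounded_closure :: "('a \<Rightarrow> real) set \<Rightarrow> ('a \<Rightarrow> real) set" for S where
  base: "f \<in> S \<Longrightarrow> f \<in> bounded_closure S"
| lim: "(\<And>n. F n \<in> bounded_closure S) \<Longrightarrow> (\<And>n x. \<bar>F n x\<bar> \<le> K) \<Longrightarrow>
    (\<And>x. (\<lambda>n. F n x) \<longlonglongrightarrow> f x) \<Longrightarrow> f \<in> bounded_closure (S :: ('a \<Rightarrow> real) set)"

text \<open>A monotone class theorem for algebras of bounded functions: the closure contains the
  indicators of a \<open>\<sigma>\<close>-algebra that includes all sets \<open>{f > c}\<close> with \<open>f \<in> S\<close>, and all bounded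
  functions measurable with respect to any \<open>\<sigma>\<close>-algebra of sets whose indicators lie in it.\<close>

locale bounded_function_algebra =
  fixes S :: "('a \<Rightarrow> real) set"
  assumes bounded: "f \<in> S \<Longrightarrow> \<exists>K. \<forall>x. \<bar>f x\<bar> \<le> K"
    and const: "(\<lambda>_. c) \<in> S"
    and add: "f \<in> S \<Longrightarrow> g \<in> S \<Longrightarrow> (\<lambda>x. f x + g x) \<in> S"
    and mult: "f \<in> S \<Longrightarrow> g \<in> S \<Longrightarrow> (\<lambda>x. f x * g x) \<in> S"
begin

lemma bounded_closure_bounded:
  assumes "f \<in> bounded_closure S"
  obtains K where "\<And>x. \<bar>f x\<bar> \<le> K"
proof -
  from assms have "\<exists>K. \<forall>x. \<bar>f x\<bar> \<le> K"
  proof induction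
    case (lim F K f)
    have "\<bar>f x\<bar> \<le> K" for x
      by (rule LIMSEQ_le_const2[OF tendsto_rabs[OF lim(3)]]) (use lim(2) in blast)
    then show ?case by blast
  qed (use bounded in blast)
  then show ?thesis using that by blast
qed

text \<open>Two inductions: fix an element of \<open>S\<close> and close up in the other argument, then fix an arbitrary
  element of the closure.\<close>

lemma bounded_closure_binop:
  fixes h :: "real \<Rightarrow> real \<Rightarrow> real"
  assumes cont: "\<And>X Y x y. X \<longlonglongrightarrow> x \<Longrightarrow> Y \<longlonglongrightarrow> y \<Longrightarrow> (\<lambda>n. h (X n) (Y n)) \<longlonglongrightarrow> h x y"
    and bdd: "\<And>K L. \<exists>B. \<forall>x y. \<bar>x\<bar> \<le> K \<longrightarrow> \<bar>y\<bar> \<le> L \<longrightarrow> \<bar>h x y\<bar> \<le> B"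
    and closed: "\<And>f g. f \<in> S \<Longrightarrow> g \<in> S \<Longrightarrow> (\<lambda>x. h (f x) (g x)) \<in> S"
    and f: "f \<in> bounded_closure S" and g: "g \<in> bounded_closure S"
  shows "(\<lambda>x. h (f x) (g x)) \<in> bounded_closure S"
proof -
  have step: "(\<lambda>x. h (f x) (g x)) \<in> bounded_closure S" if "g \<in> S" "f \<in> bounded_closure S" for f g
    using that(2)
  proof induction
    case (base f)
    then show ?case using closed that(1) by (intro bounded_closure.base)
  next
    case (lim F K f)
    obtain L where L: "\<And>x. \<bar>g x\<bar> \<le> L" using bounded \<open>g \<in> S\<close> by blast
    obtain B where B: "\<And>x y. \<bar>x\<bar> \<le> K \<Longrightarrow> \<bar>y\<bar> \<le> L \<Longrightarrow> \<bar>h x y\<bar> \<le> B" using bdd[of K L] by blast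
    show ?case
      by (rule bounded_closure.lim[OF lim.IH B[OF lim.hyps(2) L] cont[OF lim.hyps(3) tendsto_const]])
  qed
  from g show ?thesis
  proof induction
    case (base g)
    then show ?case using step f by blast
  next
    case (lim G L g)
    obtain K where K: "\<And>x. \<bar>f x\<bar> \<le> K" using bounded_closure_bounded f by blast
    obtain B where B: "\<And>x y. \<bar>x\<bar> \<le> K \<Longrightarrow> \<bar>y\<bar> \<le> L \<Longrightarrow> \<bar>h x y\<bar> \<le> B" using bdd[of K L] by blast
    show ?case
      by (rule bounded_closure.lim[OF lim.IH B[OF K lim.hyps(2)] cont[OF tendsto_const lim.hyps(3)]])
  qed
qed

lemma bounded_closure_add:
  assumes "f \<in> bounded_closure S" "g \<in> bounded_closure S"
  shows "(\<lambda>x. f x + g x) \<in> bounded_closure S"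
proof (rule bounded_closure_binop[OF _ _ add assms])
  show "\<exists>B. \<forall>x y. \<bar>x\<bar> \<le> K \<longrightarrow> \<bar>y\<bar> \<le> L \<longrightarrow> \<bar>x + y\<bar> \<le> B" for K L :: real
    by (rule exI[of _ "K + L"]) auto
qed (auto intro: tendsto_add)

lemma bounded_closure_mult:
  assumes "f \<in> bounded_closure S" "g \<in> bounded_closure S"
  shows "(\<lambda>x. f x * g x) \<in> bounded_closure S"
proof (rule bounded_closure_binop[OF _ _ mult assms])
  show "\<exists>B. \<forall>x y. \<bar>x\<bar> \<le> K \<longrightarrow> \<bar>y\<bar> \<le> L \<longrightarrow> \<bar>x * y\<bar> \<le> B" for K L :: real
    by (rule exI[of _ "K * L"]) (auto simp: abs_mult intro!: mult_mono)
qed (auto intro: tendsto_mult)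

lemma bounded_closure_const: "(\<lambda>_. c) \<in> bounded_closure S"
  by (intro bounded_closure.base const)

text \<open>An algebra of bounded functions is stable under polynomials, and Weierstrass' theorem applies
  to \<open>\<phi>\<close> on a compact interval containing the values of \<open>f\<close>.\<close>

lemma polynomial_approximation:
  fixes \<phi> :: "real \<Rightarrow> real"
  assumes f: "f \<in> S" and \<phi>: "continuous_on UNIV \<phi>" and e: "0 < e"
  obtains g where "g \<in> S" "\<And>x. \<bar>\<phi> (f x) - g x\<bar> < e"
proof -
  obtain K where K: "\<And>x. \<bar>f x\<bar> \<le> K" using bounded f by blast
  obtain p where p: "real_polynomial_function p" "\<And>t. t \<in> {-K..K} \<Longrightarrow> \<bar>\<phi> t - p t\<bar> < e"
    using Stone_Weierstrass_real_polynomial_function[of "{-K..K}" \<phi> e] \<phi> e continuous_on_subset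
    by (metis compact_Icc subset_UNIV)
  have "(\<lambda>x. p (f x)) \<in> S"
    using p(1)
  proof induction
    case (linear q)
    have "q (f x) = f x * q 1" for x
      using linear_simps(5)[OF linear, of "f x" 1] by simp
    then show ?case using mult[OF f const] by simp
  qed (auto intro: const add mult)
  moreover have "\<bar>\<phi> (f x) - p (f x)\<bar> < e" for x
    using K[of x] by (intro p(2)) (auto simp: abs_le_iff)
  ultimately show ?thesis using that by blast
qed

lemma bounded_closure_continuous:
  fixes \<phi> :: "real \<Rightarrow> real"
  assumes f: "f \<in> S" and \<phi>: "continuous_on UNIV \<phi>"
  shows "(\<lambda>x. \<phi> (f x)) \<in> bounded_closure S"
proof -
  obtain K where K: "\<And>x. \<bar>f x\<bar> \<le> K" using bounded f by blast
  have "bounded (\<phi> ` {-K..K})"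
    by (intro compact_imp_bounded compact_continuous_image continuous_on_subset[OF \<phi>]) auto
  then obtain B where B: "\<And>t. t \<in> {-K..K} \<Longrightarrow> \<bar>\<phi> t\<bar> \<le> B"
    unfolding bounded_iff real_norm_def by (metis imageI)
  have "\<exists>g\<in>S. \<forall>x. \<bar>\<phi> (f x) - g x\<bar> < inverse (real (Suc n))" for n
    using polynomial_approximation[OF f \<phi>, of "inverse (real (Suc n))"] by (metis inverse_positive_iff_positive of_nat_0_less_iff zero_less_Suc)
  then obtain g where g: "\<And>n. g n \<in> S" "\<And>n x. \<bar>\<phi> (f x) - g n x\<bar> < inverse (real (Suc n))"
    by metis
  show ?thesis
  proof (rule bounded_closure.lim[where F = g and K = "B + 1"])
    fix n x
    have "inverse (real (Suc n)) \<le> 1" by (simp add: field_simps)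
    then show "\<bar>g n x\<bar> \<le> B + 1"
      using g(2)[of x n] B[of "f x"] K[of x] by (auto simp: abs_le_iff)
  next
    fix x
    have "(\<lambda>n. \<phi> (f x) - g n x) \<longlonglongrightarrow> 0"
      by (rule Lim_null_comparison[OF _ LIMSEQ_inverse_real_of_nat])
        (use g(2) in \<open>auto intro!: always_eventually less_imp_le\<close>)
    from tendsto_diff[OF tendsto_const this, of "\<phi> (f x)"] show "(\<lambda>n. g n x) \<longlonglongrightarrow> \<phi> (f x)"
      by simp
  qed (intro bounded_closure.base g(1))
qed

text \<open>The indicator of \<open>{f > c}\<close> is the limit of the functions \<open>n (f - c)\<close> clipped to \<open>[0, 1]\<close>.\<close>

lemma bounded_closure_indicator_greater:
  assumes f: "f \<in> S"
  shows "(indicator {x. c < f x} :: 'a \<Rightarrow> real) \<in> bounded_closure S"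
proof (rule bounded_closure.lim[where F = "\<lambda>n x. min 1 (max 0 (real n * (f x - c)))" and K = 1])
  show "(\<lambda>x. min 1 (max 0 (real n * (f x - c)))) \<in> bounded_closure S" for n
    by (rule bounded_closure_continuous[OF f]) (intro continuous_intros)
  fix x
  show "(\<lambda>n. min 1 (max 0 (real n * (f x - c)))) \<longlonglongrightarrow> indicator {x. c < f x} x"
  proof (cases "c < f x")
    case True
    obtain N where N: "1 / (f x - c) < real N" using reals_Archimedean2 by blast
    have "min 1 (max 0 (real n * (f x - c))) = 1" if "n \<ge> N" for n
    proof -
      have "1 \<le> real N * (f x - c)" using N True by (simp add: field_simps)
      also have "\<dots> \<le> real n * (f x - c)" using that True by (intro mult_right_mono) auto
      finally show ?thesis by simp
    qed
    then show ?thesis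
      using True by (intro tendsto_eventually) (auto simp: eventually_sequentially)
  next
    case False
    then have "min 1 (max 0 (real n * (f x - c))) = 0" for n
      by (simp add: mult_nonneg_nonpos)
    then show ?thesis using False by simp
  qed
qed auto

text \<open>Complements and finite intersections are algebraic operations on indicators; a countable
  intersection is a bounded limit of finite ones.\<close>

lemma sigma_algebra_bounded_closure:
  "sigma_algebra UNIV {A. (indicator A :: 'a \<Rightarrow> real) \<in> bounded_closure S}"
proof (rule sigma_algebra_iff2[THEN iffD2], intro conjI ballI allI impI)
  let ?ind = "\<lambda>A. (indicator A :: 'a \<Rightarrow> real) \<in> bounded_closure S"
  have "(\<lambda>_. 0) \<in> bounded_closure S" by (rule bounded_closure_const)
  moreover have "(indicator {} :: 'a \<Rightarrow> real) = (\<lambda>_. 0)" by (simp add: fun_eq_iff)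
  ultimately show "{} \<in> {A. ?ind A}" by simp
  show compl: "UNIV - A \<in> {A. ?ind A}" if A: "A \<in> {A. ?ind A}" for A
  proof -
    have "(\<lambda>x. 1 + (- 1) * indicator A x) \<in> bounded_closure S"
      using A by (intro bounded_closure_add bounded_closure_mult bounded_closure_const) simp
    moreover have "(indicator (UNIV - A) :: 'a \<Rightarrow> real) = (\<lambda>x. 1 + (- 1) * indicator A x)"
      by (auto simp: fun_eq_iff indicator_def)
    ultimately show ?thesis by simp
  qed
  have Int: "?ind (A \<inter> B)" if "?ind A" "?ind B" for A B
    using bounded_closure_mult[OF that] by (simp add: indicator_inter_arith[abs_def])
  fix A :: "nat \<Rightarrow> 'a set" assume A: "range A \<subseteq> {A. ?ind A}"
  have fin: "?ind (\<Inter>i<n. UNIV - A i)" for n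
  proof (induction n)
    case 0
    have "(indicator UNIV :: 'a \<Rightarrow> real) = (\<lambda>_. 1)" by (simp add: fun_eq_iff)
    then show ?case using bounded_closure_const[of 1] by simp
  next
    case (Suc n)
    have "?ind (UNIV - A n)" using compl A by blast
    from Int[OF this Suc] show ?case
      by (simp add: lessThan_Suc)
  qed
  have "?ind (\<Inter>i. UNIV - A i)"
  proof (rule bounded_closure.lim[where F = "\<lambda>n. indicator (\<Inter>i<n. UNIV - A i)" and K = 1])
    fix x
    have "(\<lambda>n. indicator (\<Inter>i<n. UNIV - A i) x) \<longlonglongrightarrow> (indicator (\<Inter>n. \<Inter>i<n. UNIV - A i) x :: real)"
      by (rule LIMSEQ_indicator_decseq) (unfold decseq_def, intro allI impI INF_superset_mono, auto)
    also have "(\<Inter>n. \<Inter>i<n. UNIV - A i) = (\<Inter>i. UNIV - A i)" by auto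
    finally show "(\<lambda>n. indicator (\<Inter>i<n. UNIV - A i) x) \<longlonglongrightarrow> (indicator (\<Inter>i. UNIV - A i) x :: real)" .
  qed (use fin in \<open>auto simp: indicator_def\<close>)
  then have "UNIV - (\<Inter>i. UNIV - A i) \<in> {A. ?ind A}"
    by (intro compl) simp
  also have "UNIV - (\<Inter>i. UNIV - A i) = (\<Union>i. A i)" by auto
  finally show "(\<Union>i. A i) \<in> {A. ?ind A}" .
qed auto

lemma bounded_measurable_in_bounded_closure:
  assumes sets: "\<And>A. A \<in> sets M \<Longrightarrow> (indicator A :: 'a \<Rightarrow> real) \<in> bounded_closure S"
    and space: "space M = UNIV"
    and f: "f \<in> borel_measurable M" and K: "\<And>x. \<bar>f x\<bar> \<le> K"
  shows "f \<in> bounded_closure S"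
proof -
  have nonneg: "(\<exists>K. \<forall>x. u x \<le> K) \<longrightarrow> u \<in> bounded_closure S"
    if "u \<in> borel_measurable M" "\<And>x. 0 \<le> u x" for u
    using that
  proof (induction rule: borel_measurable_induct_real)
    case (mult u c)
    show ?case
    proof (cases "c = 0")
      case False
      show ?thesis
      proof
        assume "\<exists>K. \<forall>x. c * u x \<le> K"
        then obtain K where "\<And>x. c * u x \<le> K" by blast
        then have "u x \<le> K / c" for x using mult(1) False by (simp add: field_simps)
        then show "(\<lambda>x. c * u x) \<in> bounded_closure S"
          using mult by (intro bounded_closure_mult bounded_closure_const) blast
      qed
    qed (simp add: bounded_closure_const)
  next
    case (add u v)
    show ?case
    proof
      assume "\<exists>K. \<forall>x. v x + u x \<le> K"
      then obtain K where K: "\<And>x. v x + u x \<le> K" by blast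
      have "u x \<le> K" "v x \<le> K" for x
        using K[of x] add.hyps(2)[of x] add.hyps(4)[of x] by linarith+
      then show "(\<lambda>x. v x + u x) \<in> bounded_closure S"
        using add by (intro bounded_closure_add) blast+
    qed
  next
    case (seq U)
    show ?case
    proof
      assume "\<exists>K. \<forall>x. u x \<le> K"
      then obtain K where K: "\<And>x. u x \<le> K" by blast
      have le: "U i x \<le> u x" for i x
        by (rule incseq_le[OF _ seq.hyps(4)]) (use seq.hyps(3) space in \<open>auto simp: incseq_def le_fun_def\<close>)
      show "u \<in> bounded_closure S"
      proof (rule bounded_closure.lim[where F = U and K = K])
        show "U n \<in> bounded_closure S" for n
          using seq.IH[of n] le K by (meson order_trans)
        show "\<bar>U n x\<bar> \<le> K" for n x
          using seq.hyps(2)[of n x] le[of n x] K[of x] by simp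
      qed (use seq.hyps(4) space in auto)
    qed
  qed (use sets in auto)
  have "(\<lambda>x. f x + K) \<in> bounded_closure S"
  proof (rule nonneg[rule_format])
    show "0 \<le> f x + K" for x using K[of x] by (simp add: abs_le_iff)
    show "\<exists>L. \<forall>x. f x + K \<le> L" using K by (auto simp: abs_le_iff intro!: exI[of _ "K + K"])
  qed (use f in measurable)
  from bounded_closure_add[OF this bounded_closure_const[of "- K"]] show ?thesis by simp
qed

end

definition real_trig :: "('a::real_inner \<Rightarrow> real) set" where
  "real_trig = {f. \<exists>l. \<forall>x. trig_eval l x = of_real (f x)}"

lemma trig_eval_mult: "\<exists>l''. \<forall>x. trig_eval l'' x = trig_eval l x * trig_eval l' x"
proof (induction l)
  case (Cons p l)
  obtain c \<xi> where p: "p = (c, \<xi>)" by force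
  from Cons obtain l'' where l'': "\<And>x. trig_eval l'' x = trig_eval l x * trig_eval l' x" by blast
  have "trig_eval (map (\<lambda>(d, \<eta>). (c * d, \<xi> + \<eta>)) l') x = c * iexp (inner \<xi> x) * trig_eval l' x" for x
    by (induction l') (auto simp: inner_add_left distrib_left exp_add mult_ac)
  then have "trig_eval (map (\<lambda>(d, \<eta>). (c * d, \<xi> + \<eta>)) l' @ l'') x = trig_eval (p # l) x * trig_eval l' x" for x
    by (simp add: p l'' distrib_right)
  then show ?case by blast
qed (auto intro!: exI[of _ "[]"])

lemma norm_trig_eval_le: "\<exists>K. \<forall>x. cmod (trig_eval l x) \<le> K"
proof (induction l)
  case (Cons p l)
  obtain c \<xi> where p: "p = (c, \<xi>)" by force
  from Cons obtain K where K: "\<And>x. cmod (trig_eval l x) \<le> K" by blast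
  have "cmod (trig_eval (p # l) x) \<le> cmod c + K" for x
    using norm_triangle_ineq[of "c * iexp (inner \<xi> x)" "trig_eval l x"] K[of x]
    by (simp add: p norm_mult)
  then show ?case by blast
qed auto

lemma real_trig_const: "(\<lambda>_. c) \<in> real_trig"
  unfolding real_trig_def by (intro CollectI exI[of _ "[(of_real c, 0)]"]) simp

lemma real_trig_add:
  assumes "f \<in> real_trig" "g \<in> real_trig"
  shows "(\<lambda>x. f x + g x) \<in> real_trig"
proof -
  obtain l l' where "\<And>x. trig_eval l x = of_real (f x)" "\<And>x. trig_eval l' x = of_real (g x)"
    using assms by (auto simp: real_trig_def)
  then have "trig_eval (l @ l') x = of_real (f x + g x)" for x by simp
  then show ?thesis unfolding real_trig_def by blast
qed

lemma real_trig_mult: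
  assumes "f \<in> real_trig" "g \<in> real_trig"
  shows "(\<lambda>x. f x * g x) \<in> real_trig"
proof -
  obtain l l' where l: "\<And>x. trig_eval l x = of_real (f x)" "\<And>x. trig_eval l' x = of_real (g x)"
    using assms by (auto simp: real_trig_def)
  obtain l'' where "\<And>x. trig_eval l'' x = trig_eval l x * trig_eval l' x"
    using trig_eval_mult[of l l'] by blast
  then have "trig_eval l'' x = of_real (f x * g x)" for x by (simp add: l)
  then show ?thesis unfolding real_trig_def by blast
qed

lemma real_trig_sin: "(\<lambda>x. sin (inner \<xi> x)) \<in> real_trig"
  unfolding real_trig_def
proof (intro CollectI exI allI)
  fix x
  show "trig_eval [(- \<i> / 2, \<xi>), (\<i> / 2, - \<xi>)] x = of_real (sin (inner \<xi> x))"
    by (simp add: complex_eq_iff Re_exp Im_exp)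
qed

lemma real_trig_shift: 
  assumes "f \<in> real_trig" shows "(\<lambda>x. f (x + w)) \<in> real_trig"
proof -
  obtain l where l: "\<And>x. trig_eval l x = of_real (f x)" using assms by (auto simp: real_trig_def)
  have "trig_eval (trig_mult (\<lambda>\<xi>. iexp (inner \<xi> w)) l) x = trig_eval l (x + w)" for x
    by (induction l) (auto simp: inner_add_right distrib_left exp_add mult_ac)
  then show ?thesis using l by (auto simp: real_trig_def)
qed

interpretation real_trig: bounded_function_algebra "real_trig :: ('a::real_inner \<Rightarrow> real) set"
proof
  fix f :: "'a \<Rightarrow> real" assume "f \<in> real_trig"
  then obtain l where l: "\<And>x. trig_eval l x = of_real (f x)" by (auto simp: real_trig_def)
  obtain K where "\<And>x. cmod (trig_eval l x) \<le> K" using norm_trig_eval_le by blast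
  then show "\<exists>K. \<forall>x. \<bar>f x\<bar> \<le> K" unfolding l by auto
qed (intro real_trig_const real_trig_add real_trig_mult; assumption)+

lemma real_trig_borel_measurable:
  assumes "f \<in> real_trig" shows "f \<in> borel_measurable borel"
proof -
  obtain l where l: "\<And>x. trig_eval l x = of_real (f x)" using assms by (auto simp: real_trig_def)
  have "continuous_on UNIV (trig_eval l)"
    by (induction l) (auto intro!: continuous_intros simp: trig_eval_simps(1)[abs_def])
  then have "continuous_on UNIV (\<lambda>x. Re (trig_eval l x))" by (intro continuous_intros)
  then show ?thesis unfolding l by (intro borel_measurable_continuous_onI) simp
qed

text \<open>With respect to the \<open>\<sigma>\<close>-algebra of sets whose indicators lie in the closure, the functions
  \<open>sin \<langle>\<xi>,x\<rangle>\<close> are measurable, hence so is \<open>\<langle>\<xi>,x\<rangle> = lim n sin \<langle>\<xi>/n,x\<rangle>\<close>. A closed ball is the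
  intersection of the half-spaces containing it whose normals lie in a countable dense set, and an
  open set is a countable union of closed balls. So all Borel sets are reached.\<close>

lemma borel_indicator_in_bounded_closure_real_trig:
  fixes A :: "'a::{real_inner, second_countable_topology} set"
  assumes "A \<in> sets borel"
  shows "(indicator A :: 'a \<Rightarrow> real) \<in> bounded_closure real_trig"
proof -
  define \<Sigma> where "\<Sigma> = {A :: 'a set. (indicator A :: 'a \<Rightarrow> real) \<in> bounded_closure real_trig}"
  interpret \<Sigma>: sigma_algebra UNIV \<Sigma>
    unfolding \<Sigma>_def by (rule real_trig.sigma_algebra_bounded_closure)
  define N where "N = sigma UNIV \<Sigma>"
  have N: "sets N = \<Sigma>" "space N = UNIV"
    by (simp_all add: N_def \<Sigma>.sets_measure_of_eq)
  have trig: "f \<in> borel_measurable N" if "f \<in> real_trig" for f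
    unfolding borel_measurable_iff_greater
    using real_trig.bounded_closure_indicator_greater[OF that] by (simp add: N \<Sigma>_def)
  have inner: "inner \<xi> \<in> borel_measurable N" for \<xi>
  proof (rule borel_measurable_LIMSEQ_real)
    fix x
    \<comment> \<open>\<open>sin (h r) / h \<rightarrow> r\<close> as \<open>h \<rightarrow> 0\<close>\<close>
    have "DERIV (\<lambda>h. sin (h * inner \<xi> x)) 0 :> inner \<xi> x"
      by (auto intro!: derivative_eq_intros)
    then have "((\<lambda>h. sin (h * inner \<xi> x) / h) \<longlongrightarrow> inner \<xi> x) (at 0)"
      by (simp add: DERIV_def)
    moreover have "filterlim (\<lambda>n. inverse (real (Suc n))) (at 0) sequentially"
      using LIMSEQ_inverse_real_of_nat by (simp add: filterlim_at)
    ultimately have "(\<lambda>n. sin (inverse (real (Suc n)) * inner \<xi> x) / inverse (real (Suc n))) \<longlonglongrightarrow> inner \<xi> x"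
      by (rule filterlim_compose)
    then show "(\<lambda>n. real (Suc n) * sin (inner (inverse (real (Suc n)) *\<^sub>R \<xi>) x)) \<longlonglongrightarrow> inner \<xi> x"
      by (simp add: divide_inverse mult.commute)
  qed (intro borel_measurable_times borel_measurable_const trig real_trig_sin)
  obtain D :: "'a set" where D: "countable D" "\<And>X. open X \<Longrightarrow> X \<noteq> {} \<Longrightarrow> \<exists>d\<in>D. d \<in> X"
    using countable_dense_exists by blast
  have cball: "cball y r \<in> \<Sigma>" if "0 \<le> r" for y r
  proof -
    have "cball y r = (\<Inter>d\<in>D. {x. inner d x \<le> r * norm d + inner d y})"
    proof (intro set_eqI iffI)
      fix x assume x: "x \<in> cball y r"
      have "inner d x \<le> r * norm d + inner d y" for d
      proof -
        have "inner d (x - y) \<le> norm d * norm (x - y)" by (rule norm_cauchy_schwarz)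
        also have "\<dots> \<le> norm d * r"
          using x by (intro mult_left_mono) (auto simp: dist_norm norm_minus_commute)
        finally show ?thesis by (simp add: inner_diff_right mult.commute)
      qed
      then show "x \<in> (\<Inter>d\<in>D. {x. inner d x \<le> r * norm d + inner d y})" by simp
    next
      fix x assume x: "x \<in> (\<Inter>d\<in>D. {x. inner d x \<le> r * norm d + inner d y})"
      have "inner w x \<le> r * norm w + inner w y" for w
      proof (rule ccontr)
        define X where "X = {d. r * norm d + inner d y < inner d x}"
        assume "\<not> ?thesis"
        then have "w \<in> X" by (simp add: X_def)
        moreover have "open X"
          unfolding X_def by (intro open_Collect_less continuous_intros)
        ultimately obtain d where "d \<in> D" "d \<in> X" using D(2) by blast
        then show False using x by (force simp: X_def)
      qed
      from this[of "x - y"] have "(norm (x - y))\<^sup>2 \<le> r * norm (x - y)"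
        by (simp add: power2_norm_eq_inner inner_diff_right)
      then have "norm (x - y) \<le> r"
        using that by (cases "x = y") (auto simp: power2_eq_square)
      then show "x \<in> cball y r" by (simp add: dist_norm norm_minus_commute)
    qed
    also have "\<dots> \<in> \<Sigma>"
    proof (cases "D = {}")
      case False
      have "{x \<in> space N. inner d x \<le> r * norm d + inner d y} \<in> sets N" for d
        using inner[of d] by measurable
      then show ?thesis using False D(1) by (intro \<Sigma>.countable_INT') (auto simp: N)
    qed simp
    finally show ?thesis .
  qed
  have "open X \<Longrightarrow> X \<in> \<Sigma>" for X
  proof -
    assume X: "open X"
    define I where "I = {(d, q). d \<in> D \<and> q \<in> \<rat> \<and> 0 \<le> q \<and> cball d q \<subseteq> X}"
    have "I \<subseteq> D \<times> \<rat>" by (auto simp: I_def)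
    then have "countable I"
      by (rule countable_subset) (intro countable_SIGMA D(1) countable_rat)
    have "X = (\<Union>(d, q)\<in>I. cball d q)"
    proof (intro equalityI subsetI)
      fix x assume "x \<in> X"
      then obtain e where e: "e > 0" "ball x e \<subseteq> X" using X open_contains_ball by blast
      obtain q where q: "q \<in> \<rat>" "e / 3 < q" "q < e / 2"
        using Rats_dense_in_real[of "e / 3" "e / 2"] e by auto
      obtain d where d: "d \<in> D" "d \<in> ball x (e / 3)"
        using D(2)[of "ball x (e / 3)"] e by auto
      have "cball d q \<subseteq> ball x e"
      proof
        fix z assume "z \<in> cball d q"
        then show "z \<in> ball x e" using d q e dist_triangle[of x z d] by simp
      qed
      then have "(d, q) \<in> I" using d q e by (auto simp: I_def)
      moreover have "x \<in> cball d q" using d q by (simp add: dist_commute)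
      ultimately show "x \<in> (\<Union>(d, q)\<in>I. cball d q)" by blast
    qed (auto simp: I_def)
    also have "\<dots> \<in> \<Sigma>"
      using \<open>countable I\<close> by (intro \<Sigma>.countable_UN') (auto simp: I_def intro: cball)
    finally show "X \<in> \<Sigma>" .
  qed
  then have "sets (borel :: 'a measure) \<subseteq> \<Sigma>"
    unfolding borel_def by (simp only: sets_measure_of Pow_UNIV subset_UNIV) (rule \<Sigma>.sigma_sets_subset, auto)
  then show ?thesis using assms by (auto simp: \<Sigma>_def)
qed

lemma bounded_borel_in_bounded_closure_real_trig:
  fixes f :: "'a::{real_inner, second_countable_topology} \<Rightarrow> real"
  assumes "f \<in> borel_measurable borel" "\<And>x. \<bar>f x\<bar> \<le> K"
  shows "f \<in> bounded_closure real_trig"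
  by (rule real_trig.bounded_measurable_in_bounded_closure[where M = borel])
    (use assms borel_indicator_in_bounded_closure_real_trig in auto)

section \<open>Translation along a Gaussian direction\<close>

lemma std_normal_density_shift_left:
  "std_normal_density (r - c) = exp (c * r - c\<^sup>2 / 2) * std_normal_density r"
  by (simp add: std_normal_density_def exp_add[symmetric] power2_eq_square field_simps)

text \<open>By the Cameron-Martin formula, translation by \<open>c\<close> is integration against the density
  \<open>D r = exp (c r - c\<^sup>2 / 2)\<close>, and Young's inequality is applied to \<open>(l h) (D / l)\<close>. The last
  exponential is the \<open>q\<close>-th moment of \<open>D\<close>. Young's inequality is preferred to
  Hoelder's because the result is then linear in the integrals, so that a positive linear
  operator can be applied to it; the parameter \<open>l\<close> is optimised at the very end.\<close>

lemma std_normal_translation_le: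
  fixes h :: "real \<Rightarrow> real"
  assumes h: "h \<in> borel_measurable borel" "\<And>r. 0 \<le> h r" "\<And>r. h r \<le> K"
    and p: "1 < p" "1 < q" "1 / p + 1 / q = 1" and l: "0 < l"
  shows "(\<integral>r. h (r + c) \<partial>std_normal_distribution)
    \<le> l powr p / p * (\<integral>r. h r powr p \<partial>std_normal_distribution) + l powr - q / q * exp (q * (q - 1) * c\<^sup>2 / 2)"
proof -
  interpret N: real_distribution std_normal_distribution by (rule real_dist_normal_dist)
  define D where "D r = exp (c * r - c\<^sup>2 / 2)" for r :: real
  have hp: "(\<lambda>r. h r powr p) \<in> borel_measurable borel" using h by measurable
  have int_h: "integrable lborel (\<lambda>r. std_normal_density r * h (r + c))"
    and int_hp: "integrable lborel (\<lambda>r. std_normal_density r * h r powr p)"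
  proof -
    have "integrable std_normal_distribution (\<lambda>r. h (r + c))"
      by (rule N.integrable_const_bound[of _ K]) (use h in auto)
    then show "integrable lborel (\<lambda>r. std_normal_density r * h (r + c))"
      using h by (subst (asm) integrable_density) auto
    have "integrable std_normal_distribution (\<lambda>r. h r powr p)"
      by (rule N.integrable_const_bound[of _ "K powr p"]) (use h p hp in \<open>auto intro!: powr_mono2\<close>)
    then show "integrable lborel (\<lambda>r. std_normal_density r * h r powr p)"
      using hp by (subst (asm) integrable_density) auto
  qed
  have shift_back: "std_normal_density r * D r * h r = std_normal_density (- c + r) * h ((- c + r) + c)" for r
    using std_normal_density_shift_left[of r c] by (simp add: D_def mult_ac)
  have int_Dh: "integrable lborel (\<lambda>r. std_normal_density r * D r * h r)"
    using lborel_integrable_real_affine[OF int_h, of 1 "- c"] by (simp add: shift_back)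
  have Dq: "std_normal_density r * D r powr q = exp (q * (q - 1) * c\<^sup>2 / 2) * std_normal_density (- (q * c) + 1 * r)" for r
  proof -
    have "std_normal_density (r - q * c) = exp (q * c * r - (q * c)\<^sup>2 / 2) * std_normal_density r"
      by (rule std_normal_density_shift_left)
    moreover have "q * (c * r - c\<^sup>2 / 2) = q * (q - 1) * c\<^sup>2 / 2 + (q * c * r - (q * c)\<^sup>2 / 2)"
      by (simp add: power2_eq_square field_simps)
    ultimately show ?thesis
      by (simp add: D_def exp_powr_real exp_add mult_ac)
  qed
  have int_n: "integrable lborel std_normal_density"
    by (rule integrable_normal_density) simp
  have int_ns: "integrable lborel (\<lambda>r. std_normal_density (- (q * c) + 1 * r))"
    by (rule lborel_integrable_real_affine[OF int_n]) simp
  have int_Dq: "integrable lborel (\<lambda>r. std_normal_density r * D r powr q)"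
    unfolding Dq by (intro integrable_mult_right int_ns)
  have "(\<integral>r. std_normal_density (- (q * c) + 1 * r) \<partial>lborel) = (\<integral>r. std_normal_density r \<partial>lborel)"
    using lborel_integral_real_affine[of 1 std_normal_density "- (q * c)"] by simp
  also have "\<dots> = 1" by (rule integral_normal_density) simp
  finally have Dq_int: "(\<integral>r. std_normal_density r * D r powr q \<partial>lborel) = exp (q * (q - 1) * c\<^sup>2 / 2)"
    unfolding Dq by simp
  have Young: "h r * D r \<le> l powr p / p * h r powr p + l powr - q / q * D r powr q" for r
  proof -
    have "h r * D r = (l * h r) * (D r / l)" using l by simp
    also have "\<dots> \<le> (l * h r) powr p / p + (D r / l) powr q / q"
      using l h(2)[of r] by (intro Youngs_inequality p) (simp_all add: D_def)
    also have "\<dots> = l powr p / p * h r powr p + l powr - q / q * D r powr q"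
      using l h(2)[of r] by (simp add: powr_mult powr_divide powr_minus D_def field_simps)
    finally show ?thesis .
  qed
  have "(\<integral>r. h (r + c) \<partial>std_normal_distribution) = (\<integral>r. std_normal_density r * h (r + c) \<partial>lborel)"
    using h by (subst integral_density) auto
  also have "\<dots> = (\<integral>r. std_normal_density r * D r * h r \<partial>lborel)"
    using lborel_integral_real_affine[of 1 "\<lambda>r. std_normal_density r * h (r + c)" "- c"] by (simp add: shift_back)
  also have "\<dots> \<le> (\<integral>r. l powr p / p * (std_normal_density r * h r powr p)
      + l powr - q / q * (std_normal_density r * D r powr q) \<partial>lborel)"
  proof (rule integral_mono[OF int_Dh])
    show "integrable lborel (\<lambda>r. l powr p / p * (std_normal_density r * h r powr p)
      + l powr - q / q * (std_normal_density r * D r powr q))"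
      by (intro Bochner_Integration.integrable_add integrable_mult_right int_hp int_Dq)
    fix r
    show "std_normal_density r * D r * h r \<le> l powr p / p * (std_normal_density r * h r powr p)
      + l powr - q / q * (std_normal_density r * D r powr q)"
      using mult_left_mono[OF Young[of r], of "std_normal_density r"] by (simp add: algebra_simps)
  qed
  also have "\<dots> = l powr p / p * (\<integral>r. std_normal_density r * h r powr p \<partial>lborel)
      + l powr - q / q * exp (q * (q - 1) * c\<^sup>2 / 2)"
    using int_hp int_Dq by (simp add: Dq_int)
  also have "(\<integral>r. std_normal_density r * h r powr p \<partial>lborel) = (\<integral>r. h r powr p \<partial>std_normal_distribution)"
    using hp by (subst integral_density) auto
  finally show ?thesis .
qed

text \<open>Formally \<open>M = G * \<nu>\<close> with \<open>\<rho>\<close> the Fourier transform of \<open>\<nu>\<close>, and the integral of \<open>d\<close> over \<open>M\<close>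
  is the \<open>\<nu>\<close>-integral of the non-negative function \<open>x \<mapsto> \<integral> d (x + y) G(dy)\<close>. The multiplier
  \<open>\<rho>\<close>, evaluated at the point \<open>0\<close>, takes the place of the integral over \<open>\<nu>\<close>.\<close>

lemma smoothing_positivity:
  fixes d :: "'a::real_inner \<Rightarrow> real"
  assumes M: "prob_space M" "sets M = sets borel"
    and G: "prob_space G" "sets G = sets borel"
    and rho: "positive_multiplier \<rho>"
    and cf: "\<And>\<xi>. (\<integral>x. iexp (inner \<xi> x) \<partial>M) = \<rho> \<xi> * (\<integral>x. iexp (inner \<xi> x) \<partial>G)"
    and d: "d \<in> real_trig" and nonneg: "\<And>x. 0 \<le> (\<integral>y. d (x + y) \<partial>G)"
  shows "0 \<le> (\<integral>x. d x \<partial>M)"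
proof -
  note fin = prob_space.axioms(1)
  obtain l where l: "\<And>x. trig_eval l x = of_real (d x)" using d by (auto simp: real_trig_def)
  have "trig_eval (trig_mult (\<lambda>\<xi>. \<integral>x. iexp (inner \<xi> x) \<partial>G) l) x \<in> \<real>\<^sub>\<ge>\<^sub>0" for x
    using trig_eval_integral(2)[OF fin[OF G(1)] G(2), of l x] nonneg[of x]
    by (simp add: l flip: trig_eval_integral(2)[OF fin[OF G(1)] G(2)])
  from positive_multiplierD[OF rho this]
  have "trig_eval (trig_mult (\<lambda>\<xi>. \<integral>x. iexp (inner \<xi> x) \<partial>M) l) 0 \<in> \<real>\<^sub>\<ge>\<^sub>0"
    by (simp add: trig_mult_trig_mult cf)
  then show ?thesis
    by (simp add: l flip: trig_eval_integral(2)[OF fin[OF M(1)] M(2)])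
qed

lemma integrable_real_trig:
  assumes "prob_space M" "sets M = sets borel" "f \<in> real_trig"
  shows "integrable M (\<lambda>y. f (x + y))"
proof -
  obtain l where l: "\<And>x. trig_eval l x = of_real (f x)" using assms by (auto simp: real_trig_def)
  from trig_eval_integral(1)[OF prob_space.axioms(1)[OF assms(1)] assms(2), of l x]
  show ?thesis by (simp add: l complex_of_real_integrable_eq)
qed

text \<open>The one-dimensional inequality holds on every line in the direction \<open>v\<close>. For a trigonometric
  polynomial \<open>f\<close>, the functions \<open>|f|\<close> and \<open>|f|\<^sup>p\<close> are uniformly close to trigonometric
  polynomials \<open>g1\<close> and \<open>g2\<close>, so up to small constants the inequality says that a trigonometric
  polynomial built from them has non-negative Gaussian averages, and \<open>smoothing_positivity\<close>
  transfers it to \<open>M\<close>. Absolute values allow general \<open>f\<close>, so that all functions of the bounded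
  closure can be reached.\<close>

lemma gaussian_factor_translation_le:
  fixes f :: "'a::{real_inner, second_countable_topology} \<Rightarrow> real"
  assumes M: "prob_space M" "sets M = sets borel"
    and rho: "positive_multiplier \<rho>"
    and cf: "\<And>\<xi>. (\<integral>x. iexp (inner \<xi> x) \<partial>M) = \<rho> \<xi> * of_real (exp (- (inner \<xi> v)\<^sup>2 / 2))"
    and p: "1 < p" "1 < q" "1 / p + 1 / q = 1" and l: "0 < l"
    and f: "f \<in> borel_measurable borel" "\<And>x. \<bar>f x\<bar> \<le> K"
  shows "(\<integral>x. \<bar>f (x + c *\<^sub>R v)\<bar> \<partial>M)
     \<le> l powr p / p * (\<integral>x. \<bar>f x\<bar> powr p \<partial>M) + l powr - q / q * exp (q * (q - 1) * c\<^sup>2 / 2)"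
proof -
  interpret M: prob_space M by fact
  define A where "A = l powr p / p"
  define B where "B = l powr - q / q * exp (q * (q - 1) * c\<^sup>2 / 2)"
  have A: "0 \<le> A" using p by (simp add: A_def)
  let ?G = "gauss_ray v"
  note G = prob_space_gauss_ray[of v]
  interpret G: prob_space ?G by (rule G)
  have transl: "(\<lambda>x. x + w) \<in> borel_measurable borel" for w :: 'a
    by (intro borel_measurable_continuous_onI continuous_intros)
  have bd_int: "integrable N u" if "prob_space N" "sets N = sets borel" "u \<in> borel_measurable borel" "\<And>x. \<bar>u x\<bar> \<le> L"
    for N and u :: "'a \<Rightarrow> real" and L
  proof -
    interpret N: prob_space N by fact
    show ?thesis
      by (rule N.integrable_const_bound[of _ L]) (use that in \<open>auto simp: measurable_cong_sets[OF that(2) refl]\<close>)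
  qed
  have powr_bd: "\<bar>\<bar>t\<bar> powr p\<bar> \<le> L powr p" if "\<bar>t\<bar> \<le> L" for t L :: real
    using that p by (simp add: powr_mono2)
  \<comment> \<open>Along the ray, the claim is the one-dimensional inequality.\<close>
  have ray: "(\<integral>y. \<bar>f (x + y + c *\<^sub>R v)\<bar> \<partial>?G) \<le> A * (\<integral>y. \<bar>f (x + y)\<bar> powr p \<partial>?G) + B"
    if f: "f \<in> borel_measurable borel" "\<And>x. \<bar>f x\<bar> \<le> K" for f :: "'a \<Rightarrow> real" and x K
  proof -
    have line: "(\<lambda>r. x + r *\<^sub>R v) \<in> borel_measurable borel"
      by (intro borel_measurable_continuous_onI continuous_intros)
    have fx: "(\<lambda>y. f (x + y + w)) \<in> borel_measurable borel" for w
      by (intro measurable_compose[OF _ f(1)] borel_measurable_continuous_onI continuous_intros)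
    have gmeas: "(\<lambda>r. r *\<^sub>R v) \<in> measurable std_normal_distribution borel"
      by (auto intro!: borel_measurable_continuous_onI continuous_intros)
    define h where "h r = \<bar>f (x + r *\<^sub>R v)\<bar>" for r
    have hm: "h \<in> borel_measurable borel"
      unfolding h_def by (intro borel_measurable_abs measurable_compose[OF line f(1)])
    have "(\<integral>y. \<bar>f (x + y + c *\<^sub>R v)\<bar> \<partial>?G) = (\<integral>r. h (r + c) \<partial>std_normal_distribution)"
      unfolding gauss_ray_def h_def
      by (subst integral_distr[OF gmeas]) (use fx in \<open>simp_all add: scaleR_add_left add.assoc\<close>)
    also have "\<dots> \<le> A * (\<integral>r. h r powr p \<partial>std_normal_distribution) + B"
      unfolding A_def B_def by (rule std_normal_translation_le[OF hm, where K = K]) (use p l in \<open>auto simp: h_def f(2)\<close>)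
    also have "(\<integral>r. h r powr p \<partial>std_normal_distribution) = (\<integral>y. \<bar>f (x + y)\<bar> powr p \<partial>?G)"
      unfolding gauss_ray_def h_def
      by (subst integral_distr[OF gmeas]) (use fx[of 0] in simp_all)
    finally show ?thesis .
  qed
  have trig: "(\<integral>x. \<bar>f (x + c *\<^sub>R v)\<bar> \<partial>M) \<le> A * (\<integral>x. \<bar>f x\<bar> powr p \<partial>M) + B"
    if f: "f \<in> real_trig" for f
  proof (rule field_le_epsilon)
    fix e0 :: real assume "0 < e0"
    define e where "e = e0 / (2 * A + 2)"
    have "(2 * A + 2) * e = e0" using A by (simp add: e_def)
    then have e: "0 < e" "2 * A * e + 2 * e = e0"
      using \<open>0 < e0\<close> A by (simp_all only: distrib_right) (simp add: e_def)
    obtain K where K: "\<And>x. \<bar>f x\<bar> \<le> K" using real_trig.bounded f by blast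
    have fm: "f \<in> borel_measurable borel" by (rule real_trig_borel_measurable[OF f])
    obtain g1 where g1: "g1 \<in> real_trig" "\<And>x. \<bar>\<bar>f x\<bar> - g1 x\<bar> < e"
      using real_trig.polynomial_approximation[OF f continuous_on_rabs[OF continuous_on_id] e(1)] by blast
    have "continuous_on UNIV (\<lambda>t::real. \<bar>t\<bar> powr p)"
      using p by (intro continuous_on_powr' continuous_intros) auto
    then obtain g2 where g2: "g2 \<in> real_trig" "\<And>x. \<bar>\<bar>f x\<bar> powr p - g2 x\<bar> < e"
      using real_trig.polynomial_approximation[OF f _ e(1)] by blast
    \<comment> \<open>Right side minus left side, with slack for both approximations.\<close>
    define d where "d x = (A * g2 x + (A * e + B + e)) + (- 1) * g1 (x + c *\<^sub>R v)" for x
    have dt: "d \<in> real_trig"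
      unfolding d_def by (intro real_trig_add real_trig_mult real_trig_const real_trig_shift g1 g2)
    have int: "integrable N (\<lambda>y. g2 (x + y))" "integrable N (\<lambda>y. g1 (x + y + c *\<^sub>R v))"
      if "prob_space N" "sets N = sets borel" for N x
      using integrable_real_trig[OF that g2(1)] integrable_real_trig[OF that real_trig_shift[OF g1(1)]] by auto
    have d_int: "(\<integral>y. d (x + y) \<partial>N) = A * (\<integral>y. g2 (x + y) \<partial>N) + (A * e + B + e) - (\<integral>y. g1 (x + y + c *\<^sub>R v) \<partial>N)"
      if "prob_space N" "sets N = sets borel" for N x
    proof -
      interpret N: prob_space N by fact
      show ?thesis using int[OF that, of x] by (simp add: d_def N.prob_space)
    qed
    have shift_meas: "(\<lambda>y. f (x + y + w)) \<in> borel_measurable borel" for x w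
      by (intro measurable_compose[OF _ fm] borel_measurable_continuous_onI continuous_intros)
    have cmp1: "(\<integral>y. g1 (x + y + c *\<^sub>R v) \<partial>N) - e \<le> (\<integral>y. \<bar>f (x + y + c *\<^sub>R v)\<bar> \<partial>N)"
      "(\<integral>y. \<bar>f (x + y + c *\<^sub>R v)\<bar> \<partial>N) \<le> (\<integral>y. g1 (x + y + c *\<^sub>R v) \<partial>N) + e"
      "(\<integral>y. \<bar>f (x + y)\<bar> powr p \<partial>N) \<le> (\<integral>y. g2 (x + y) \<partial>N) + e"
      "(\<integral>y. g2 (x + y) \<partial>N) - e \<le> (\<integral>y. \<bar>f (x + y)\<bar> powr p \<partial>N)"
      if N: "prob_space N" "sets N = sets borel" for N x
    proof -
      interpret N: prob_space N by fact
      have i1: "integrable N (\<lambda>y. \<bar>f (x + y + c *\<^sub>R v)\<bar>)"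
        by (rule bd_int[OF N, of _ K]) (use shift_meas K in auto)
      have i2: "integrable N (\<lambda>y. \<bar>f (x + y)\<bar> powr p)"
        by (rule bd_int[OF N, of _ "K powr p"]) (use shift_meas[of x 0] powr_bd K in auto)
      have "(\<integral>y. g1 (x + y + c *\<^sub>R v) - e \<partial>N) \<le> (\<integral>y. \<bar>f (x + y + c *\<^sub>R v)\<bar> \<partial>N)"
        by (rule integral_mono) (use int[OF N, of x] i1 g1(2) in \<open>auto simp: abs_less_iff less_imp_le algebra_simps intro!: less_imp_le\<close>)
      then show "(\<integral>y. g1 (x + y + c *\<^sub>R v) \<partial>N) - e \<le> (\<integral>y. \<bar>f (x + y + c *\<^sub>R v)\<bar> \<partial>N)"
        using int[OF N, of x] by (simp add: N.prob_space)
      have "(\<integral>y. \<bar>f (x + y + c *\<^sub>R v)\<bar> \<partial>N) \<le> (\<integral>y. g1 (x + y + c *\<^sub>R v) + e \<partial>N)"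
        by (rule integral_mono) (use int[OF N, of x] i1 g1(2) in \<open>auto simp: abs_less_iff less_imp_le algebra_simps intro!: less_imp_le\<close>)
      then show "(\<integral>y. \<bar>f (x + y + c *\<^sub>R v)\<bar> \<partial>N) \<le> (\<integral>y. g1 (x + y + c *\<^sub>R v) \<partial>N) + e"
        using int[OF N, of x] by (simp add: N.prob_space)
      have "(\<integral>y. \<bar>f (x + y)\<bar> powr p \<partial>N) \<le> (\<integral>y. g2 (x + y) + e \<partial>N)"
        by (rule integral_mono) (use int[OF N, of x] i2 g2(2) in \<open>auto simp: abs_less_iff less_imp_le algebra_simps intro!: less_imp_le\<close>)
      then show "(\<integral>y. \<bar>f (x + y)\<bar> powr p \<partial>N) \<le> (\<integral>y. g2 (x + y) \<partial>N) + e"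
        using int[OF N, of x] by (simp add: N.prob_space)
      have "(\<integral>y. g2 (x + y) - e \<partial>N) \<le> (\<integral>y. \<bar>f (x + y)\<bar> powr p \<partial>N)"
        by (rule integral_mono) (use int[OF N, of x] i2 g2(2) in \<open>auto simp: abs_less_iff less_imp_le algebra_simps intro!: less_imp_le\<close>)
      then show "(\<integral>y. g2 (x + y) \<partial>N) - e \<le> (\<integral>y. \<bar>f (x + y)\<bar> powr p \<partial>N)"
        using int[OF N, of x] by (simp add: N.prob_space)
    qed
    have "0 \<le> (\<integral>x. d x \<partial>M)"
    proof (rule smoothing_positivity[OF M G sets_gauss_ray rho _ dt])
      show "(\<integral>x. iexp (inner \<xi> x) \<partial>M) = \<rho> \<xi> * (\<integral>x. iexp (inner \<xi> x) \<partial>?G)" for \<xi>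
        by (simp only: cf gauss_ray_fourier)
      fix x
      have "A * (\<integral>y. \<bar>f (x + y)\<bar> powr p \<partial>?G) \<le> A * ((\<integral>y. g2 (x + y) \<partial>?G) + e)"
        by (intro mult_left_mono cmp1(3) G sets_gauss_ray A)
      then show "0 \<le> (\<integral>y. d (x + y) \<partial>?G)"
        unfolding d_int[OF G sets_gauss_ray]
        using ray[OF fm K, of x] cmp1(1)[OF G sets_gauss_ray, of x] by (simp add: algebra_simps)
    qed
    then have "(\<integral>y. g1 (0 + y + c *\<^sub>R v) \<partial>M) \<le> A * (\<integral>y. g2 (0 + y) \<partial>M) + (A * e + B + e)"
      using d_int[OF M, of 0] by simp
    moreover have "A * ((\<integral>y. g2 (0 + y) \<partial>M) - e) \<le> A * (\<integral>y. \<bar>f (0 + y)\<bar> powr p \<partial>M)"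
      by (intro mult_left_mono cmp1(4) M A)
    ultimately show "(\<integral>x. \<bar>f (x + c *\<^sub>R v)\<bar> \<partial>M) \<le> A * (\<integral>x. \<bar>f x\<bar> powr p \<partial>M) + B + e0"
      using cmp1(2)[OF M, of 0] e(2) by (simp add: algebra_simps)
  qed
  have "f \<in> bounded_closure real_trig"
    using bounded_borel_in_bounded_closure_real_trig f by blast
  then have "f \<in> borel_measurable borel \<and> (\<integral>x. \<bar>f (x + c *\<^sub>R v)\<bar> \<partial>M) \<le> A * (\<integral>x. \<bar>f x\<bar> powr p \<partial>M) + B"
  proof induction
    case (base f)
    then show ?case using trig real_trig_borel_measurable by blast
  next
    case (lim F K f)
    have Fm: "F n \<in> borel_measurable borel" for n using lim.IH by blast
    have fm: "f \<in> borel_measurable borel"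
      by (rule borel_measurable_LIMSEQ_real[OF lim.hyps(3) Fm])
    have Mm: "u \<in> borel_measurable M \<longleftrightarrow> u \<in> borel_measurable borel" for u :: "'a \<Rightarrow> real"
      by (simp add: measurable_cong_sets[OF M(2) refl])
    have shm: "(\<lambda>x. u (x + c *\<^sub>R v)) \<in> borel_measurable borel" if "u \<in> borel_measurable borel" for u :: "'a \<Rightarrow> real"
      by (rule measurable_compose[OF transl that])
    have "(\<lambda>n. \<integral>x. \<bar>F n (x + c *\<^sub>R v)\<bar> \<partial>M) \<longlonglongrightarrow> (\<integral>x. \<bar>f (x + c *\<^sub>R v)\<bar> \<partial>M)"
      by (rule integral_dominated_convergence[where w = "\<lambda>_. K"])
        (use lim.hyps(2) in \<open>auto simp: Mm intro!: borel_measurable_abs shm fm Fm tendsto_rabs lim.hyps(3)\<close>)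
    moreover have "(\<lambda>n. \<integral>x. \<bar>F n x\<bar> powr p \<partial>M) \<longlonglongrightarrow> (\<integral>x. \<bar>f x\<bar> powr p \<partial>M)"
    proof (rule integral_dominated_convergence[where w = "\<lambda>_. K powr p"])
      show "AE x in M. (\<lambda>n. \<bar>F n x\<bar> powr p) \<longlonglongrightarrow> \<bar>f x\<bar> powr p"
        using p by (intro AE_I2 tendsto_powr' tendsto_rabs lim.hyps(3) tendsto_const) auto
      show "AE x in M. norm (\<bar>F n x\<bar> powr p) \<le> K powr p" for n
        using powr_bd lim.hyps(2) by (intro AE_I2) simp
    qed (use Fm fm in \<open>auto simp: Mm\<close>)
    ultimately have "(\<integral>x. \<bar>f (x + c *\<^sub>R v)\<bar> \<partial>M) \<le> A * (\<integral>x. \<bar>f x\<bar> powr p \<partial>M) + B"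
      by (intro LIMSEQ_le[where X = "\<lambda>n. \<integral>x. \<bar>F n (x + c *\<^sub>R v)\<bar> \<partial>M"
            and Y = "\<lambda>n. A * (\<integral>x. \<bar>F n x\<bar> powr p \<partial>M) + B"] tendsto_intros) (use lim.IH in auto)
    with fm show ?case by blast
  qed
  then show ?thesis by (simp add: A_def B_def)
qed

text \<open>For \<open>J > 0\<close> choose \<open>l\<close> with \<open>l\<^sup>p J = l\<^sup>-\<^sup>q E\<close>; both sides then equal
  \<open>J\<^sup>1\<^sup>/\<^sup>p E\<^sup>1\<^sup>/\<^sup>q\<close>. The case \<open>J = 0\<close> is covered by enlarging \<open>J\<close> slightly.\<close>

lemma Young_optimal:
  fixes L J E p q :: real
  assumes p: "1 < p" "1 < q" "1 / p + 1 / q = 1" and L: "0 \<le> L" and J: "0 \<le> J" and E: "0 < E"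
    and le: "\<And>l. 0 < l \<Longrightarrow> L \<le> l powr p / p * J + l powr - q / q * E"
  shows "L powr p \<le> E powr (p / q) * J"
proof (rule field_le_epsilon)
  fix e0 :: real assume "0 < e0"
  define e where "e = e0 / E powr (p / q)"
  define J' where "J' = J + e"
  have J': "0 < J'" "J \<le> J'" using \<open>0 < e0\<close> E J by (auto simp: J'_def e_def add_nonneg_pos)
  define l where "l = exp ((ln E - ln J') / (p * q))"
  define s where "s = exp (ln J' / p + ln E / q)"
  have pq: "1 / p = 1 - 1 / q" "p \<noteq> 0" "q \<noteq> 0" using p by auto
  have "l powr p * J' = exp ((ln E - ln J') / (p * q) * p + ln J')"
    using J' unfolding l_def exp_powr_real exp_add by simp
  also have "(ln E - ln J') / (p * q) * p + ln J' = ln J' * (1 - 1 / q) + ln E / q"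
    using pq(2,3) by (simp add: field_simps)
  also have "\<dots> = ln J' / p + ln E / q" unfolding pq(1)[symmetric] by simp
  finally have 1: "l powr p * J' = s" by (simp add: s_def)
  have pq': "1 / q = 1 - 1 / p" using pq by simp
  have "l powr - q * E = exp ((ln E - ln J') / (p * q) * - q + ln E)"
    using E unfolding l_def exp_powr_real exp_add by simp
  also have "(ln E - ln J') / (p * q) * - q + ln E = ln J' / p + ln E * (1 - 1 / p)"
    using pq(2,3) by (simp add: field_simps)
  also have "\<dots> = ln J' / p + ln E / q" unfolding pq'[symmetric] by simp
  finally have 2: "l powr - q * E = s" by (simp add: s_def)
  have "L \<le> l powr p / p * J + l powr - q / q * E" by (rule le) (simp add: l_def)
  also have "\<dots> \<le> l powr p / p * J' + l powr - q / q * E"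
    using J' p by (intro add_right_mono mult_left_mono) auto
  also have "\<dots> = (l powr p * J') * (1 / p) + (l powr - q * E) * (1 / q)" by simp
  also have "\<dots> = s * (1 / p + 1 / q)" unfolding 1 2 by (simp only: distrib_left)
  finally have "L \<le> s" using p by simp
  then have "L powr p \<le> s powr p" using L p by (intro powr_mono2) auto
  also have "s powr p = exp (ln J' + p / q * ln E)"
    using pq(2) by (simp add: s_def exp_powr_real field_simps)
  also have "\<dots> = E powr (p / q) * J'"
    using J' E by (simp add: exp_add powr_def)
  also have "\<dots> = E powr (p / q) * J + e0"
    using E by (simp add: J'_def e_def distrib_left)
  finally show "L powr p \<le> E powr (p / q) * J + e0" .
qed

text \<open>Take out of \<open>R\<close> the direction \<open>v = S u\<close>, where \<open>u = g / |g|\<close>, so that the translation is by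
  \<open>|g|\<close> units along a Gaussian ray. The rest of the triplet remains admissible because
  \<open>\<langle>v,x\<rangle>\<^sup>2 = \<langle>u,S x\<rangle>\<^sup>2 \<le> |S x|\<^sup>2 = \<langle>R x,x\<rangle>\<close>.\<close>

lemma levy_translation_harnack:
  fixes M :: "'a::{real_inner, banach, second_countable_topology} measure"
  assumes trip: "levy_triplet M a R m" and p: "1 < p"
    and f: "f \<in> borel_measurable borel" "\<And>x. 0 \<le> f x" "\<And>x. f x \<le> K"
  shows "(\<integral>x. f (x + op_sqrt R g) \<partial>M) powr p
    \<le> exp (p * (norm g)\<^sup>2 / (2 * (p - 1))) * (\<integral>x. f x powr p \<partial>M)"
proof -
  have M: "prob_space M" "sets M = sets borel" and R: "nonneg_symmetric R" and m: "levy_measure m"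
    and cf: "\<And>\<xi>. (\<integral>x. iexp (inner x \<xi>) \<partial>M) = exp (- levy_exponent a R m \<xi>)"
    using trip by (auto simp: levy_triplet_def infinitely_divisible_def)
  define S where "S = op_sqrt R"
  have sym: "\<And>x y. inner (S x) y = inner x (S y)"
    using op_sqrt_properties(1)[OF R] by (simp add: S_def nonneg_symmetric_def)
  define u where "u = g /\<^sub>R norm g"
  define v where "v = S u"
  define c where "c = norm g"
  have u: "norm u \<le> 1" by (cases "g = 0") (simp_all add: u_def)
  have cv: "c *\<^sub>R v = S g"
    by (cases "g = 0") (simp_all add: c_def v_def u_def blinfun.scaleR_right)
  define R' where "R' = R - rank_one v"
  have "(inner v x)\<^sup>2 \<le> inner (R x) x" for x
  proof -
    have "\<bar>inner v x\<bar> \<le> norm u * norm (S x)"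
      by (simp add: v_def sym Cauchy_Schwarz_ineq2)
    also have "\<dots> \<le> norm (S x)" using u by (simp add: mult_left_le_one_le)
    finally have "(inner v x)\<^sup>2 \<le> (norm (S x))\<^sup>2"
      by (metis abs_ge_zero power2_abs power_mono)
    then show ?thesis by (simp add: S_def norm_op_sqrt_sq[OF R])
  qed
  then have R': "nonneg_symmetric R'"
    unfolding R'_def by (intro nonneg_symmetric_diff_rank_one R)
  have cf': "(\<integral>x. iexp (inner \<xi> x) \<partial>M)
      = exp (- levy_exponent a R' m \<xi>) * of_real (exp (- (inner \<xi> v)\<^sup>2 / 2))" for \<xi>
  proof -
    have "- levy_exponent a R m \<xi> = - levy_exponent a R' m \<xi> + of_real (- (inner \<xi> v)\<^sup>2 / 2)"
      unfolding levy_exponent_def R'_def blinfun.diff_left rank_one_apply inner_diff_left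
      by (simp add: power2_eq_square inner_commute diff_divide_distrib)
    then show ?thesis
      unfolding exp_of_real[symmetric] exp_add[symmetric] using cf[of \<xi>] by (simp add: inner_commute)
  qed
  define q where "q = p / (p - 1)"
  have q: "1 < q" "1 / p + 1 / q = 1" using p by (auto simp: q_def field_simps)
  define E where "E = exp (q * (q - 1) * c\<^sup>2 / 2)"
  have "(\<integral>x. f (x + c *\<^sub>R v) \<partial>M) powr p \<le> E powr (p / q) * (\<integral>x. f x powr p \<partial>M)"
  proof (rule Young_optimal[OF p q])
    fix l :: real assume "0 < l"
    have "\<bar>f x\<bar> \<le> K" for x using f by simp
    from gaussian_factor_translation_le[OF M positive_multiplier_levy[OF R' m] cf' p q \<open>0 < l\<close> f(1) this]
    show "(\<integral>x. f (x + c *\<^sub>R v) \<partial>M) \<le> l powr p / p * (\<integral>x. f x powr p \<partial>M) + l powr - q / q * E"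
      by (simp add: f(2) E_def)
  qed (auto simp: f(2) E_def intro!: Bochner_Integration.integral_nonneg)
  also have "E powr (p / q) = exp (p * c\<^sup>2 / (2 * (p - 1)))"
  proof -
    have "q * (q - 1) * c\<^sup>2 / 2 * (p / q) = p * c\<^sup>2 / (2 * (p - 1))"
    proof -
      have "q - 1 = 1 / (p - 1)" using p by (simp add: q_def field_simps)
      moreover have "q * (q - 1) * c\<^sup>2 / 2 * (p / q) = p * c\<^sup>2 / 2 * (q - 1)" using q by simp
      ultimately show ?thesis by simp
    qed
    then show ?thesis by (simp add: E_def exp_powr_real)
  qed
  finally show ?thesis unfolding cv by (simp only: c_def S_def)
qed

lemma levy_power_harnack:
  fixes M :: "'a::{real_inner, banach, second_countable_topology} measure"
  assumes trip: "levy_triplet M a R m" and fin: "Gamma_norm V R < \<infinity>" and p: "1 < p"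
  shows "power_harnack (shift_expectation M V) (enn2real (Gamma_norm V R)) p"
  unfolding power_harnack_def
proof (intro ballI allI)
  have M: "sets M = sets borel" and R: "nonneg_symmetric R"
    using trip by (auto simp: levy_triplet_def infinitely_divisible_def)
  define C where "C = enn2real (Gamma_norm V R)"
  fix f :: "'a \<Rightarrow> real" and x y :: 'a assume "f \<in> bounded_borel_nonneg"
  then obtain K where f: "f \<in> borel_measurable borel" "\<And>x. 0 \<le> f x" "\<And>x. f x \<le> K"
    by (auto simp: bounded_borel_nonneg_def bounded_borel_iff abs_le_iff)
  obtain g where g: "op_sqrt R g = V (x - y)" "norm g \<le> C * norm (x - y)"
    using Gamma_norm_preimage[OF R fin] unfolding C_def by blast
  have fy: "(\<lambda>z. f (V y + z)) \<in> borel_measurable borel"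
    by (intro measurable_compose[OF _ f(1)] borel_measurable_continuous_onI continuous_intros)
  have "shift_expectation M V f x powr p = (\<integral>z. f (V y + (z + op_sqrt R g)) \<partial>M) powr p"
    unfolding shift_expectation_def g(1) by (simp add: blinfun.diff_right algebra_simps)
  also have "\<dots> \<le> exp (p * (norm g)\<^sup>2 / (2 * (p - 1))) * (\<integral>z. f (V y + z) powr p \<partial>M)"
    by (rule levy_translation_harnack[OF trip p fy]) (use f in auto)
  also have "\<dots> \<le> exp (p * (C * norm (x - y))\<^sup>2 / (2 * (p - 1))) * (\<integral>z. f (V y + z) powr p \<partial>M)"
  proof (rule mult_right_mono)
    have "(norm g)\<^sup>2 \<le> (C * norm (x - y))\<^sup>2" using g(2) by (rule power_mono) simp
    then show "exp (p * (norm g)\<^sup>2 / (2 * (p - 1))) \<le> exp (p * (C * norm (x - y))\<^sup>2 / (2 * (p - 1)))"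
      using p by (simp add: divide_right_mono mult_left_mono)
  qed (auto intro!: Bochner_Integration.integral_nonneg)
  finally show "shift_expectation M V f x powr p
      \<le> exp (p * (enn2real (Gamma_norm V R) * norm (x - y))\<^sup>2 / (2 * (p - 1)))
        * shift_expectation M V (\<lambda>z. f z powr p) y"
    by (simp only: shift_expectation_def C_def)
qed

section \<open>Necessity of the range condition in the Gaussian case\<close>

lemma char_fun_cos_integral:
  fixes M :: "'a::{second_countable_topology, real_inner} measure"
  assumes M: "prob_space M" "sets M = sets borel"
    and cf: "(\<integral>x. exp (\<i> * of_real (inner x \<xi>)) \<partial>M) = exp (\<i> * of_real (inner a \<xi>) - of_real q)"
  shows "(\<integral>x. cos (inner (x - a) \<xi>) \<partial>M) = exp (- q)"
proof -
  interpret prob_space M by fact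
  have meas: "(\<lambda>x. exp (\<i> * complex_of_real (inner x \<xi>))) \<in> borel_measurable M"
    unfolding measurable_cong_sets[OF M(2) refl]
    by (intro borel_measurable_continuous_onI continuous_intros)
  have int: "integrable M (\<lambda>x. exp (- (\<i> * complex_of_real (inner a \<xi>))) * exp (\<i> * complex_of_real (inner x \<xi>)))"
    by (intro integrable_mult_right integrable_const_bound[of _ 1] meas) simp_all
  have "(\<integral>x. cos (inner (x - a) \<xi>) \<partial>M)
      = (\<integral>x. Re (exp (- (\<i> * complex_of_real (inner a \<xi>))) * exp (\<i> * complex_of_real (inner x \<xi>))) \<partial>M)"
    by (intro Bochner_Integration.integral_cong refl)
      (simp add: exp_add[symmetric] Re_exp inner_diff_left)
  also have "\<dots> = Re (exp (- (\<i> * complex_of_real (inner a \<xi>))) * exp (\<i> * of_real (inner a \<xi>) - of_real q))"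
    unfolding cf[symmetric] integral_mult_right_zero[symmetric] by (rule integral_Re[OF int])
  also have "\<dots> = exp (- q)"
    by (simp add: exp_add[symmetric] Re_exp)
  finally show ?thesis .
qed

text \<open>If \<open>cos \<theta>\<^sub>n \<rightarrow> 1\<close> then \<open>sin \<theta>\<^sub>n \<rightarrow> 0\<close>, so \<open>cos (\<theta>\<^sub>n + e) \<rightarrow> cos e < 1\<close>.\<close>

lemma cos_shift_not_tendsto_1:
  fixes \<theta> :: "nat \<Rightarrow> real"
  assumes "(\<lambda>n. cos (\<theta> n)) \<longlonglongrightarrow> 1" and e: "0 < e" "e \<le> 1"
  shows "\<not> (\<lambda>n. cos (\<theta> n + e)) \<longlonglongrightarrow> 1"
proof
  assume shifted: "(\<lambda>n. cos (\<theta> n + e)) \<longlonglongrightarrow> 1"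
  have "(\<lambda>n. sqrt (1 - (cos (\<theta> n))\<^sup>2)) \<longlonglongrightarrow> sqrt (1 - 1\<^sup>2)"
    by (intro tendsto_intros assms)
  then have "(\<lambda>n. \<bar>sin (\<theta> n)\<bar>) \<longlonglongrightarrow> 0"
    by (simp add: sin_squared_eq[symmetric])
  then have "(\<lambda>n. sin (\<theta> n)) \<longlonglongrightarrow> 0"
    by (simp add: tendsto_rabs_zero_iff)
  then have "(\<lambda>n. cos (\<theta> n + e)) \<longlonglongrightarrow> 1 * cos e - 0 * sin e"
    unfolding cos_add by (intro tendsto_intros assms)
  from LIMSEQ_unique[OF this shifted] have "cos e = 1" by simp
  moreover have "cos e < cos 0"
    using e pi_gt3 by (intro cos_monotone_0_pi) auto
  ultimately show False by simp
qed

text \<open>Off the range of \<open>S\<close> there are \<open>z\<^sub>n\<close> with \<open>\<langle>V x,z\<^sub>n\<rangle> = 1\<close> and \<open>|S z\<^sub>n| < 2\<^sup>-\<^sup>n\<close>. The expectations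
  of \<open>1 - cos \<langle>y - a,z\<^sub>n\<rangle>\<close> are \<open>1 - exp (- |S z\<^sub>n|\<^sup>2 / 2)\<close>, which are summable, so the set \<open>A\<close>
  where these terms have a finite sum has full measure, while its translates by \<open>\<epsilon> V x\<close> miss it
  for \<open>0 < \<epsilon> \<le> 1\<close>. Working with cosines instead of squares means that nothing but the
  characteristic function is used.\<close>

lemma gaussian_strong_feller_imp_range:
  fixes V R :: "'a::{real_inner, banach, second_countable_topology} \<Rightarrow>\<^sub>L 'a" and M :: "'a measure"
  assumes M: "prob_space M" "sets M = sets borel" and R: "nonneg_symmetric R"
    and cf: "\<And>\<xi>. (\<integral>x. exp (\<i> * of_real (inner x \<xi>)) \<partial>M)
               = exp (\<i> * of_real (inner a \<xi>) - of_real (inner (R \<xi>) \<xi> / 2))"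
    and sf: "strong_feller (\<lambda>f x. \<integral>y. f (V x + y) \<partial>M)"
  shows "range V \<subseteq> range (op_sqrt R)"
proof (rule ccontr)
  interpret prob_space M by fact
  define S where "S = op_sqrt R"
  have sym: "\<And>x y. inner (S x) y = inner x (S y)"
    using op_sqrt_properties(1)[OF R] by (simp add: S_def nonneg_symmetric_def)
  assume "\<not> ?thesis"
  then obtain x where x: "V x \<notin> range S" by (auto simp: S_def)
  have "\<exists>z. inner (V x) z = 1 \<and> norm (S z) < (1/2) ^ n" for n :: nat
  proof -
    obtain w where w: "2 ^ n * norm (S w) < \<bar>inner (V x) w\<bar>"
      using range_criterion[OF sym, of "2 ^ n" "V x"] x by (metis not_le rangeI zero_le_numeral zero_le_power)
    define d where "d = inner (V x) w"
    have "0 \<le> 2 ^ n * norm (S w)" by simp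
    then have d: "d \<noteq> 0" using w unfolding d_def by linarith
    have "norm (S (w /\<^sub>R d)) < (1/2) ^ n"
      using w d by (simp add: blinfun.scaleR_right d_def field_simps)
    moreover have "inner (V x) (w /\<^sub>R d) = 1"
      using d by (simp add: d_def)
    ultimately show ?thesis by blast
  qed
  then obtain z where z: "\<And>n. inner (V x) (z n) = 1" "\<And>n. norm (S (z n)) < (1/2) ^ n"
    by metis
  define h where "h u = (\<Sum>n. ennreal (1 - cos (inner (u - a) (z n))))" for u
  define A where "A = {u. h u < \<infinity>}"
  have hm: "h \<in> borel_measurable borel"
    unfolding h_def by measurable
  then have A: "A \<in> sets borel" unfolding A_def by measurable
  have lim: "(\<lambda>n. cos (inner (u - a) (z n))) \<longlonglongrightarrow> 1" if "u \<in> A" for u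
  proof -
    have "summable (\<lambda>n. 1 - cos (inner (u - a) (z n)))"
      using that by (intro summable_suminf_not_top) (auto simp: A_def h_def)
    from tendsto_diff[OF tendsto_const summable_LIMSEQ_zero[OF this], of 1]
    show ?thesis by simp
  qed
  have shiftA: "u + e *\<^sub>R V x \<notin> A" if "u \<in> A" "0 < e" "e \<le> 1" for u e
  proof
    assume "u + e *\<^sub>R V x \<in> A"
    from lim[OF this] have "(\<lambda>n. cos (inner (u - a) (z n) + e)) \<longlonglongrightarrow> 1"
      by (simp add: inner_add_left inner_diff_left z algebra_simps)
    with cos_shift_not_tendsto_1[OF lim] that show False by blast
  qed
  have "AE u in M. u \<in> A"
  proof -
    have int1: "integrable M (\<lambda>u. cos (inner (u - a) (z n)))" for n
      by (rule integrable_const_bound[of _ 1])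
        (auto simp: measurable_cong_sets[OF M(2) refl])
    have "(\<integral>\<^sup>+u. h u \<partial>M) = (\<Sum>n. \<integral>\<^sup>+u. ennreal (1 - cos (inner (u - a) (z n))) \<partial>M)"
      unfolding h_def by (intro nn_integral_suminf) (simp add: measurable_cong_sets[OF M(2) refl])
    also have "\<dots> \<le> (\<Sum>n. ennreal ((1/2) ^ n))"
    proof (intro suminf_le summableI)
      fix n
      have "(\<integral>\<^sup>+u. ennreal (1 - cos (inner (u - a) (z n))) \<partial>M) = ennreal (\<integral>u. 1 - cos (inner (u - a) (z n)) \<partial>M)"
        using int1 by (intro nn_integral_eq_integral) auto
      also have "(\<integral>u. 1 - cos (inner (u - a) (z n)) \<partial>M) = 1 - exp (- ((norm (S (z n)))\<^sup>2 / 2))"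
        using int1[of n] char_fun_cos_integral[OF M cf]
        by (simp add: prob_space S_def norm_op_sqrt_sq[OF R])
      also have "\<dots> \<le> (norm (S (z n)))\<^sup>2 / 2"
        using exp_ge_add_one_self[of "- ((norm (S (z n)))\<^sup>2 / 2)"] by simp
      also have "\<dots> \<le> ((1/2) ^ n)\<^sup>2"
        using power_mono[OF less_imp_le[OF z(2)[of n]] norm_ge_zero, of 2]
            zero_le_power2[of "norm (S (z n))"] by linarith
      also have "\<dots> \<le> (1/2) ^ n"
        by (simp add: power2_eq_square mult_le_one power_le_one mult_left_le)
      finally show "(\<integral>\<^sup>+u. ennreal (1 - cos (inner (u - a) (z n))) \<partial>M) \<le> ennreal ((1/2) ^ n)"
        using ennreal_leI by blast
    qed
    also have "\<dots> < \<infinity>"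
      by (subst suminf_ennreal2) (auto simp: summable_geometric)
    finally have "(\<integral>\<^sup>+u. h u \<partial>M) \<noteq> \<infinity>" by simp
    then have "AE u in M. h u \<noteq> \<infinity>"
      using hm by (intro nn_integral_noteq_infinite) (simp_all add: measurable_cong_sets[OF M(2) refl])
    then show ?thesis by (simp add: A_def less_top)
  qed
  define p where "p v = (\<integral>y. indicator A (V v + y) \<partial>M :: real)" for v
  have "indicator A \<in> bounded_borel"
    using A by (auto simp: bounded_borel_def bounded_iff intro!: exI[of _ 1])
  then have cont: "continuous_on UNIV p"
    using sf unfolding strong_feller_def p_def by blast
  have "p 0 = (\<integral>y. 1 \<partial>M)"
    unfolding p_def
  proof (rule integral_cong_AE)
    show "AE y in M. indicator A (V 0 + y) = (1::real)"
      using \<open>AE u in M. u \<in> A\<close> by eventually_elim simp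
  qed (use A in \<open>simp_all add: measurable_cong_sets[OF M(2) refl]\<close>)
  then have p0: "p 0 = 1" by (simp add: prob_space)
  have pe: "p (e *\<^sub>R x) = 0" if "0 < e" "e \<le> 1" for e
  proof -
    have "AE y in M. indicator A (V (e *\<^sub>R x) + y) = (0::real)"
      using \<open>AE u in M. u \<in> A\<close>
    proof eventually_elim
      case (elim y)
      from shiftA[OF this that] show ?case
        by (simp add: blinfun.scaleR_right add.commute)
    qed
    then have "p (e *\<^sub>R x) = (\<integral>y. 0 \<partial>M)"
      unfolding p_def
      by (rule integral_cong_AE[rotated 2]) (use A in \<open>simp_all add: measurable_cong_sets[OF M(2) refl]\<close>)
    then show ?thesis by simp
  qed
  have "(\<lambda>n. p (inverse (real (Suc n)) *\<^sub>R x)) \<longlonglongrightarrow> p 0"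
  proof (rule continuous_on_tendsto_compose[OF cont])
    show "(\<lambda>n. inverse (real (Suc n)) *\<^sub>R x) \<longlonglongrightarrow> 0"
      using tendsto_scaleR[OF LIMSEQ_inverse_real_of_nat tendsto_const, of x] by simp
  qed auto
  moreover have "p (inverse (real (Suc n)) *\<^sub>R x) = 0" for n
    by (rule pe) (auto simp: field_simps)
  ultimately show False
    by (simp add: LIMSEQ_const_iff p0)
qed

section \<open>The equivalence theorem\<close>

theorem theorem5p3:
  fixes U :: "real \<Rightarrow> real \<Rightarrow> 'a::{real_inner, banach, polish_space} \<Rightarrow>\<^sub>L 'a"
    and \<mu> :: "real \<Rightarrow> real \<Rightarrow> 'a measure"
    and a :: "real \<Rightarrow> real \<Rightarrow> 'a"
    and R :: "real \<Rightarrow> real \<Rightarrow> 'a \<Rightarrow>\<^sub>L 'a"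
    and m :: "real \<Rightarrow> real \<Rightarrow> 'a measure"
    and s t :: real
  assumes "evolution_family U"
    and "\<And>s t. s \<le> t \<Longrightarrow> levy_triplet (\<mu> t s) (a t s) (R t s) (m t s)"
    and "\<And>s r t. s \<le> r \<Longrightarrow> r \<le> t \<Longrightarrow>
           \<mu> t s = conv (\<mu> t r) (distr (\<mu> r s) borel (blinfun_apply (U t r)))"
    and "s \<le> t"
  shows "let p = transition_op U \<mu> s t;
             \<Gamma>norm = Gamma_norm (U t s) (R t s);
             S1 = (range (blinfun_apply (U t s)) \<subseteq> range (blinfun_apply (op_sqrt (R t s))));
             S2 = (\<Gamma>norm < \<infinity> \<and> (\<forall>\<alpha>>1. power_harnack p (enn2real \<Gamma>norm) \<alpha>));
             S3 = (\<Gamma>norm < \<infinity> \<and> (\<exists>\<alpha>>1. power_harnack p (enn2real \<Gamma>norm) \<alpha>));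
             S4 = (\<Gamma>norm < \<infinity> \<and> log_harnack p (enn2real \<Gamma>norm));
             S5 = strong_feller p
         in (S1 \<longrightarrow> S2) \<and> (S2 \<longrightarrow> S3) \<and> (S3 \<longrightarrow> S4) \<and> (S4 \<longrightarrow> S5) \<and>
            (m t s = null_measure borel \<longrightarrow>
               (S1 \<longleftrightarrow> S2) \<and> (S2 \<longleftrightarrow> S3) \<and> (S3 \<longleftrightarrow> S4) \<and> (S4 \<longleftrightarrow> S5))"
proof -
  define V where "V = U t s"
  define M where "M = \<mu> t s"
  define C where "C = enn2real (Gamma_norm V (R t s))"
  let ?p = "shift_expectation M V"
  have trip: "levy_triplet M (a t s) (R t s) (m t s)"
    unfolding M_def using assms(2,4) by blast
  then have M: "prob_space M" "sets M = sets borel" and R: "nonneg_symmetric (R t s)"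
    and cf: "\<And>\<xi>. (\<integral>x. iexp (inner x \<xi>) \<partial>M) = exp (- levy_exponent (a t s) (R t s) (m t s) \<xi>)"
    by (auto simp: levy_triplet_def infinitely_divisible_def)
  have p: "transition_op U \<mu> s t = ?p"
    by (simp add: fun_eq_iff transition_op_def shift_expectation_def V_def M_def)
  define S1 where "S1 \<longleftrightarrow> range V \<subseteq> range (op_sqrt (R t s))"
  define S2 where "S2 \<longleftrightarrow> Gamma_norm V (R t s) < \<infinity> \<and> (\<forall>\<alpha>>1. power_harnack ?p C \<alpha>)"
  define S3 where "S3 \<longleftrightarrow> Gamma_norm V (R t s) < \<infinity> \<and> (\<exists>\<alpha>>1. power_harnack ?p C \<alpha>)"
  define S4 where "S4 \<longleftrightarrow> Gamma_norm V (R t s) < \<infinity> \<and> log_harnack ?p C"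
  define S5 where "S5 \<longleftrightarrow> strong_feller ?p"
  have 12: "S1 \<longrightarrow> S2"
    unfolding S1_def S2_def C_def using Gamma_norm_finite[OF R] levy_power_harnack[OF trip] by blast
  have 23: "S2 \<longrightarrow> S3"
    unfolding S2_def S3_def by (metis one_less_numeral_iff semiring_norm(76))
  have 34: "S3 \<longrightarrow> S4"
    unfolding S3_def S4_def using power_harnack_imp_log_harnack[OF M] by blast
  have 45: "S4 \<longrightarrow> S5"
    unfolding S4_def S5_def using log_harnack_imp_strong_feller[OF M] by blast
  have 51: "S5 \<longrightarrow> S1" if null: "m t s = null_measure borel"
  proof
    assume S5
    have "(\<integral>x. iexp (inner x \<xi>) \<partial>M) = exp (\<i> * of_real (inner (a t s) \<xi>) - of_real (inner (R t s \<xi>) \<xi> / 2))" for \<xi>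
      unfolding cf by (simp add: levy_exponent_def null integral_null_measure)
    from gaussian_strong_feller_imp_range[OF M R this] \<open>S5\<close> show S1
      unfolding S1_def S5_def shift_expectation_def[abs_def] by blast
  qed
  show ?thesis
    unfolding Let_def p V_def[symmetric] C_def[symmetric] S1_def[symmetric] S2_def[symmetric]
      S3_def[symmetric] S4_def[symmetric] S5_def[symmetric]
    using 12 23 34 45 51 by blast
qed

end
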